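(* Let $\{X_{t,T}\}_{t=1}^{T}$, $T\ge 1$, be a locally stationary functional time series in $L^4_H$: for every $u\in[0,1]$ there is an associated process $\{X_t^{(u)}\}_{t\in\mathbb Z}$ in $L^4_H$ as in the definition of local stationarity with $p=4$ and some $\rho\ge 2$. Assume moreover that for every $u$ the process $\{X_t^{(u)}\}$ is $L^4$-$m$-approximable and $E[X_t^{(u)}]=0$ in $L^2$. Let $K_1:\mathbb R\to\mathbb R$ be symmetric around zero, bounded, Lipschitz continuous, with $K_1(v)=0$ for all $|v|>C_1$ for some $C_1<\infty$, and $\int K_1(z)\,dz=1$. Let $h=h_T>0$ with $h\to0$ as $T\to\infty$, and put $K_{1,h}(x)=K_1(x/h)$. Let $C_u=E[X_t^{(u)}\otimes X_t^{(u)}]$, with eigenvalues $\lambda_{u,1}\ge\lambda_{u,2}\ge\cdots\ge0$ and corresponding orthonormal eigenfunctions $v_{u,j}$, and let $$\hat C_u=\frac1{Th}\sum_{t=1}^{T}K_{1,h}\Big(u-\frac tT\Big)X_{t,T}\otimes X_{t,T}.$$ Let $\hat\lambda_{u,1},\dots,\hat\lambda_{u,q}$ be the $q$ largest eigenvalues of $\hat C_u$ (in descending order), with corresponding orthonormal eigenfunctions $\hat v_{u,1},\dots,\hat v_{u,q}$, so that $\hat C_u(\hat v_{u,j})=\hat\lambda_{u,j}\hat v_{u,j}$, and let $\hat c_{u,j}=\mathrm{sign}(\langle\hat v_{u,j},v_{u,j}\rangle)$. Suppose $\lambda_{u,1}>\lambda_{u,2}>\dots>\lambda_{u,q}>\lambda_{u,q+1}$.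 Then, as $T\to\infty$, for each $u\in[C_1h,1-C_1h]$, $$\max_{1\le j\le q}|\hat\lambda_{u,j}-\lambda_{u,j}|=O_P\Big(h+\sqrt{\tfrac1{Th}}+\tfrac1{Th^2}\Big),$$ $$\max_{1\le j\le q}\|\hat c_{u,j}\hat v_{u,j}-v_{u,j}\|=O_P\Big(h+\sqrt{\tfrac1{Th}}+\tfrac1{Th^2}\Big).$$
   Context: $H=L^2=L^2([0,1]^d)$ is the real Hilbert space with $\langle x,y\rangle=\int_{[0,1]^d}x(t)y(t)\,dt$ and norm $\|\cdot\|$. $L^p_H$ is the space of $H$-valued random functions $X$ on a probability space with $v_p(X)=(E\|X\|^p)^{1/p}<\infty$. $(f\otimes g)(x)=\langle g,x\rangle f$. The statement is pointwise in $u$: $u\in(0,1)$ is fixed, and it lies in $[C_1h,1-C_1h]$ for all large $T$. Local stationarity. $\{X_{t,T}\}_{t=1}^T$ in $L^p_H$ is locally stationary if for each $u\in[0,1]$ there is an $H$-valued process $\{X_t^{(u)}\}_{t\in\mathbb Z}$ in $L^p_H$ such that (i) $\{X_t^{(u)}\}_t$ is strictly stationary; (ii) for all $1\le t\le T$, almost surely $$\|X_{t,T}-X_t^{(u)}\|\le\Big(\Big|\frac tT-u\Big|+\frac1T\Big)U_{t,T}^{(u)},$$ where $U_{t,T}^{(u)}$ are positive random variables with $E[(U_{t,T}^{(u)})^\rho]<C$ for some $\rho>0$ and $C<\infty$ independent of $u,t,T$. $L^p$-$m$-approximability. $\{X_t^{(u)}\}$ is $L^p$-$m$-approximable if $X_t^{(u)}\in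 L^p_H$ has the form $X_t^{(u)}=f_u(\varepsilon_t,\varepsilon_{t-1},\dots)$ with $\varepsilon_j$ i.i.d. elements of a measurable space $S$ and $f_u:S^\infty\to H$ measurable, and, with $\{\varepsilon_{t,k}^{(m)}\}_k$ (for each $t$ and $m$) independent copies of $\{\varepsilon_k\}_k$ defined on the same probability space and $$X_{m,t}^{(u)}=f_u(\varepsilon_t,\dots,\varepsilon_{t-m+1},\varepsilon_{t,t-m}^{(m)},\varepsilon_{t,t-m-1}^{(m)},\dots),$$ one has $\sum_{m\ge1}v_p(X_t^{(u)}-X_{m,t}^{(u)})<\infty$. *)

theory Defs
  imports "HOL-Probability.Probability"
begin

section \<open>The separable real Hilbert space of square integrable functions on the unit cube\<close>

text \<open>The dimension of the cube is the cardinality of the finite index type \<^typ>\<open>'d\<close>,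
  and in \<^term>\<open>cbox 0 1\<close> the 1 is the all-ones vector.\<close>

abbreviation cube_measure :: "(real ^ 'd::finite) measure" where
  "cube_measure \<equiv> lebesgue_on (cbox 0 1)"

definition square_int :: "(real ^ 'd::finite \<Rightarrow> real) \<Rightarrow> bool" where
  "square_int f \<longleftrightarrow> f \<in> borel_measurable cube_measure \<and> integrable cube_measure (\<lambda>x. (f x)\<^sup>2)"

definition l2_eq :: "(real ^ 'd::finite \<Rightarrow> real) \<Rightarrow> (real ^ 'd \<Rightarrow> real) \<Rightarrow> bool" where
  "l2_eq f g \<longleftrightarrow> square_int f \<and> square_int g \<and> (AE x in cube_measure. f x = g x)"

lemma finite_measure_cube: "finite_measure (cube_measure :: (real ^ 'd::finite) measure)"
  by (rule finite_measure_lebesgue_on) auto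

lemma square_int_measurable [measurable_dest]:
  "square_int f \<Longrightarrow> f \<in> borel_measurable cube_measure"
  by (simp add: square_int_def)

lemma square_int_D: "square_int f \<Longrightarrow> integrable cube_measure (\<lambda>x. (f x)\<^sup>2)"
  by (simp add: square_int_def)

lemma square_int_mult:
  assumes "square_int f" "square_int g"
  shows "integrable cube_measure (\<lambda>x. f x * g x)"
proof (rule Bochner_Integration.integrable_bound)
  show "integrable cube_measure (\<lambda>x. (f x)\<^sup>2 + (g x)\<^sup>2)"
    using assms by (simp add: square_int_def)
  show "(\<lambda>x. f x * g x) \<in> borel_measurable cube_measure"
    using assms by (auto simp: square_int_def intro!: borel_measurable_times)
  show "AE x in cube_measure. norm (f x * g x) \<le> norm ((f x)\<^sup>2 + (g x)\<^sup>2)"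
  proof (rule AE_I2)
    fix x
    have "2 * \<bar>f x\<bar> * \<bar>g x\<bar> \<le> \<bar>f x\<bar>\<^sup>2 + \<bar>g x\<bar>\<^sup>2" by (rule sum_squares_bound)
    moreover have "0 \<le> \<bar>f x\<bar> * \<bar>g x\<bar>" by simp
    ultimately have "\<bar>f x\<bar> * \<bar>g x\<bar> \<le> (f x)\<^sup>2 + (g x)\<^sup>2"
      unfolding power2_abs by linarith
    then show "norm (f x * g x) \<le> norm ((f x)\<^sup>2 + (g x)\<^sup>2)"
      by (simp add: abs_mult)
  qed
qed

lemma square_int_add: "square_int f \<Longrightarrow> square_int g \<Longrightarrow> square_int (\<lambda>x. f x + g x)"
  using square_int_mult[of f g]
  by (auto simp: square_int_def power2_sum mult.assoc intro!: borel_measurable_add)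

lemma square_int_scale: "square_int f \<Longrightarrow> square_int (\<lambda>x. c * f x)"
  by (auto simp: square_int_def power_mult_distrib intro!: borel_measurable_times)

lemma square_int_uminus: "square_int f \<Longrightarrow> square_int (\<lambda>x. - f x)"
  using square_int_scale[of f "-1"] by simp

lemma square_int_diff: "square_int f \<Longrightarrow> square_int g \<Longrightarrow> square_int (\<lambda>x. f x - g x)"
  using square_int_add[of f "\<lambda>x. - g x"] square_int_uminus[of g] by simp

lemma square_int_zero: "square_int (\<lambda>x. 0)"
  by (simp add: square_int_def)

quotient_type (overloaded) 'd L2_cube = "real ^ 'd::finite \<Rightarrow> real" / partial: l2_eq
proof (rule part_equivpI)
  show "\<exists>f. l2_eq f f"
    by (rule exI[of _ "\<lambda>x. 0"]) (simp add: l2_eq_def square_int_zero)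
  show "symp l2_eq"
    by (auto simp: symp_def l2_eq_def elim: AE_mp)
  show "transp l2_eq"
    unfolding transp_def l2_eq_def by (auto elim: AE_mp)
qed

instantiation L2_cube :: (finite) real_vector
begin

lift_definition zero_L2_cube :: "'a L2_cube" is "\<lambda>x. 0"
  by (simp add: l2_eq_def square_int_zero)

lift_definition plus_L2_cube :: "'a L2_cube \<Rightarrow> 'a L2_cube \<Rightarrow> 'a L2_cube"
  is "\<lambda>f g x. f x + g x"
  by (auto simp: l2_eq_def intro: square_int_add)

lift_definition minus_L2_cube :: "'a L2_cube \<Rightarrow> 'a L2_cube \<Rightarrow> 'a L2_cube"
  is "\<lambda>f g x. f x - g x"
  by (auto simp: l2_eq_def intro: square_int_diff)

lift_definition uminus_L2_cube :: "'a L2_cube \<Rightarrow> 'a L2_cube"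
  is "\<lambda>f x. - f x"
  by (auto simp: l2_eq_def intro: square_int_uminus)

lift_definition scaleR_L2_cube :: "real \<Rightarrow> 'a L2_cube \<Rightarrow> 'a L2_cube"
  is "\<lambda>c f x. c * f x"
  by (auto simp: l2_eq_def intro: square_int_scale)

instance
proof
  fix x y z :: "'a L2_cube" and a b :: real
  show "x + y + z = x + (y + z)"
    by transfer (auto simp: l2_eq_def intro!: square_int_add)
  show "x + y = y + x"
    by transfer (auto simp: l2_eq_def intro!: square_int_add)
  show "0 + x = x"
    by transfer (auto simp: l2_eq_def)
  show "- x + x = 0"
    by transfer (auto simp: l2_eq_def square_int_zero)
  show "x - y = x + - y"
    by transfer (auto simp: l2_eq_def intro!: square_int_diff)
  show "a *\<^sub>R (x + y) = a *\<^sub>R x + a *\<^sub>R y"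
    by transfer (auto simp: l2_eq_def distrib_left intro!: square_int_scale square_int_add)
  show "(a + b) *\<^sub>R x = a *\<^sub>R x + b *\<^sub>R x"
    by transfer (auto simp: l2_eq_def distrib_right intro!: square_int_scale square_int_add)
  show "a *\<^sub>R b *\<^sub>R x = (a * b) *\<^sub>R x"
    by transfer (auto simp: l2_eq_def intro!: square_int_scale)
  show "1 *\<^sub>R x = x"
    by transfer (auto simp: l2_eq_def)
qed

end

instantiation L2_cube :: (finite) real_inner
begin

lift_definition inner_L2_cube :: "'a L2_cube \<Rightarrow> 'a L2_cube \<Rightarrow> real"
  is "\<lambda>f g. LINT x|cube_measure. f x * g x"
  by (rule integral_cong_AE) (auto simp: l2_eq_def square_int_def)

definition norm_L2_cube :: "'a L2_cube \<Rightarrow> real"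
  where "norm_L2_cube x = sqrt (inner x x)"

definition sgn_L2_cube :: "'a L2_cube \<Rightarrow> 'a L2_cube"
  where "sgn_L2_cube x = x /\<^sub>R norm x"

definition dist_L2_cube :: "'a L2_cube \<Rightarrow> 'a L2_cube \<Rightarrow> real"
  where "dist_L2_cube x y = norm (x - y)"

definition uniformity_L2_cube :: "('a L2_cube \<times> 'a L2_cube) filter"
  where "uniformity_L2_cube = (INF e\<in>{0<..}. principal {(x, y). dist x y < e})"

definition open_L2_cube :: "'a L2_cube set \<Rightarrow> bool"
  where "open_L2_cube U \<longleftrightarrow> (\<forall>x\<in>U. \<forall>\<^sub>F (x', y) in uniformity. x' = x \<longrightarrow> y \<in> U)"

instance
proof
  fix x y z :: "'a L2_cube" and a :: real
  show "inner x y = inner y x"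
    by transfer (simp add: mult.commute)
  show "inner (x + y) z = inner x z + inner y z"
    by transfer (simp add: distrib_right l2_eq_def square_int_mult)
  show "inner (a *\<^sub>R x) y = a * inner x y"
    by transfer (simp add: mult.assoc)
  show "0 \<le> inner x x"
    by transfer (simp add: integral_nonneg_AE)
  show "(inner x x = 0) = (x = 0)"
  proof transfer
    fix f :: "real ^ 'a \<Rightarrow> real" assume "l2_eq f f"
    then have f: "square_int f" by (simp add: l2_eq_def)
    have "(LINT t|cube_measure. f t * f t) = 0 \<longleftrightarrow> (AE t in cube_measure. f t * f t = 0)"
      by (rule integral_nonneg_eq_0_iff_AE) (auto intro: square_int_mult f)
    then show "((LINT t|cube_measure. f t * f t) = 0) = l2_eq f (\<lambda>x. 0)"
      by (simp add: l2_eq_def f square_int_zero)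
  qed
qed (simp_all add: norm_L2_cube_def sgn_L2_cube_def dist_L2_cube_def
      uniformity_L2_cube_def open_L2_cube_def)

end

lemma abs_L2_cube_surj:
  obtains f where "square_int f" "x = abs_L2_cube f"
proof -
  have "l2_eq (rep_L2_cube x) (rep_L2_cube x)" "abs_L2_cube (rep_L2_cube x) = x"
    using Quotient_L2_cube by (auto simp: Quotient_def)
  then show ?thesis using that[of "rep_L2_cube x"] by (auto simp: l2_eq_def)
qed

lemma l2_eq_refl [simp]: "l2_eq f f \<longleftrightarrow> square_int f"
  by (simp add: l2_eq_def)

lemma inner_abs_L2_cube:
  "square_int f \<Longrightarrow> square_int g \<Longrightarrow>
    inner (abs_L2_cube f) (abs_L2_cube g) = (LINT t|cube_measure. f t * g t)"
  by (simp add: inner_L2_cube.abs_eq)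

lemma dist_abs_L2_cube:
  assumes "square_int f" "square_int g"
  shows "dist (abs_L2_cube f) (abs_L2_cube g) = sqrt (LINT t|cube_measure. (f t - g t)\<^sup>2)"
  using assms square_int_diff[OF assms]
  by (simp add: dist_norm norm_eq_sqrt_inner minus_L2_cube.abs_eq inner_abs_L2_cube power2_eq_square)

lemma square_int_integrable:
  "square_int f \<Longrightarrow> integrable cube_measure f"
  unfolding square_int_def
  by (elim conjE finite_measure.square_integrable_imp_integrable[OF finite_measure_cube])

lemma square_int_diff_D:
  "square_int f \<Longrightarrow> square_int g \<Longrightarrow> integrable cube_measure (\<lambda>x. (f x - g x)\<^sup>2)"
  by (rule square_int_D[OF square_int_diff])

lemma l2_complete:
  fixes F :: "nat \<Rightarrow> real ^ 'd::finite \<Rightarrow> real"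
  assumes F: "\<And>n. square_int (F n)"
  assumes C: "\<And>e. e > 0 \<Longrightarrow> \<exists>N. \<forall>i\<ge>N. \<forall>j\<ge>N. (LINT t|cube_measure. (F i t - F j t)\<^sup>2) < e"
  obtains f where "square_int f" "(\<lambda>n. LINT t|cube_measure. (F n t - f t)\<^sup>2) \<longlonglongrightarrow> 0"
proof -
  interpret cube: finite_measure "cube_measure :: (real ^ 'd) measure"
    by (rule finite_measure_cube)
  have F_meas [measurable]: "F n \<in> borel_measurable cube_measure" for n
    using F by (simp add: square_int_def)
  define m where "m = measure (cube_measure :: (real ^ 'd) measure) (space cube_measure) + 1"
  have m: "m > 0" by (simp add: m_def add_nonneg_pos)
  have L1: "\<exists>N. \<forall>i\<ge>N. \<forall>j\<ge>N. (LINT t|cube_measure. norm (F i t - F j t)) < e" if e: "e > 0" for e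
  proof -
    define d where "d = e / (2 * m)"
    have d: "d > 0" using e m by (simp add: d_def)
    obtain N where N: "\<And>i j. i \<ge> N \<Longrightarrow> j \<ge> N \<Longrightarrow> (LINT t|cube_measure. (F i t - F j t)\<^sup>2) < d * e / 2"
      using C[of "d * e / 2"] d e by auto
    show ?thesis
    proof (intro exI allI impI)
      fix i j assume ij: "i \<ge> N" "j \<ge> N"
      let ?g = "\<lambda>t. F i t - F j t"
      have g: "square_int ?g" by (intro square_int_diff F)
      have "(LINT t|cube_measure. norm (?g t)) \<le> (LINT t|cube_measure. (?g t)\<^sup>2 / d + d)"
      proof (rule integral_mono)
        show "integrable cube_measure (\<lambda>t. norm (?g t))"
          using square_int_integrable[OF g] by simp
        show "integrable cube_measure (\<lambda>t. (?g t)\<^sup>2 / d + d)"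
          using square_int_D[OF g] by (simp add: cube.integrable_const)
        fix t
        have "norm (?g t) * d \<le> (?g t)\<^sup>2 + d * d"
        proof -
          have "2 * \<bar>?g t\<bar> * d \<le> \<bar>?g t\<bar>\<^sup>2 + d\<^sup>2" by (rule sum_squares_bound)
          moreover have "0 \<le> \<bar>?g t\<bar> * d" using d by simp
          ultimately show ?thesis
            unfolding power2_abs real_norm_def power2_eq_square[of d] by linarith
        qed
        then show "norm (?g t) \<le> (?g t)\<^sup>2 / d + d"
          using d by (simp add: field_simps)
      qed
      also have "\<dots> = (LINT t|cube_measure. (?g t)\<^sup>2) / d + d * (m - 1)"
        using square_int_D[OF g] by (simp add: cube.integrable_const m_def mult.commute)
      also have "\<dots> < d * e / 2 / d + d * m"
        using N[OF ij] d by (intro add_strict_mono divide_strict_right_mono) auto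
      also have "\<dots> = e" using d m by (simp add: d_def)
      finally show "(LINT t|cube_measure. norm (?g t)) < e" .
    qed
  qed
  obtain r where r: "strict_mono r" "AE t in cube_measure. Cauchy (\<lambda>i. F (r i) t)"
    using cauchy_L1_AE_cauchy_subseq[OF square_int_integrable[OF F] L1] by blast
  define f where "f t = lim (\<lambda>i. F (r i) t)" for t
  have f_meas [measurable]: "f \<in> borel_measurable cube_measure"
    unfolding f_def by measurable
  have conv: "AE t in cube_measure. (\<lambda>i. F (r i) t) \<longlonglongrightarrow> f t"
    using r(2) unfolding f_def
    by eventually_elim (rule convergent_LIMSEQ_iff[THEN iffD1, OF Cauchy_convergent])
  have key: "\<exists>N. \<forall>n\<ge>N. (\<integral>\<^sup>+t. ennreal ((F n t - f t)\<^sup>2) \<partial>cube_measure) \<le> ennreal e" if e: "e > 0" for e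
  proof -
    obtain N where N: "\<And>i j. i \<ge> N \<Longrightarrow> j \<ge> N \<Longrightarrow> (LINT t|cube_measure. (F i t - F j t)\<^sup>2) < e"
      using C[OF e] by auto
    show ?thesis
    proof (intro exI allI impI)
      fix n assume n: "n \<ge> N"
      have "(\<integral>\<^sup>+t. ennreal ((F n t - f t)\<^sup>2) \<partial>cube_measure)
          = (\<integral>\<^sup>+t. liminf (\<lambda>k. ennreal ((F n t - F (r k) t)\<^sup>2)) \<partial>cube_measure)"
      proof (rule nn_integral_cong_AE, use conv in eventually_elim)
        fix t assume "(\<lambda>i. F (r i) t) \<longlonglongrightarrow> f t"
        then have "(\<lambda>k. ennreal ((F n t - F (r k) t)\<^sup>2)) \<longlonglongrightarrow> ennreal ((F n t - f t)\<^sup>2)"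
          by (intro tendsto_intros)
        then show "ennreal ((F n t - f t)\<^sup>2) = liminf (\<lambda>k. ennreal ((F n t - F (r k) t)\<^sup>2))"
          by (metis lim_imp_Liminf trivial_limit_sequentially)
      qed
      also have "\<dots> \<le> liminf (\<lambda>k. \<integral>\<^sup>+t. ennreal ((F n t - F (r k) t)\<^sup>2) \<partial>cube_measure)"
        by (rule nn_integral_liminf) measurable
      also have "\<dots> \<le> ennreal e"
      proof (rule Liminf_le)
        have "\<forall>\<^sub>F k in sequentially. k \<ge> N" by (rule eventually_ge_at_top)
        then show "\<forall>\<^sub>F k in sequentially. (\<integral>\<^sup>+t. ennreal ((F n t - F (r k) t)\<^sup>2) \<partial>cube_measure) \<le> ennreal e"
        proof eventually_elim
          fix k assume "k \<ge> N"
          then have "r k \<ge> N" using seq_suble[OF r(1), of k] by simp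
          then have "(LINT t|cube_measure. (F n t - F (r k) t)\<^sup>2) \<le> e"
            using N[OF n] by (simp add: less_imp_le)
          moreover have "(\<integral>\<^sup>+t. ennreal ((F n t - F (r k) t)\<^sup>2) \<partial>cube_measure)
              = ennreal (LINT t|cube_measure. (F n t - F (r k) t)\<^sup>2)"
            by (rule nn_integral_eq_integral[OF square_int_diff_D[OF F F]]) simp
          ultimately show "(\<integral>\<^sup>+t. ennreal ((F n t - F (r k) t)\<^sup>2) \<partial>cube_measure) \<le> ennreal e"
            by (simp add: ennreal_leI)
        qed
      qed simp
      finally show "(\<integral>\<^sup>+t. ennreal ((F n t - f t)\<^sup>2) \<partial>cube_measure) \<le> ennreal e" .
    qed
  qed
  have sq: "square_int (\<lambda>t. F n t - f t)"
    if "(\<integral>\<^sup>+t. ennreal ((F n t - f t)\<^sup>2) \<partial>cube_measure) \<le> ennreal e" for n e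
  proof -
    have "(\<integral>\<^sup>+t. ennreal (norm ((F n t - f t)\<^sup>2)) \<partial>cube_measure) < \<infinity>"
      using le_less_trans[OF that] by simp
    then have "integrable cube_measure (\<lambda>t. (F n t - f t)\<^sup>2)"
      by (intro integrableI_bounded) auto
    then show ?thesis by (simp add: square_int_def)
  qed
  obtain N where "(\<integral>\<^sup>+t. ennreal ((F N t - f t)\<^sup>2) \<partial>cube_measure) \<le> ennreal 1"
    using key[of 1] by auto
  then have "square_int (\<lambda>t. F N t - f t)" by (rule sq)
  then have f: "square_int f"
    using square_int_diff[OF F[of N]] by fastforce
  have "(\<lambda>n. LINT t|cube_measure. (F n t - f t)\<^sup>2) \<longlonglongrightarrow> 0"
  proof (rule LIMSEQ_I)
    fix e :: real assume e: "e > 0"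
    obtain N where N: "\<And>n. n \<ge> N \<Longrightarrow> (\<integral>\<^sup>+t. ennreal ((F n t - f t)\<^sup>2) \<partial>cube_measure) \<le> ennreal (e/2)"
      using key[of "e/2"] e by auto
    show "\<exists>N. \<forall>n\<ge>N. norm ((LINT t|cube_measure. (F n t - f t)\<^sup>2) - 0) < e"
    proof (intro exI allI impI)
      fix n assume n: "n \<ge> N"
      have "(\<integral>\<^sup>+t. ennreal ((F n t - f t)\<^sup>2) \<partial>cube_measure)
          = ennreal (LINT t|cube_measure. (F n t - f t)\<^sup>2)"
        by (rule nn_integral_eq_integral[OF square_int_diff_D[OF F f]]) simp
      then have "(LINT t|cube_measure. (F n t - f t)\<^sup>2) \<le> e / 2"
        using N[OF n] e by simp
      moreover have "0 \<le> (LINT t|cube_measure. (F n t - f t)\<^sup>2)" by simp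
      ultimately show "norm ((LINT t|cube_measure. (F n t - f t)\<^sup>2) - 0) < e"
        using e by simp
    qed
  qed
  with f show ?thesis by (rule that)
qed

instance L2_cube :: (finite) complete_space
proof
  fix X :: "nat \<Rightarrow> 'a L2_cube" assume X: "Cauchy X"
  have "\<exists>f. square_int f \<and> X n = abs_L2_cube f" for n
    using abs_L2_cube_surj[of "X n"] by metis
  then obtain F where F: "\<And>n. square_int (F n)" "\<And>n. X n = abs_L2_cube (F n)"
    by metis
  have d: "(dist (X i) (X j))\<^sup>2 = (LINT t|cube_measure. (F i t - F j t)\<^sup>2)" for i j
    using F by (simp add: dist_abs_L2_cube)
  have C: "\<exists>N. \<forall>i\<ge>N. \<forall>j\<ge>N. (LINT t|cube_measure. (F i t - F j t)\<^sup>2) < e" if e: "e > 0" for e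
  proof -
    obtain N where N: "\<And>i j. i \<ge> N \<Longrightarrow> j \<ge> N \<Longrightarrow> dist (X i) (X j) < sqrt e"
      using X e unfolding Cauchy_def by (metis real_sqrt_gt_0_iff)
    have "(dist (X i) (X j))\<^sup>2 < e" if "i \<ge> N" "j \<ge> N" for i j
      using N[OF that] e power_strict_mono[of "dist (X i) (X j)" "sqrt e" 2] by simp
    then show ?thesis unfolding d by blast
  qed
  obtain f where f: "square_int f" "(\<lambda>n. LINT t|cube_measure. (F n t - f t)\<^sup>2) \<longlonglongrightarrow> 0"
    by (rule l2_complete[of F, OF F(1) C])
  have "(\<lambda>n. sqrt (LINT t|cube_measure. (F n t - f t)\<^sup>2)) \<longlonglongrightarrow> sqrt 0"
    by (intro tendsto_real_sqrt f)
  then have "(\<lambda>n. dist (X n) (abs_L2_cube f)) \<longlonglongrightarrow> 0"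
    using F f by (simp add: dist_abs_L2_cube)
  then have "X \<longlonglongrightarrow> abs_L2_cube f"
    by (rule tendsto_dist_iff[THEN iffD2])
  then show "convergent X" by (rule convergentI)
qed

instance L2_cube :: (finite) banach ..

definition ind_L2 :: "(real ^ 'd::finite) set \<Rightarrow> 'd L2_cube"
  where "ind_L2 A = abs_L2_cube (indicat_real A)"

lemma square_int_indicator:
  assumes "A \<in> sets lebesgue"
  shows "square_int (indicat_real (A :: (real ^ 'd::finite) set))"
proof -
  interpret cube: finite_measure "cube_measure :: (real ^ 'd) measure"
    by (rule finite_measure_cube)
  have m: "indicat_real A \<in> borel_measurable cube_measure"
    using assms by (intro measurable_restrict_space1 borel_measurable_indicator)
  have "(\<lambda>x. (indicat_real A x)\<^sup>2) = indicat_real A"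
    by (auto simp: indicator_def)
  moreover have "integrable cube_measure (indicat_real A)"
    by (rule cube.integrable_const_bound[where B = 1]) (use m in \<open>auto simp: indicator_def\<close>)
  ultimately show ?thesis using m by (simp add: square_int_def)
qed

lemma ex_countable_dense_L2_cube:
  "\<exists>D :: 'd::finite L2_cube set. countable D \<and> closure D = UNIV"
proof -
  interpret cube: finite_measure "cube_measure :: (real ^ 'd) measure"
    by (rule finite_measure_cube)
  obtain B :: "(real ^ 'd) set set" where B: "countable B" "\<And>X. X \<in> B \<Longrightarrow> open X"
      "\<And>X. open X \<Longrightarrow> \<exists>B'\<subseteq>B. \<Union>B' = X"
    using ex_countable_basis unfolding topological_basis_def by metis
  define V where "V = Union ` {b. finite b \<and> b \<subseteq> B}"
  have V: "countable V"
    unfolding V_def by (intro countable_image countable_Collect_finite_subset B)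
  have V_sets: "A \<in> sets lebesgue" if "A \<in> V" for A
  proof -
    have "open A" using that B(2) by (auto simp: V_def)
    then show ?thesis by simp
  qed
  define g :: "(real \<times> (real ^ 'd) set) list \<Rightarrow> 'd L2_cube"
    where "g l = sum_list (map (\<lambda>(q, A). q *\<^sub>R ind_L2 A) l)" for l
  define D where "D = g ` lists (\<rat> \<times> V)"
  have D: "countable D"
    unfolding D_def by (intro countable_image countable_lists countable_SIGMA countable_rat V)
  have D_add: "x + y \<in> D" if xy: "x \<in> D" "y \<in> D" for x y
  proof -
    obtain k l where "x = g k" "y = g l" "k \<in> lists (\<rat> \<times> V)" "l \<in> lists (\<rat> \<times> V)"
      using xy unfolding D_def by blast
    moreover have "g k + g l = g (k @ l)" by (simp add: g_def)
    ultimately show ?thesis unfolding D_def by (metis append_in_lists_conv imageI)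
  qed
  have D_scale: "q *\<^sub>R x \<in> D" if x: "x \<in> D" and q: "q \<in> \<rat>" for x q
  proof -
    obtain k where k: "x = g k" "k \<in> lists (\<rat> \<times> V)"
      using x unfolding D_def by blast
    have "q *\<^sub>R g k = g (map (\<lambda>(p, A). (q * p, A)) k)"
      unfolding g_def by (induction k) (auto simp: scaleR_add_right)
    moreover have "map (\<lambda>(p, A). (q * p, A)) k \<in> lists (\<rat> \<times> V)"
      using k(2) q by (induction k) auto
    ultimately show ?thesis using k by (auto simp: D_def)
  qed
  have C_add: "x + y \<in> closure D" if xy: "x \<in> closure D" "y \<in> closure D" for x y
  proof -
    obtain s t where "\<And>n. s n \<in> D" "s \<longlonglongrightarrow> x" "\<And>n. t n \<in> D" "t \<longlonglongrightarrow> y"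
      using xy unfolding closure_sequential by metis
    then have "\<And>n. s n + t n \<in> D" "(\<lambda>n. s n + t n) \<longlonglongrightarrow> x + y"
      by (auto intro: D_add tendsto_add)
    then show ?thesis unfolding closure_sequential by (intro exI[of _ "\<lambda>n. s n + t n"]) auto
  qed
  have C_scale: "c *\<^sub>R x \<in> closure D" if x: "x \<in> closure D" for x c
  proof -
    obtain s where s: "\<And>n. s n \<in> D" "s \<longlonglongrightarrow> x"
      using x unfolding closure_sequential by metis
    have "c \<in> closure \<rat>" by (simp add: Rats_closure_real)
    then obtain q where q: "\<And>n. q n \<in> \<rat>" "q \<longlonglongrightarrow> c"
      unfolding closure_sequential by metis
    have "\<And>n. q n *\<^sub>R s n \<in> D" "(\<lambda>n. q n *\<^sub>R s n) \<longlonglongrightarrow> c *\<^sub>R x"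
      using s q by (auto intro: D_scale tendsto_scaleR)
    then show ?thesis unfolding closure_sequential by (intro exI[of _ "\<lambda>n. q n *\<^sub>R s n"]) auto
  qed
  have C_zero: "0 \<in> closure D"
  proof -
    have "g [] \<in> D" unfolding D_def by (rule imageI) simp
    then have "0 \<in> D" by (simp add: g_def)
    then show ?thesis using closure_subset by blast
  qed
  have C_sum: "(\<Sum>i\<in>I. y i) \<in> closure D" if "finite I" "\<And>i. i \<in> I \<Longrightarrow> y i \<in> closure D"
    for I :: "real set" and y
    using that by (induction I) (auto intro: C_zero C_add)
  have C_V: "ind_L2 A \<in> closure D" if "A \<in> V" for A
  proof -
    have "g [(1, A)] \<in> D" unfolding D_def using that by (intro imageI) auto
    then show ?thesis using closure_subset[of D] by (auto simp: g_def)
  qed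
  have dist_ind: "dist (ind_L2 A) (ind_L2 A')
      = sqrt (measure cube_measure ((A - A' \<union> (A' - A)) \<inter> cbox 0 1))"
    if "A \<in> sets lebesgue" "A' \<in> sets lebesgue" for A A' :: "(real ^ 'd) set"
  proof -
    have "(LINT t|cube_measure. (indicat_real A t - indicat_real A' t)\<^sup>2)
        = (LINT t|cube_measure. indicat_real ((A - A') \<union> (A' - A)) t)"
      by (rule Bochner_Integration.integral_cong) (auto simp: indicator_def)
    then show ?thesis
      unfolding ind_L2_def using that
      by (simp add: dist_abs_L2_cube square_int_indicator)
  qed
  have C_ind: "ind_L2 A \<in> closure D" if A: "A \<in> sets lebesgue" for A
  proof -
    have "\<exists>y\<in>closure D. dist y (ind_L2 A) < e" if e: "e > 0" for e
    proof -
      obtain U where U: "open U" "A \<subseteq> U" "U - A \<in> lmeasurable" "emeasure lebesgue (U - A) < ennreal (e\<^sup>2 / 4)"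
        using sets_lebesgue_outer_open[OF A, of "e\<^sup>2/4"] e by auto
      obtain B' where B': "B' \<subseteq> B" "\<Union>B' = U" using B(3)[OF U(1)] by auto
      have cB': "countable (insert {} B')" using B' B(1) countable_subset by auto
      obtain b :: "nat \<Rightarrow> (real ^ 'd) set" where b: "range b = insert {} B'"
        using uncountable_def[of "insert {} B'"] cB' by auto
      define W where "W n = (\<Union>i\<le>n. b i)" for n
      have W_V: "W n \<in> V" for n
      proof -
        have "W n = \<Union>(b ` {..n} - {{}})" by (auto simp: W_def)
        moreover have "b ` {..n} - {{}} \<subseteq> B" using b B' by blast
        ultimately show ?thesis unfolding V_def by blast
      qed
      have W_sets: "W n \<in> sets lebesgue" for n using V_sets W_V by blast
      have W_U: "W n \<subseteq> U" for n
        using b B' unfolding W_def by blast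
      have UW: "(\<Union>n. W n) = U"
      proof -
        have "(\<Union>n. W n) = \<Union>(range b)" unfolding W_def by blast
        then show ?thesis using b B' by simp
      qed
      have U_sets: "U \<in> sets lebesgue" using U(1) by simp
      have "(\<lambda>n. measure cube_measure (W n \<inter> cbox 0 1)) \<longlonglongrightarrow> measure cube_measure (\<Union>n. W n \<inter> cbox 0 1)"
      proof (rule cube.finite_Lim_measure_incseq)
        show "range (\<lambda>n. W n \<inter> cbox 0 1) \<subseteq> sets cube_measure"
          using W_sets by (auto simp: sets_restrict_space)
        show "incseq (\<lambda>n. W n \<inter> cbox 0 1)"
          by (force simp: incseq_def W_def)
      qed
      also have "(\<Union>n. W n \<inter> cbox 0 1) = U \<inter> cbox 0 1" using UW by auto
      finally have lim: "(\<lambda>n. measure cube_measure (W n \<inter> cbox 0 1)) \<longlonglongrightarrow> measure cube_measure (U \<inter> cbox 0 1)" .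
      have "\<exists>n. measure cube_measure (U \<inter> cbox 0 1) - measure cube_measure (W n \<inter> cbox 0 1) < e\<^sup>2 / 4"
      proof -
        have "\<forall>\<^sub>F n in sequentially. measure cube_measure (W n \<inter> cbox 0 1) > measure cube_measure (U \<inter> cbox 0 1) - e\<^sup>2/4"
          using e by (intro order_tendstoD(1)[OF lim]) auto
        then obtain n where "measure cube_measure (W n \<inter> cbox 0 1) > measure cube_measure (U \<inter> cbox 0 1) - e\<^sup>2/4"
          by (auto simp: eventually_sequentially)
        then show ?thesis by (intro exI[of _ n]) simp
      qed
      then obtain n where n: "measure cube_measure (U \<inter> cbox 0 1) - measure cube_measure (W n \<inter> cbox 0 1) < e\<^sup>2 / 4" ..
      have restr: "S \<inter> cbox 0 1 \<in> sets cube_measure" if "S \<in> sets lebesgue" for S :: "(real ^ 'd) set"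
        using that by (auto simp: sets_restrict_space)
      have "measure cube_measure ((U - W n \<union> (W n - U)) \<inter> cbox 0 1)
          = measure cube_measure (U \<inter> cbox 0 1 - W n \<inter> cbox 0 1)"
        using W_U[of n] by (intro arg_cong[where f = "measure cube_measure"]) blast
      also have "\<dots> = measure cube_measure (U \<inter> cbox 0 1) - measure cube_measure (W n \<inter> cbox 0 1)"
        using W_U[of n] by (intro cube.finite_measure_Diff restr U_sets W_sets) auto
      finally have "dist (ind_L2 U) (ind_L2 (W n)) < sqrt (e\<^sup>2 / 4)"
        using n dist_ind[OF U_sets W_sets[of n]] by simp
      then have 1: "dist (ind_L2 (W n)) (ind_L2 U) < e / 2"
        using e by (simp add: real_sqrt_divide dist_commute)
      have "measure cube_measure ((U - A \<union> (A - U)) \<inter> cbox 0 1) = measure lebesgue ((U - A) \<inter> cbox 0 1)"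
        using U(2) A U_sets by (subst measure_restrict_space) (auto intro!: arg_cong[where f = "measure lebesgue"])
      also have "\<dots> \<le> measure lebesgue (U - A)"
        using U(3) A U_sets by (intro measure_mono_fmeasurable) auto
      also have "\<dots> < e\<^sup>2 / 4"
        using U(3,4) e by (simp add: emeasure_eq_measure2 ennreal_less_iff)
      finally have "dist (ind_L2 U) (ind_L2 A) < sqrt (e\<^sup>2 / 4)"
        using dist_ind[OF U_sets A] by simp
      then have 2: "dist (ind_L2 U) (ind_L2 A) < e / 2"
        using e by (simp add: real_sqrt_divide)
      have "dist (ind_L2 (W n)) (ind_L2 A) < e"
        using 1 2 dist_triangle[of "ind_L2 (W n)" "ind_L2 A" "ind_L2 U"] by linarith
      then show ?thesis using C_V[OF W_V] by blast
    qed
    then have "ind_L2 A \<in> closure (closure D)" by (subst closure_approachable) blast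
    then show ?thesis by simp
  qed
  have abs_sum: "abs_L2_cube (\<lambda>t. \<Sum>y\<in>I. y * indicat_real (A y) t) = (\<Sum>y\<in>I. y *\<^sub>R ind_L2 (A y))
      \<and> square_int (\<lambda>t. \<Sum>y\<in>I. y * indicat_real (A y) t)"
    if "finite I" "\<And>y. A y \<in> sets lebesgue" for I and A :: "real \<Rightarrow> (real ^ 'd) set"
    using that(1)
  proof induction
    case empty
    then show ?case by (simp add: square_int_zero zero_L2_cube_def)
  next
    case (insert y I)
    have y: "square_int (\<lambda>t. y * indicat_real (A y) t)"
      using that by (intro square_int_scale square_int_indicator)
    have ay: "abs_L2_cube (\<lambda>t. y * indicat_real (A y) t) = y *\<^sub>R ind_L2 (A y)"
      unfolding ind_L2_def using that by (simp add: scaleR_L2_cube.abs_eq square_int_indicator)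
    define s where "s t = (\<Sum>y\<in>I. y * indicat_real (A y) t)" for t
    have IH: "abs_L2_cube s = (\<Sum>y\<in>I. y *\<^sub>R ind_L2 (A y))" "square_int s"
      using insert.IH unfolding s_def by blast+
    have e: "(\<lambda>t. \<Sum>y\<in>insert y I. y * indicat_real (A y) t) = (\<lambda>t. y * indicat_real (A y) t + s t)"
      unfolding s_def by (rule ext) (rule sum.insert[OF insert.hyps])
    have "abs_L2_cube (\<lambda>t. y * indicat_real (A y) t + s t) = y *\<^sub>R ind_L2 (A y) + abs_L2_cube s"
      unfolding ay[symmetric] using y IH(2) by (simp only: plus_L2_cube.abs_eq l2_eq_refl)
    then show ?case
      unfolding e unfolding sum.insert[OF insert.hyps] IH(1) using square_int_add[OF y IH(2)] by simp
  qed
  have simple: "square_int F \<and> abs_L2_cube F \<in> closure D" if F: "simple_function cube_measure F" for F :: "real ^ 'd \<Rightarrow> real"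
  proof -
    define A where "A y = F -` {y} \<inter> cbox 0 1" for y
    have A: "A y \<in> sets lebesgue" for y
    proof -
      have "A y \<in> sets cube_measure"
        using simple_functionD(2)[OF F, of "{y}"] by (simp add: A_def)
      then show ?thesis by (auto simp: sets_restrict_space intro!: sets.Int)
    qed
    have I: "finite (F ` cbox 0 1)" using simple_functionD(1)[OF F] by simp
    define F' where "F' t = (\<Sum>y\<in>F ` cbox 0 1. y * indicat_real (A y) t)" for t
    have F': "square_int F'" "abs_L2_cube F' = (\<Sum>y\<in>F ` cbox 0 1. y *\<^sub>R ind_L2 (A y))"
      using abs_sum[OF I A] unfolding F'_def by auto
    have eq: "F' t = F t" if t: "t \<in> cbox 0 1" for t
    proof -
      have "F' t = (\<Sum>y\<in>F ` cbox 0 1. if y = F t then F t else 0)"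
        unfolding F'_def by (rule sum.cong) (use t in \<open>auto simp: A_def indicator_def\<close>)
      then show ?thesis using I t by simp
    qed
    have sF: "square_int F"
    proof -
      have "F \<in> borel_measurable cube_measure" by (rule borel_measurable_simple_function[OF F])
      moreover have "integrable cube_measure (\<lambda>t. (F t)\<^sup>2) \<longleftrightarrow> integrable cube_measure (\<lambda>t. (F' t)\<^sup>2)"
        by (rule Bochner_Integration.integrable_cong) (auto simp: eq)
      ultimately show ?thesis using F'(1) by (simp add: square_int_def)
    qed
    have "l2_eq F F'"
      using sF F'(1) unfolding l2_eq_def by (auto intro!: AE_I2 simp: eq)
    then have "abs_L2_cube F = abs_L2_cube F'"
      using Quotient_rel_abs[OF Quotient_L2_cube] by blast
    then show ?thesis using sF F'(2) C_sum[OF I] C_scale C_ind[OF A] by simp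
  qed
  have "x \<in> closure D" for x :: "'d L2_cube"
  proof -
    obtain f where f: "square_int f" "x = abs_L2_cube f" by (rule abs_L2_cube_surj)
    have f_meas [measurable]: "f \<in> borel_measurable cube_measure" using f by (simp add: square_int_def)
    obtain F where F: "\<And>i. simple_function cube_measure (F i)"
        "\<And>t. t \<in> space cube_measure \<Longrightarrow> (\<lambda>i. F i t) \<longlonglongrightarrow> f t"
        "\<And>i t. t \<in> space cube_measure \<Longrightarrow> dist (F i t) 0 \<le> 2 * dist (f t) 0"
      using borel_measurable_implies_sequence_metric[OF f_meas, of 0] by blast
    have F_meas [measurable]: "F i \<in> borel_measurable cube_measure" for i
      by (rule borel_measurable_simple_function[OF F(1)])
    have "(\<lambda>i. LINT t|cube_measure. (F i t - f t)\<^sup>2) \<longlonglongrightarrow> (LINT t|(cube_measure :: (real ^ 'd) measure). 0)"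
    proof (rule integral_dominated_convergence)
      show "integrable cube_measure (\<lambda>t. 9 * (f t)\<^sup>2)" using square_int_D[OF f(1)] by simp
      show "AE t in cube_measure. (\<lambda>i. (F i t - f t)\<^sup>2) \<longlonglongrightarrow> 0"
      proof (rule AE_I2)
        fix t assume t: "t \<in> space (cube_measure :: (real ^ 'd) measure)"
        have "(\<lambda>i. (F i t - f t)\<^sup>2) \<longlonglongrightarrow> (f t - f t)\<^sup>2"
          by (intro tendsto_intros F(2)[OF t])
        then show "(\<lambda>i. (F i t - f t)\<^sup>2) \<longlonglongrightarrow> 0" by simp
      qed
      show "AE t in cube_measure. norm ((F i t - f t)\<^sup>2) \<le> 9 * (f t)\<^sup>2" for i
      proof (rule AE_I2)
        fix t assume t: "t \<in> space (cube_measure :: (real ^ 'd) measure)"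
        have "\<bar>F i t - f t\<bar> \<le> 3 * \<bar>f t\<bar>" using F(3)[OF t, of i] by (simp add: dist_norm)
        then have "\<bar>F i t - f t\<bar>\<^sup>2 \<le> (3 * \<bar>f t\<bar>)\<^sup>2" by (rule power_mono) simp
        then show "norm ((F i t - f t)\<^sup>2) \<le> 9 * (f t)\<^sup>2" by (simp add: power_mult_distrib)
      qed
    qed auto
    then have "(\<lambda>i. sqrt (LINT t|cube_measure. (F i t - f t)\<^sup>2)) \<longlonglongrightarrow> sqrt 0"
      by (intro tendsto_real_sqrt) simp
    then have "(\<lambda>i. dist (abs_L2_cube (F i)) x) \<longlonglongrightarrow> 0"
      using simple[OF F(1)] f by (simp add: dist_abs_L2_cube)
    then have lim: "(\<lambda>i. abs_L2_cube (F i)) \<longlonglongrightarrow> x" by (rule tendsto_dist_iff[THEN iffD2])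
    have "\<And>i. abs_L2_cube (F i) \<in> closure D" using simple[OF F(1)] by blast
    then show ?thesis using lim closed_sequentially[OF closed_closure] by metis
  qed
  then show ?thesis using D by blast
qed

instance L2_cube :: (finite) second_countable_topology
proof
  obtain D :: "'a L2_cube set" where D: "countable D" "closure D = UNIV"
    using ex_countable_dense_L2_cube by blast
  define B where "B = (\<lambda>(x, q). ball x q) ` (D \<times> \<rat>)"
  have "countable B"
    unfolding B_def by (intro countable_image countable_SIGMA D countable_rat)
  moreover have "topological_basis B"
  proof (rule topological_basisI)
    show "open b" if "b \<in> B" for b using that by (auto simp: B_def)
    fix U and x :: "'a L2_cube" assume U: "open U" "x \<in> U"
    obtain e where e: "e > 0" "ball x e \<subseteq> U" using U open_contains_ball by blast
    obtain q where q: "q \<in> \<rat>" "0 < q" "q < e / 2" using Rats_dense_in_real[of 0 "e/2"] e by auto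
    have "x \<in> closure D" using D by simp
    then obtain y where y: "y \<in> D" "dist y x < q" using q closure_approachable[of x D] by blast
    have "ball y q \<subseteq> ball x e"
    proof
      fix z assume "z \<in> ball y q"
      then have "dist y z < q" by simp
      then have "dist x z < e" using y q dist_triangle[of x z y] by (simp add: dist_commute)
      then show "z \<in> ball x e" by simp
    qed
    moreover have "ball y q \<in> B" using y q by (auto simp: B_def)
    moreover have "x \<in> ball y q" using y by simp
    ultimately show "\<exists>b\<in>B. x \<in> b \<and> b \<subseteq> U" using e by blast
  qed
  ultimately show "\<exists>B::'a L2_cube set set. countable B \<and> open = generate_topology B"
    using topological_basis_imp_subbasis by blast
qed

section \<open>Random elements, stationarity and approximability\<close>

definition in_Lp :: "'w measure \<Rightarrow> real \<Rightarrow> ('w \<Rightarrow> 'h::real_normed_vector) \<Rightarrow> bool" where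
  "in_Lp M p X \<longleftrightarrow> X \<in> borel_measurable M \<and> integrable M (\<lambda>w. norm (X w) powr p)"

definition v_norm :: "'w measure \<Rightarrow> real \<Rightarrow> ('w \<Rightarrow> 'h::real_normed_vector) \<Rightarrow> real" where
  "v_norm M p X = (LINT w|M. norm (X w) powr p) powr (1 / p)"

definition strictly_stationary :: "'w measure \<Rightarrow> (int \<Rightarrow> 'w \<Rightarrow> 'h::topological_space) \<Rightarrow> bool" where
  "strictly_stationary M X \<longleftrightarrow>
     (\<forall>J s. finite J \<longrightarrow>
        distr M (PiM J (\<lambda>_. borel)) (\<lambda>w. \<lambda>t\<in>J. X (t + s) w) =
        distr M (PiM J (\<lambda>_. borel)) (\<lambda>w. \<lambda>t\<in>J. X t w))"

text \<open>\<open>X t T\<close> is the array element with time index \<open>t\<close> in row \<open>T\<close> (only \<open>1 \<le> t \<le> T\<close> matters),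
  and \<open>Xs u\<close> is the stationary process associated with the rescaled time \<open>u\<close>.\<close>

definition locally_stationary ::
  "'w measure \<Rightarrow> real \<Rightarrow> real \<Rightarrow> (nat \<Rightarrow> nat \<Rightarrow> 'w \<Rightarrow> 'h::real_normed_vector)
    \<Rightarrow> (real \<Rightarrow> int \<Rightarrow> 'w \<Rightarrow> 'h) \<Rightarrow> bool" where
  "locally_stationary M p \<rho> X Xs \<longleftrightarrow>
     (\<forall>T. \<forall>t\<in>{1..T}. in_Lp M p (X t T)) \<and>
     (\<forall>u\<in>{0..1}. (\<forall>t. in_Lp M p (Xs u t)) \<and> strictly_stationary M (Xs u)) \<and>
     \<rho> > 0 \<and>
     (\<exists>(C::real) (U :: real \<Rightarrow> nat \<Rightarrow> nat \<Rightarrow> 'w \<Rightarrow> real).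
        \<forall>u\<in>{0..1}. \<forall>T. \<forall>t\<in>{1..T}.
          U u t T \<in> borel_measurable M \<and>
          (AE w in M. U u t T w > 0) \<and>
          integrable M (\<lambda>w. U u t T w powr \<rho>) \<and>
          (LINT w|M. U u t T w powr \<rho>) < C \<and>
          (AE w in M. norm (X t T w - Xs u (int t) w)
             \<le> (\<bar>real t / real T - u\<bar> + 1 / real T) * U u t T w))"

definition iid_seq :: "'w measure \<Rightarrow> 's measure \<Rightarrow> (int \<Rightarrow> 'w \<Rightarrow> 's) \<Rightarrow> bool" where
  "iid_seq M S \<epsilon> \<longleftrightarrow>
     prob_space.indep_vars M (\<lambda>_. S) \<epsilon> UNIV \<and> (\<forall>i j. distr M S (\<epsilon> i) = distr M S (\<epsilon> j))"

definition indep_copy ::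
  "'w measure \<Rightarrow> 's measure \<Rightarrow> (int \<Rightarrow> 'w \<Rightarrow> 's) \<Rightarrow> (int \<Rightarrow> 'w \<Rightarrow> 's) \<Rightarrow> bool" where
  "indep_copy M S \<epsilon> \<epsilon>' \<longleftrightarrow>
     prob_space.indep_var M
       (PiM UNIV (\<lambda>_. S)) (\<lambda>w k. \<epsilon> k w) (PiM UNIV (\<lambda>_. S)) (\<lambda>w k. \<epsilon>' k w) \<and>
     distr M (PiM UNIV (\<lambda>_. S)) (\<lambda>w k. \<epsilon>' k w) = distr M (PiM UNIV (\<lambda>_. S)) (\<lambda>w k. \<epsilon> k w)"

text \<open>The innovations \<open>\<epsilon>\<^sub>t, \<dots>, \<epsilon>\<^bsub>t-m+1\<^esub>\<close> are kept, all older ones are replaced by the copy.\<close>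

definition coupled_past ::
  "(int \<Rightarrow> 'w \<Rightarrow> 's) \<Rightarrow> (int \<Rightarrow> 'w \<Rightarrow> 's) \<Rightarrow> int \<Rightarrow> nat \<Rightarrow> 'w \<Rightarrow> nat \<Rightarrow> 's" where
  "coupled_past \<epsilon> \<epsilon>' t m w = (\<lambda>j. if j < m then \<epsilon> (t - int j) w else \<epsilon>' (t - int j) w)"

text \<open>Equality of random variables is almost sure equality. \<open>\<epsilon>' t m\<close> is the copy used for the
  \<open>m\<close>-th approximation at time \<open>t\<close>; the series over \<open>m \<ge> 1\<close> is written with \<open>Suc m\<close>, \<open>m \<ge> 0\<close>.
  The approximations have the law of \<open>X t\<close>, so all the moments in the series are finite.\<close>

definition Lp_m_approximable ::
  "'w measure \<Rightarrow> 's measure \<Rightarrow> real \<Rightarrow> (int \<Rightarrow> 'w \<Rightarrow> 'h::real_normed_vector) \<Rightarrow> bool" where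
  "Lp_m_approximable M S p X \<longleftrightarrow>
     (\<forall>t. in_Lp M p (X t)) \<and>
     (\<exists>(f :: (nat \<Rightarrow> 's) \<Rightarrow> 'h) (\<epsilon> :: int \<Rightarrow> 'w \<Rightarrow> 's) (\<epsilon>' :: int \<Rightarrow> nat \<Rightarrow> int \<Rightarrow> 'w \<Rightarrow> 's).
        f \<in> borel_measurable (PiM UNIV (\<lambda>_. S)) \<and>
        iid_seq M S \<epsilon> \<and>
        (\<forall>t. AE w in M. X t w = f (\<lambda>j. \<epsilon> (t - int j) w)) \<and>
        (\<forall>t. \<forall>m\<ge>1. indep_copy M S \<epsilon> (\<epsilon>' t m)) \<and>
        (\<forall>t. summable (\<lambda>m. v_norm M p
           (\<lambda>w. X t w - f (coupled_past \<epsilon> (\<epsilon>' t (Suc m)) t (Suc m) w)))))"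

section \<open>Covariance operators and their eigensystems\<close>

definition tensor :: "'h::real_inner \<Rightarrow> 'h \<Rightarrow> 'h \<Rightarrow> 'h" where
  "tensor f g x = inner g x *\<^sub>R f"

text \<open>The expectation of the random operator \<open>Y \<otimes> Y\<close> is taken pointwise, as a Bochner integral.\<close>

definition cov_op ::
  "'w measure \<Rightarrow> ('w \<Rightarrow> 'h::{real_inner, second_countable_topology}) \<Rightarrow> 'h \<Rightarrow> 'h" where
  "cov_op M Y x = (LINT w|M. tensor (Y w) (Y w) x)"

definition local_cov ::
  "(real \<Rightarrow> real) \<Rightarrow> (nat \<Rightarrow> real) \<Rightarrow> (nat \<Rightarrow> nat \<Rightarrow> 'w \<Rightarrow> 'h::real_inner)
    \<Rightarrow> real \<Rightarrow> nat \<Rightarrow> 'w \<Rightarrow> 'h \<Rightarrow> 'h" where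
  "local_cov K h X u T w x =
     (1 / (real T * h T)) *\<^sub>R
       (\<Sum>t=1..T. K ((u - real t / real T) / h T) *\<^sub>R tensor (X t T w) (X t T w) x)"

text \<open>\<open>lam 1 \<ge> \<dots> \<ge> lam n\<close> are the \<open>n\<close> largest eigenvalues of the self-adjoint operator \<open>A\<close>, counted
  with multiplicity, and \<open>v 1, \<dots>, v n\<close> are corresponding orthonormal eigenvectors. The last
  conjunct says that no larger eigenvalue, and no further multiplicity of a larger
  eigenvalue, has been left out.\<close>

definition leading_eigensystem ::
  "('h::real_inner \<Rightarrow> 'h) \<Rightarrow> nat \<Rightarrow> (nat \<Rightarrow> real) \<Rightarrow> (nat \<Rightarrow> 'h) \<Rightarrow> bool" where
  "leading_eigensystem A n lam v \<longleftrightarrow>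
     (\<forall>i\<in>{1..n}. \<forall>j\<in>{1..n}. inner (v i) (v j) = (if i = j then 1 else 0)) \<and>
     (\<forall>j\<in>{1..n}. A (v j) = lam j *\<^sub>R v j) \<and>
     (\<forall>i\<in>{1..n}. \<forall>j\<in>{1..n}. i \<le> j \<longrightarrow> lam j \<le> lam i) \<and>
     (\<forall>\<mu> x. x \<noteq> 0 \<and> A x = \<mu> *\<^sub>R x \<and> (\<forall>j\<in>{1..n}. inner x (v j) = 0) \<longrightarrow>
        (\<forall>j\<in>{1..n}. \<mu> \<le> lam j))"

text \<open>The whole non-increasing sequence of eigenvalues: each initial segment consists of the
  largest ones.\<close>

definition full_eigensystem :: "('h::real_inner \<Rightarrow> 'h) \<Rightarrow> (nat \<Rightarrow> real) \<Rightarrow> (nat \<Rightarrow> 'h) \<Rightarrow> bool" where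
  "full_eigensystem A lam v \<longleftrightarrow> (\<forall>n. leading_eigensystem A n lam v)"

section \<open>Stochastic boundedness\<close>

text \<open>Outer probabilities are used so that the notion is meaningful without a measurability
  assumption (a selection of eigenfunctions need not be measurable); for random variables
  it is the usual one, by the lemma below.\<close>

definition big_O_P :: "'w measure \<Rightarrow> (nat \<Rightarrow> 'w \<Rightarrow> real) \<Rightarrow> (nat \<Rightarrow> real) \<Rightarrow> bool" where
  "big_O_P M Y a \<longleftrightarrow>
     (\<forall>e>0. \<exists>B>0. \<forall>\<^sub>F T in sequentially.
        \<exists>E\<in>sets M. {w \<in> space M. \<bar>Y T w\<bar> > B * a T} \<subseteq> E \<and> measure M E < e)"

lemma big_O_P_iff:
  assumes "prob_space M" and Y [measurable]: "\<And>T. Y T \<in> borel_measurable M"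
  shows "big_O_P M Y a \<longleftrightarrow>
     (\<forall>e>0. \<exists>B>0. \<forall>\<^sub>F T in sequentially. measure M {w \<in> space M. \<bar>Y T w\<bar> > B * a T} < e)"
proof -
  interpret prob_space M by fact
  have "(\<exists>E\<in>sets M. {w \<in> space M. \<bar>Y T w\<bar> > b} \<subseteq> E \<and> measure M E < e)
      \<longleftrightarrow> measure M {w \<in> space M. \<bar>Y T w\<bar> > b} < e" for T b e
  proof
    assume "\<exists>E\<in>sets M. {w \<in> space M. \<bar>Y T w\<bar> > b} \<subseteq> E \<and> measure M E < e"
    then show "measure M {w \<in> space M. \<bar>Y T w\<bar> > b} < e"
      by (meson finite_measure_mono le_less_trans)
  next
    have "{w \<in> space M. \<bar>Y T w\<bar> > b} \<in> sets M" by measurable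
    moreover assume "measure M {w \<in> space M. \<bar>Y T w\<bar> > b} < e"
    ultimately show "\<exists>E\<in>sets M. {w \<in> space M. \<bar>Y T w\<bar> > b} \<subseteq> E \<and> measure M E < e" by blast
  qed
  then show ?thesis by (simp add: big_O_P_def)
qed

end

theory Submission
  imports Defs "HOL-Library.Diagonal_Subsequence"
begin

text \<open>Let \<open>\<Delta>\<close> be the operator norm of the difference between the estimated and the true
  covariance operator. Eigenvalues differ by at most \<open>\<Delta>\<close> (Courant--Fischer) and, after fixing the
  sign, eigenvectors by at most a multiple of \<open>\<Delta>\<close> depending on the spectral gaps; both bounds are
  deterministic. To bound \<open>\<Delta>\<close>, local stationarity replaces \<open>X t T\<close> by the stationary process at a
  cost of order \<open>h + 1/T\<close> in mean, and the Riemann sum of the Lipschitz kernel has error of order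
  \<open>1/(T h\<^sup>2)\<close>. The fluctuation of the stationary estimator is measured in Hilbert--Schmidt norm:
  its second moment is a double sum of autocovariances of \<open>X \<otimes> X\<close>, and coupling with the \<open>m\<close>-th
  approximation bounds the lag-\<open>m\<close> autocovariance by a multiple of \<open>v\<^sub>4(X\<^sub>0 - X\<^bsub>m,0\<^esub>)\<close>,
  which is summable.\<close>

section \<open>Spectral perturbation\<close>

text \<open>\<open>leading_eigensystem\<close> speaks of eigenvectors only, whereas min-max
  arguments need bounds on the quadratic form. The link is
  \<open>quadratic_form_sup_attained\<close>: a form bound that failed would produce a further
  eigenvector. Attainment rests on compactness and on a positive supremum, so leading eigenvalues
  must be known to be nonnegative. For the estimator this is not automatic: \<open>K\<close> may
  take negative values, and \<open>local_cov\<close> then need not be positive semidefinite. It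
  follows from finite rank in an infinite-dimensional space, where 0 is always a competing
  eigenvalue. All randomness is confined to an event on which one inequality holds for every
  \<open>x\<close>. To obtain it, the full Hilbert--Schmidt norm is never formed: its finite
  sections are bounded in mean, uniformly in \<open>N\<close>, and their increasing exceedance
  events are united. Summing over matrix entries inside the expectation keeps the covariance bounds
  free of \<open>N\<close>. The coupling works because the \<open>m\<close>-th approximation at time
  0 shares no innovation with the process at time \<open>- m\<close>, while its law is that of the
  process.\<close>

lemma homogeneous_system_nontrivial:
  fixes a :: "'i \<Rightarrow> 'k \<Rightarrow> 'f::field"
  assumes "finite K" "finite I" "card K < card I"
  shows "\<exists>c. (\<exists>i\<in>I. c i \<noteq> 0) \<and> (\<forall>k\<in>K. (\<Sum>i\<in>I. c i * a i k) = 0)"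
  using assms
proof (induction K arbitrary: I a rule: finite_induct)
  case empty
  then obtain i where "i \<in> I" by fastforce
  then show ?case by (intro exI[of _ "\<lambda>_. 1"]) auto
next
  case (insert k K)
  show ?case
  proof (cases "\<forall>i\<in>I. a i k = 0")
    case True
    then have "(\<Sum>i\<in>I. c i * a i k) = 0" for c
      by (intro sum.neutral) auto
    moreover have "card K < card I" using insert by simp
    ultimately show ?thesis using insert.IH[OF insert.prems(1), of a] by auto
  next
    case False
    then obtain i0 where i0: "i0 \<in> I" "a i0 k \<noteq> 0" by blast
    define I' where "I' = I - {i0}"
    have fI': "finite I'" and cI': "card K < card I'"
      using insert i0 by (auto simp: I'_def)
    \<comment> \<open>Gaussian elimination with pivot \<open>i0\<close>: equation \<open>k\<close>
      is solved for the unknown at \<open>i0\<close>, and \<open>b\<close> holds the coefficients of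
      the other equations after substitution. Below, \<open>d\<close> restores the eliminated
      unknown.\<close>
    define b where "b i l = a i l - a i k / a i0 k * a i0 l" for i l
    obtain c where c: "\<exists>i\<in>I'. c i \<noteq> 0" "\<And>l. l \<in> K \<Longrightarrow> (\<Sum>i\<in>I'. c i * b i l) = 0"
      using insert.IH[OF fI' cI', of b] by blast
    define d where "d = c(i0 := - (\<Sum>i\<in>I'. c i * a i k) / a i0 k)"
    have sumd: "(\<Sum>i\<in>I. d i * a i l) = d i0 * a i0 l + (\<Sum>i\<in>I'. c i * a i l)" for l
    proof -
      have "(\<Sum>i\<in>I. d i * a i l) = d i0 * a i0 l + (\<Sum>i\<in>I'. d i * a i l)"
        unfolding I'_def by (rule sum.remove) (use insert.prems i0 in auto)
      also have "(\<Sum>i\<in>I'. d i * a i l) = (\<Sum>i\<in>I'. c i * a i l)"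
        by (rule sum.cong) (auto simp: d_def I'_def)
      finally show ?thesis .
    qed
    show ?thesis
    proof (intro exI[of _ d] conjI ballI)
      show "\<exists>i\<in>I. d i \<noteq> 0" using c(1) by (auto simp: d_def I'_def)
      fix l assume l: "l \<in> insert k K"
      show "(\<Sum>i\<in>I. d i * a i l) = 0"
      proof (cases "l = k")
        case True
        then show ?thesis using i0 unfolding sumd by (simp add: d_def)
      next
        case False
        then have "(\<Sum>i\<in>I'. c i * b i l) = 0" using l c(2) by auto
        moreover have "(\<Sum>i\<in>I'. c i * b i l) =
            (\<Sum>i\<in>I'. c i * a i l) - (\<Sum>i\<in>I'. c i * a i k) / a i0 k * a i0 l"
          by (simp add: b_def right_diff_distrib sum_subtractf sum_distrib_right sum_divide_distrib mult.assoc)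
        ultimately show ?thesis unfolding sumd by (simp add: d_def)
      qed
    qed
  qed
qed

text \<open>Compactness of an operator as weak-to-norm sequential continuity. Weak convergence is
  expressed by convergence of all scalar products, so no weak limit has to be produced.\<close>

definition completely_continuous :: "('h::real_inner \<Rightarrow> 'g::real_normed_vector) \<Rightarrow> bool" where
  "completely_continuous A \<longleftrightarrow>
     (\<forall>x. bounded (range x) \<longrightarrow> (\<forall>y. convergent (\<lambda>k::nat. inner (x k) y)) \<longrightarrow> convergent (\<lambda>k. A (x k)))"

text \<open>A diagonal subsequence makes the scalar products with a countable dense set converge.
  Boundedness carries this to every \<open>y\<close>: moving \<open>y\<close> to a nearby
  \<open>z\<close> in the dense set changes each scalar product by less than \<open>e / 4\<close>,
  which leaves \<open>e / 2\<close> for the Cauchy property at \<open>z\<close>.\<close>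

lemma bounded_weakly_convergent_subsequence:
  fixes x :: "nat \<Rightarrow> 'h::{real_inner, second_countable_topology}"
  assumes "bounded (range x)"
  obtains r :: "nat \<Rightarrow> nat" where "strict_mono r" "\<And>y. convergent (\<lambda>k. inner (x (r k)) y)"
proof -
  obtain b where b: "b > 0" "\<And>k. norm (x k) \<le> b"
    using assms unfolding bounded_pos by auto
  obtain D :: "'h set" where D: "countable D" "\<And>U. open U \<Longrightarrow> U \<noteq> {} \<Longrightarrow> \<exists>d\<in>D. d \<in> U"
    by (rule countable_dense_setE) blast
  have "D \<noteq> {}" using D(2)[of UNIV] by auto
  define d where "d = from_nat_into D"
  let ?P = "\<lambda>n s. convergent (\<lambda>k. inner (x (s k)) (d n))"
  interpret subseqs ?P
  proof
    fix n :: nat and s :: "nat \<Rightarrow> nat" assume "strict_mono s"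
    have "bounded (range (\<lambda>k. inner (x (s k)) (d n)))"
      unfolding bounded_iff
    proof (intro exI[of _ "b * norm (d n)"] ballI)
      fix z assume "z \<in> range (\<lambda>k. inner (x (s k)) (d n))"
      then obtain k where "z = inner (x (s k)) (d n)" by blast
      then have "norm z \<le> norm (x (s k)) * norm (d n)" by (simp add: Cauchy_Schwarz_ineq2)
      also have "\<dots> \<le> b * norm (d n)" by (intro mult_right_mono b) simp
      finally show "norm z \<le> b * norm (d n)" .
    qed
    then obtain l r where "strict_mono r" "((\<lambda>k. inner (x (s k)) (d n)) \<circ> r) \<longlonglongrightarrow> l"
      using bounded_imp_convergent_subsequence by blast
    then show "\<exists>r'. strict_mono r' \<and> ?P n (s \<circ> r')"
      by (auto simp: convergent_def o_def)
  qed
  have conv: "?P n diagseq" for n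
  proof -
    \<comment> \<open>\<open>diagseq\<close> is known to inherit the \<open>n\<close>-th property
      only from index \<open>Suc n\<close> on, which suffices for convergence.\<close>
    have "?P n (diagseq \<circ> ((+) (Suc n)))"
    proof (rule diagseq_holds)
      fix r s :: "nat \<Rightarrow> nat" and n assume "strict_mono r" "?P n s"
      then show "?P n (s \<circ> r)"
        using convergent_subseq_convergent[of "\<lambda>k. inner (x (s k)) (d n)" r] by (simp add: o_def)
    qed
    then have "convergent (\<lambda>k. inner (x (diagseq (k + Suc n))) (d n))"
      by (simp add: o_def add.commute)
    then show ?thesis
      by (simp only: convergent_ignore_initial_segment[of "\<lambda>k. inner (x (diagseq k)) (d n)"])
  qed
  have "convergent (\<lambda>k. inner (x (diagseq k)) y)" for y
  proof -
    have "Cauchy (\<lambda>k. inner (x (diagseq k)) y)"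
    proof (rule metric_CauchyI)
      fix e :: real assume e: "e > 0"
      have "e / (4 * b) > 0" using e b by simp
      then have "ball y (e / (4 * b)) \<noteq> {}" by (simp only: ball_eq_empty not_le)
      then obtain z where z: "z \<in> D" "z \<in> ball y (e / (4 * b))" using D(2) open_ball by blast
      obtain n where n: "z = d n"
        using z(1) D(1) \<open>D \<noteq> {}\<close> unfolding d_def by (metis from_nat_into_surj)
      have near: "\<bar>inner (x k) y - inner (x k) z\<bar> < e / 4" for k
      proof -
        have "\<bar>inner (x k) y - inner (x k) z\<bar> \<le> norm (x k) * norm (y - z)"
          by (simp add: inner_diff_right[symmetric] Cauchy_Schwarz_ineq2)
        also have "\<dots> \<le> b * norm (y - z)" by (intro mult_right_mono b) simp
        also have "\<dots> < b * (e / (4 * b))"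
          using z(2) b by (intro mult_strict_left_mono) (auto simp: dist_norm)
        also have "\<dots> = e / 4" using b by simp
        finally show ?thesis .
      qed
      have "Cauchy (\<lambda>k. inner (x (diagseq k)) z)"
        using conv[of n] n by (simp add: Cauchy_convergent_iff)
      then obtain N where N: "\<And>i j. i \<ge> N \<Longrightarrow> j \<ge> N \<Longrightarrow>
          dist (inner (x (diagseq i)) z) (inner (x (diagseq j)) z) < e / 2"
        using e unfolding Cauchy_def by (meson half_gt_zero)
      show "\<exists>N. \<forall>i\<ge>N. \<forall>j\<ge>N. dist (inner (x (diagseq i)) y) (inner (x (diagseq j)) y) < e"
      proof (intro exI[of _ N] allI impI)
        fix i j assume "i \<ge> N" "j \<ge> N"
        from N[OF this] near[of "diagseq i"] near[of "diagseq j"]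
        show "dist (inner (x (diagseq i)) y) (inner (x (diagseq j)) y) < e"
          unfolding dist_real_def by linarith
      qed
    qed
    then show ?thesis by (simp add: Cauchy_convergent_iff)
  qed
  then show thesis using that subseq_diagseq by blast
qed

text \<open>For a maximising sequence of unit vectors in \<open>V\<close>,
  \<open>s *\<^sub>R x k - A (x k)\<close> tends to 0. Along a weakly convergent subsequence
  \<open>A (x (r k))\<close> converges, and dividing by \<open>s\<close> turns this into norm
  convergence of \<open>x (r k)\<close>; the limit is the eigenvector. The hypothesis
  \<open>\<mu> \<ge> 0\<close> makes \<open>s\<close> positive for that division.\<close>

lemma quadratic_form_sup_attained:
  fixes A :: "'h::{real_inner, second_countable_topology} \<Rightarrow> 'h"
  assumes A: "bounded_linear A" "completely_continuous A"
    and adj: "\<And>x y. inner (A x) y = inner x (A y)"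
    and V: "subspace V" "closed V" "\<And>x. x \<in> V \<Longrightarrow> A x \<in> V"
    and x0: "x\<^sub>0 \<in> V" "inner (A x\<^sub>0) x\<^sub>0 > \<mu> * (norm x\<^sub>0)\<^sup>2" and mu: "\<mu> \<ge> 0"
  obtains s y where "s > \<mu>" "y \<in> V" "y \<noteq> 0" "A y = s *\<^sub>R y"
proof -
  interpret A: bounded_linear A by fact
  define Q where "Q = (\<lambda>x. inner (A x) x) ` {x \<in> V. norm x = 1}"
  have Abd: "inner (A x) x \<le> onorm A * (norm x)\<^sup>2" for x
  proof -
    have "inner (A x) x \<le> norm (A x) * norm x" by (rule norm_cauchy_schwarz)
    also have "\<dots> \<le> onorm A * norm x * norm x" by (intro mult_right_mono onorm A) simp
    finally show ?thesis by (simp add: power2_eq_square)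
  qed
  have nAbd: "- inner (A x) x \<le> onorm A * (norm x)\<^sup>2" for x
  proof -
    have "\<bar>inner (A x) x\<bar> \<le> norm (A x) * norm x" by (rule Cauchy_Schwarz_ineq2)
    also have "\<dots> \<le> onorm A * norm x * norm x" by (intro mult_right_mono onorm A) simp
    finally show ?thesis by (simp add: power2_eq_square)
  qed
  have bdd: "bdd_above Q"
    unfolding Q_def bdd_above_def
  proof (intro exI[of _ "onorm A"] ballI)
    fix z assume "z \<in> (\<lambda>x. inner (A x) x) ` {x \<in> V. norm x = 1}"
    then obtain x where "z = inner (A x) x" "norm x = 1" by auto
    then show "z \<le> onorm A" using Abd[of x] by simp
  qed
  have x00: "x\<^sub>0 \<noteq> 0" using x0(2) by (auto simp: A.zero)
  define s where "s = Sup Q"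
  have hom: "inner (A x) x = (norm x)\<^sup>2 * inner (A (sgn x)) (sgn x)" if "x \<noteq> 0" for x
  proof -
    have "x = norm x *\<^sub>R sgn x" by (simp add: sgn_div_norm that)
    then have "inner (A x) x = inner (A (norm x *\<^sub>R sgn x)) (norm x *\<^sub>R sgn x)" by simp
    then show ?thesis by (simp add: A.scaleR power2_eq_square)
  qed
  have sgnV: "sgn x \<in> V \<and> norm (sgn x) = 1" if "x \<in> V" "x \<noteq> 0" for x
    using that V(1) by (simp add: sgn_div_norm subspace_scale)
  have Qs: "inner (A x) x \<le> s * (norm x)\<^sup>2" if "x \<in> V" for x
  proof (cases "x = 0")
    case False
    have "inner (A (sgn x)) (sgn x) \<in> Q" using sgnV[OF that False] by (auto simp: Q_def)
    then have "inner (A (sgn x)) (sgn x) \<le> s" unfolding s_def by (rule cSup_upper[OF _ bdd])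
    then have "(norm x)\<^sup>2 * inner (A (sgn x)) (sgn x) \<le> (norm x)\<^sup>2 * s"
      by (intro mult_left_mono) auto
    then show ?thesis unfolding hom[OF False] by (simp add: mult.commute)
  qed (simp add: A.zero)
  have Qne: "Q \<noteq> {}" using sgnV[OF x0(1) x00] by (auto simp: Q_def)
  have s_mu: "s > \<mu>"
  proof -
    have "\<mu> * (norm x\<^sub>0)\<^sup>2 < s * (norm x\<^sub>0)\<^sup>2" using Qs[OF x0(1)] x0(2) by linarith
    then show ?thesis using x00 by simp
  qed
  have "\<exists>x. x \<in> V \<and> norm x = 1 \<and> inner (A x) x > s - 1 / real (Suc k)" for k
  proof -
    have "s - 1 / real (Suc k) < Sup Q" by (simp add: s_def)
    then obtain z where "z \<in> Q" "s - 1 / real (Suc k) < z" using Qne by (metis less_cSupE)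
    then show ?thesis by (auto simp: Q_def)
  qed
  then obtain x where x: "\<And>k. x k \<in> V" "\<And>k. norm (x k) = 1"
      "\<And>k. inner (A (x k)) (x k) > s - 1 / real (Suc k)"
    by metis
  have "bounded (range x)" by (rule boundedI[of _ 1]) (auto simp: x)
  then obtain r where r: "strict_mono r" "\<And>y. convergent (\<lambda>k. inner (x (r k)) y)"
    by (rule bounded_weakly_convergent_subsequence) blast
  have bxr: "bounded (range (\<lambda>k. x (r k)))" by (rule boundedI[of _ 1]) (auto simp: x)
  have "convergent (\<lambda>k. A (x (r k)))"
    using A(2) r(2) bxr unfolding completely_continuous_def by blast
  then obtain z where z: "(\<lambda>k. A (x (r k))) \<longlonglongrightarrow> z" by (auto simp: convergent_def)
  \<comment> \<open>Bounds the form of \<open>s - A\<close> from above. With step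
    \<open>1 / c\<close> the quadratic term cancels half of the linear one, leaving
    \<open>- (1 / c) * (norm (g k))\<^sup>2\<close>.\<close>
  define c where "c = s + onorm A"
  have c: "c > 0" using s_mu mu onorm_pos_le[OF A(1)] by (simp add: c_def)
  define g where "g k = s *\<^sub>R x k - A (x k)" for k
  text \<open>Cauchy--Schwarz for the form of \<open>s - A\<close>, which is nonnegative on \<open>V\<close>: expand it at
    \<open>x k - g k / c\<close>.\<close>
  have gbd: "(norm (g k))\<^sup>2 \<le> c * (1 / real (Suc k))" for k
  proof -
    have gV: "g k \<in> V" unfolding g_def using x(1) V by (intro subspace_diff subspace_scale) auto
    have "0 \<le> s * (norm (x k - (1/c) *\<^sub>R g k))\<^sup>2 - inner (A (x k - (1/c) *\<^sub>R g k)) (x k - (1/c) *\<^sub>R g k)"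
      using Qs[of "x k - (1/c) *\<^sub>R g k"] x(1) gV V(1) by (simp add: subspace_diff subspace_scale)
    also have "\<dots> = (s - inner (A (x k)) (x k)) - 2 / c * (s * inner (x k) (g k) - inner (A (x k)) (g k))
        + (1/c)\<^sup>2 * (s * (norm (g k))\<^sup>2 - inner (A (g k)) (g k))"
    proof -
      have "inner (A (g k)) (x k) = inner (A (x k)) (g k)" by (metis adj inner_commute)
      then have expand_A: "inner (A (x k - (1/c) *\<^sub>R g k)) (x k - (1/c) *\<^sub>R g k) =
          inner (A (x k)) (x k) - 2 / c * inner (A (x k)) (g k) + (1/c)\<^sup>2 * inner (A (g k)) (g k)"
        by (simp add: A.diff A.scaleR inner_diff_left inner_diff_right power2_eq_square algebra_simps)
      have expand_norm: "(norm (x k - (1/c) *\<^sub>R g k))\<^sup>2 =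
          1 - 2 / c * inner (x k) (g k) + (1/c)\<^sup>2 * (norm (g k))\<^sup>2"
      proof -
        have "inner (x k) (x k) = 1" by (simp add: x power2_norm_eq_inner[symmetric])
        then show ?thesis
          unfolding power2_norm_eq_inner
          by (simp add: inner_diff_left inner_diff_right inner_commute[of "g k" "x k"]
              power2_eq_square algebra_simps)
      qed
      show ?thesis unfolding expand_A expand_norm by (simp add: algebra_simps)
    qed
    also have "s * inner (x k) (g k) - inner (A (x k)) (g k) = (norm (g k))\<^sup>2"
      by (simp add: g_def power2_norm_eq_inner inner_diff_left)
    also have "s * (norm (g k))\<^sup>2 - inner (A (g k)) (g k) \<le> c * (norm (g k))\<^sup>2"
      using nAbd[of "g k"] by (simp add: c_def algebra_simps)
    finally have "0 \<le> (s - inner (A (x k)) (x k)) - 2 / c * (norm (g k))\<^sup>2 + (1/c)\<^sup>2 * (c * (norm (g k))\<^sup>2)"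
      using c by (simp add: mult_left_mono)
    also have "(1/c)\<^sup>2 * (c * (norm (g k))\<^sup>2) = 1 / c * (norm (g k))\<^sup>2"
      using c by (simp add: power2_eq_square)
    finally have "1 / c * (norm (g k))\<^sup>2 \<le> s - inner (A (x k)) (x k)" by (simp add: algebra_simps)
    also have "\<dots> \<le> 1 / real (Suc k)" using x(3)[of k] by simp
    finally show ?thesis using c by (simp add: field_simps)
  qed
  have "(\<lambda>k. (norm (g k))\<^sup>2) \<longlonglongrightarrow> 0"
  proof (rule tendsto_sandwich[of "\<lambda>_. 0" _ _ "\<lambda>k. c * (1 / real (Suc k))"])
    have "(\<lambda>k. c * (1 / real (Suc k))) \<longlonglongrightarrow> c * 0"
      using LIMSEQ_inverse_real_of_nat by (intro tendsto_mult_left) (simp add: divide_inverse)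
    then show "(\<lambda>k. c * (1 / real (Suc k))) \<longlonglongrightarrow> 0" by simp
  qed (use gbd in auto)
  then have "(\<lambda>k. norm (g k)) \<longlonglongrightarrow> 0"
    using tendsto_real_sqrt by fastforce
  then have "g \<longlonglongrightarrow> 0" by (rule tendsto_norm_zero_cancel)
  then have gr: "(\<lambda>k. g (r k)) \<longlonglongrightarrow> 0"
    using LIMSEQ_subseq_LIMSEQ[OF _ r(1), of g 0] by (simp add: o_def)
  define y where "y = (1 / s) *\<^sub>R z"
  have s0: "s > 0" using s_mu mu by simp
  have xr: "(\<lambda>k. x (r k)) \<longlonglongrightarrow> y"
  proof -
    have "(\<lambda>k. (1 / s) *\<^sub>R (g (r k) + A (x (r k)))) \<longlonglongrightarrow> (1 / s) *\<^sub>R (0 + z)"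
      by (intro tendsto_intros gr z)
    then show ?thesis using s0 by (simp add: g_def y_def)
  qed
  have "A y = z"
    using LIMSEQ_unique[OF A.tendsto[OF xr] z] .
  then have "A y = s *\<^sub>R y" using s0 by (simp add: y_def)
  moreover have "norm y = 1"
    using LIMSEQ_unique[OF tendsto_norm[OF xr]] by (simp add: x)
  then have "y \<noteq> 0" by auto
  moreover have "y \<in> V" using V(2) x(1) xr by (meson closed_sequentially)
  ultimately show thesis using that s_mu by blast
qed

text \<open>If the bound failed, \<open>quadratic_form_sup_attained\<close> on the invariant
  subspace orthogonal to the first \<open>j - 1\<close> eigenvectors would yield an eigenvector with
  eigenvalue above \<open>lam j\<close>. It is orthogonal to all of \<open>v 1, ..., v n\<close>,
  contradicting the maximality clause of \<open>leading_eigensystem\<close>.\<close>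

lemma leading_eigensystem_form_bound:
  fixes A :: "'h::{real_inner, second_countable_topology} \<Rightarrow> 'h"
  assumes A: "bounded_linear A" "completely_continuous A"
    and adj: "\<And>x y. inner (A x) y = inner x (A y)"
    and eig: "leading_eigensystem A n lam v" and j: "j \<in> {1..n}" and pos: "lam j \<ge> 0"
    and x: "\<And>i. i \<in> {1..<j} \<Longrightarrow> inner x (v i) = 0"
  shows "inner (A x) x \<le> lam j * (norm x)\<^sup>2"
proof (rule ccontr)
  assume neg: "\<not> ?thesis"
  define V where "V = {x. \<forall>i\<in>{1..<j}. inner x (v i) = 0}"
  have Av: "A (v i) = lam i *\<^sub>R v i" if "i \<in> {1..n}" for i
    using eig that by (simp add: leading_eigensystem_def)
  have "subspace V" unfolding V_def subspace_def by (auto simp: inner_add_left)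
  moreover have "closed V"
  proof -
    have "V = (\<Inter>i\<in>{1..<j}. {x. inner x (v i) = 0})" by (auto simp: V_def)
    then show ?thesis by (auto intro!: closed_INT closed_Collect_eq continuous_intros)
  qed
  moreover have "A x \<in> V" if "x \<in> V" for x
    using that j Av by (auto simp: V_def adj)
  moreover have "x \<in> V" using x by (simp add: V_def)
  moreover have "inner (A x) x > lam j * (norm x)\<^sup>2" using neg by simp
  ultimately obtain s y where y: "s > lam j" "y \<in> V" "y \<noteq> 0" "A y = s *\<^sub>R y"
    using quadratic_form_sup_attained[OF A adj, of V x "lam j"] pos by blast
  \<comment> \<open>For \<open>i < j\<close> this is membership in \<open>V\<close>. For
    \<open>i \<ge> j\<close> eigenvectors of a symmetric operator to different eigenvalues are
    orthogonal, since \<open>s > lam j \<ge> lam i\<close>.\<close>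
  have "inner y (v i) = 0" if i: "i \<in> {1..n}" for i
  proof (cases "i < j")
    case True
    then show ?thesis using y(2) i by (auto simp: V_def)
  next
    case False
    then have "lam i \<le> lam j" using eig i j by (auto simp: leading_eigensystem_def)
    then have "s \<noteq> lam i" using y(1) by simp
    moreover have "s * inner y (v i) = lam i * inner y (v i)"
      using adj[of y "v i"] y(4) Av[OF i] by simp
    ultimately show ?thesis by simp
  qed
  then have "s \<le> lam j" using eig y j unfolding leading_eigensystem_def by blast
  then show False using y(1) by simp
qed

section \<open>Min-max comparison of eigenvalues and perturbation of eigenvectors\<close>

lemma inner_sum_orthonormal:
  fixes v :: "'i \<Rightarrow> 'h::real_inner"
  assumes "finite I" "\<And>i j. i \<in> I \<Longrightarrow> j \<in> I \<Longrightarrow> inner (v i) (v j) = (if i = j then 1 else 0)"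
  shows "inner (\<Sum>i\<in>I. a i *\<^sub>R v i) (\<Sum>i\<in>I. b i *\<^sub>R v i) = (\<Sum>i\<in>I. a i * b i)"
proof -
  have "inner (\<Sum>i\<in>I. a i *\<^sub>R v i) (\<Sum>i\<in>I. b i *\<^sub>R v i)
      = (\<Sum>i\<in>I. \<Sum>j\<in>I. if i = j then a i * b j else 0)"
    unfolding inner_sum_left inner_sum_right
    by (intro sum.cong refl) (simp add: assms(2))
  then show ?thesis using assms(1) by simp
qed

text \<open>Dimension count of Courant--Fischer: the span of \<open>a 1, ..., a j\<close> contains a
  nonzero \<open>x\<close> orthogonal to the \<open>j - 1\<close> vectors \<open>b i\<close>. At
  this \<open>x\<close> the form of \<open>A\<close> is at least
  \<open>\<alpha> j * (norm x)\<^sup>2\<close> and that of \<open>B\<close> at most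
  \<open>\<mu> * (norm x)\<^sup>2\<close>. Applied in both directions it gives Weyl's
  inequality.\<close>

lemma eigenvalue_perturbation_le:
  fixes A B :: "'h::real_inner \<Rightarrow> 'h" and j :: nat
  assumes A: "bounded_linear A"
    and ortho: "\<And>i k. i \<in> {1..j} \<Longrightarrow> k \<in> {1..j} \<Longrightarrow> inner (a i) (a k) = (if i = k then 1 else 0)"
    and eig: "\<And>i. i \<in> {1..j} \<Longrightarrow> A (a i) = \<alpha> i *\<^sub>R a i"
    and dec: "\<And>i. i \<in> {1..j} \<Longrightarrow> \<alpha> j \<le> \<alpha> i"
    and B: "\<And>x. (\<And>i. i \<in> {1..<j} \<Longrightarrow> inner x (b i) = 0) \<Longrightarrow> inner (B x) x \<le> \<mu> * (norm x)\<^sup>2"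
    and D: "\<And>x. inner (A x - B x) x \<le> \<Delta> * (norm x)\<^sup>2"
    and j: "j \<ge> 1"
  shows "\<alpha> j \<le> \<mu> + \<Delta>"
proof -
  interpret A: bounded_linear A by fact
  obtain c where c: "\<exists>i\<in>{1..j}. c i \<noteq> 0" "\<forall>k\<in>{1..<j}. (\<Sum>i\<in>{1..j}. c i * inner (a i) (b k)) = 0"
  proof -
    have "card {1..<j} < card {1..j}" using j by simp
    from homogeneous_system_nontrivial[OF finite_atLeastLessThan finite_atLeastAtMost this,
        of "\<lambda>i k. inner (a i) (b k)"]
    show ?thesis using that by blast
  qed
  define x where "x = (\<Sum>i\<in>{1..j}. c i *\<^sub>R a i)"
  have nx: "(norm x)\<^sup>2 = (\<Sum>i\<in>{1..j}. c i * c i)"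
    unfolding power2_norm_eq_inner x_def by (rule inner_sum_orthonormal) (auto simp: ortho)
  have pos: "(norm x)\<^sup>2 > 0"
  proof -
    obtain i where "i \<in> {1..j}" "c i \<noteq> 0" using c(1) by blast
    then show ?thesis
      unfolding nx by (intro sum_pos2[of _ i]) (auto simp: zero_less_mult_iff linorder_neq_iff)
  qed
  have "A x = (\<Sum>i\<in>{1..j}. (c i * \<alpha> i) *\<^sub>R a i)"
    by (simp add: x_def A.sum A.scaleR eig)
  then have "inner (A x) x = (\<Sum>i\<in>{1..j}. c i * \<alpha> i * c i)"
    unfolding x_def by (simp only: inner_sum_orthonormal[of "{1..j}" a, OF finite_atLeastAtMost ortho])
  also have "\<dots> \<ge> (\<Sum>i\<in>{1..j}. \<alpha> j * (c i * c i))"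
  proof (rule sum_mono)
    fix i assume "i \<in> {1..j}"
    then have "\<alpha> j * (c i * c i) \<le> \<alpha> i * (c i * c i)" by (intro mult_right_mono dec) auto
    then show "\<alpha> j * (c i * c i) \<le> c i * \<alpha> i * c i" by (simp add: mult_ac)
  qed
  finally have "\<alpha> j * (norm x)\<^sup>2 \<le> inner (A x) x" by (simp add: nx sum_distrib_left)
  moreover have "inner x (b k) = 0" if "k \<in> {1..<j}" for k
    using c(2) that by (simp add: x_def inner_sum_left)
  then have "inner (B x) x \<le> \<mu> * (norm x)\<^sup>2" by (rule B)
  ultimately have "\<alpha> j * (norm x)\<^sup>2 \<le> (\<mu> + \<Delta>) * (norm x)\<^sup>2"
    using D[of x] by (simp add: inner_diff_left algebra_simps)
  then show ?thesis using pos by simp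
qed

text \<open>Testing \<open>(C - lam j) x\<close> against the reflection of \<open>x\<close> that changes the sign of the component
  orthogonal to \<open>v 1, \<dots>, v j\<close> makes both parts of the spectrum contribute positively.\<close>
lemma spectral_gap_lower_bound:
  fixes C :: "'h::real_inner \<Rightarrow> 'h" and j :: nat
  assumes C: "bounded_linear C"
    and adj: "\<And>x y. inner (C x) y = inner x (C y)"
    and ortho: "\<And>i k. i \<in> {1..j} \<Longrightarrow> k \<in> {1..j} \<Longrightarrow> inner (v i) (v k) = (if i = k then 1 else 0)"
    and eig: "\<And>i. i \<in> {1..j} \<Longrightarrow> C (v i) = lam i *\<^sub>R v i"
    and gap_above: "\<And>i. i \<in> {1..<j} \<Longrightarrow> lam i \<ge> lam j + g"
    and gap_below: "\<And>y. (\<And>i. i \<in> {1..j} \<Longrightarrow> inner y (v i) = 0) \<Longrightarrow> inner (C y) y \<le> (lam j - g) * (norm y)\<^sup>2"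
    and j: "j \<ge> 1" and x: "inner x (v j) = 0"
  shows "g * norm x \<le> norm (C x - lam j *\<^sub>R x)"
proof -
  interpret C: bounded_linear C by fact
  define c where "c i = inner x (v i)" for i
  define p where "p = (\<Sum>i\<in>{1..j}. c i *\<^sub>R v i)"
  define y where "y = x - p"
  have xp: "x = p + y" by (simp add: y_def)
  have pv: "inner p (v i) = c i" if "i \<in> {1..j}" for i
  proof -
    have "inner p (v i) = (\<Sum>k\<in>{1..j}. if k = i then c k else 0)"
      unfolding p_def inner_sum_left using that by (intro sum.cong refl) (simp add: ortho)
    also have "\<dots> = c i" by (subst sum.delta) (use that in auto)
    finally show ?thesis .
  qed
  have yv: "inner y (v i) = 0" if "i \<in> {1..j}" for i
    using pv[OF that] by (simp add: y_def inner_diff_left c_def)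
  have py: "inner p y = 0" unfolding p_def inner_sum_left
    by (rule sum.neutral) (use yv in \<open>auto simp: inner_commute\<close>)
  have Cp: "C p = (\<Sum>i\<in>{1..j}. (c i * lam i) *\<^sub>R v i)"
    by (simp add: p_def C.sum C.scaleR eig)
  have Cpy: "inner (C p) y = 0" unfolding Cp inner_sum_left
    by (rule sum.neutral) (use yv in \<open>auto simp: inner_commute\<close>)
  have Cyp: "inner (C y) p = 0" by (metis adj inner_commute Cpy)
  have npp: "inner p p = (\<Sum>i\<in>{1..j}. c i * c i)"
    unfolding p_def by (rule inner_sum_orthonormal) (auto simp: ortho)
  have Cpp: "inner (C p) p = (\<Sum>i\<in>{1..j}. c i * lam i * c i)"
    unfolding Cp unfolding p_def by (rule inner_sum_orthonormal) (auto simp: ortho)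
  have low: "g * inner p p \<le> inner (C p) p - lam j * inner p p"
  proof -
    have "g * inner p p + lam j * inner p p = (\<Sum>i\<in>{1..j}. (lam j + g) * (c i * c i))"
      unfolding npp by (simp add: sum_distrib_left distrib_right add.commute sum.distrib)
    also have "\<dots> \<le> (\<Sum>i\<in>{1..j}. c i * lam i * c i)"
    proof (rule sum_mono)
      fix i assume i: "i \<in> {1..j}"
      \<comment> \<open>At \<open>i = j\<close> there is no gap, but the coefficient
        \<open>c j\<close> vanishes because \<open>x\<close> is orthogonal to
        \<open>v j\<close>.\<close>
      show "(lam j + g) * (c i * c i) \<le> c i * lam i * c i"
      proof (cases "i = j")
        case True
        then show ?thesis using x by (simp add: c_def)
      next
        case False
        then have "(lam j + g) * (c i * c i) \<le> lam i * (c i * c i)"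
          using i by (intro mult_right_mono gap_above) auto
        then show ?thesis by (simp add: mult_ac)
      qed
    qed
    finally show ?thesis unfolding Cpp by simp
  qed
  have low': "g * inner y y \<le> lam j * inner y y - inner (C y) y"
    using gap_below[OF yv] by (simp add: power2_norm_eq_inner algebra_simps)
  have nx: "(norm x)\<^sup>2 = inner p p + inner y y"
    unfolding power2_norm_eq_inner xp using py by (simp add: inner_add_left inner_add_right inner_commute)
  have nz: "(norm (p - y))\<^sup>2 = inner p p + inner y y"
    unfolding power2_norm_eq_inner using py by (simp add: inner_diff_left inner_diff_right inner_commute)
  then have nzx: "norm (p - y) = norm x" using nx by (metis norm_ge_zero power2_eq_imp_eq)
  have "g * (norm x)\<^sup>2 \<le> inner (C x - lam j *\<^sub>R x) (p - y)"
    unfolding xp C.add using low low' py Cpy Cyp nx[unfolded xp]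
    by (simp add: inner_add_left inner_diff_left inner_diff_right inner_commute[of y p] algebra_simps)
  also have "\<dots> \<le> norm (C x - lam j *\<^sub>R x) * norm x"
    using norm_cauchy_schwarz[of "C x - lam j *\<^sub>R x" "p - y"] by (simp add: nzx)
  finally have "(g * norm x) * norm x \<le> norm (C x - lam j *\<^sub>R x) * norm x"
    by (simp add: power2_eq_square mult.assoc)
  then show ?thesis by (cases "x = 0") auto
qed

text \<open>With \<open>x\<close> the part of \<open>w\<close> orthogonal to \<open>v\<close> and
  \<open>a\<close> the scalar product, \<open>(norm x)\<^sup>2 = 1 - a\<^sup>2\<close>, so
  \<open>1 - \<bar>a\<bar> \<le> 1 - a\<^sup>2 \<le> norm x\<close>; the error splits into
  \<open>1 - \<bar>a\<bar>\<close> along \<open>v\<close> and \<open>norm x\<close> across. For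
  \<open>a = 0\<close> the convention \<open>sgn 0 = 0\<close> leaves \<open>- v\<close>, whose norm
  equals \<open>norm x = 1\<close>.\<close>

lemma norm_sgn_inner_diff_le:
  fixes v w :: "'h::real_inner"
  assumes v: "norm v = 1" and w: "norm w = 1"
  shows "norm (sgn (inner w v) *\<^sub>R w - v) \<le> 2 * norm (w - inner w v *\<^sub>R v)"
proof -
  define a where "a = inner w v"
  define x where "x = w - a *\<^sub>R v"
  have vv: "inner v v = 1" and ww: "inner w w = 1"
    using v w by (simp_all add: power2_norm_eq_inner[symmetric])
  have nx: "(norm x)\<^sup>2 = 1 - a\<^sup>2"
    unfolding power2_norm_eq_inner x_def
    by (simp add: inner_diff_left inner_diff_right vv ww inner_commute[of v w] a_def power2_eq_square)
  have x1: "norm x \<le> 1" using nx by (metis diff_ge_0_iff_ge le_add_same_cancel1 norm_ge_zero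
        power2_le_imp_le power_one zero_le_one zero_le_power2 diff_add_cancel)
  show ?thesis
  proof (cases "a = 0")
    case True
    then show ?thesis using v nx w by (simp add: a_def[symmetric] x_def)
  next
    case False
    have "\<bar>a\<bar> \<le> 1" using Cauchy_Schwarz_ineq2[of w v] by (simp add: a_def v w)
    have "1 - \<bar>a\<bar> \<le> 1 - a\<^sup>2"
    proof -
      have "\<bar>a\<bar> * \<bar>a\<bar> \<le> \<bar>a\<bar> * 1" using \<open>\<bar>a\<bar> \<le> 1\<close> by (intro mult_left_mono) auto
      then show ?thesis by (simp add: power2_eq_square)
    qed
    also have "\<dots> \<le> norm x"
    proof -
      have "norm x * norm x \<le> norm x * 1" using x1 by (intro mult_left_mono) auto
      then show ?thesis unfolding nx[symmetric] by (simp add: power2_eq_square)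
    qed
    finally have a1: "1 - \<bar>a\<bar> \<le> norm x" .
    have "sgn a *\<^sub>R w - v = (\<bar>a\<bar> - 1) *\<^sub>R v + sgn a *\<^sub>R x"
      by (simp add: x_def scaleR_diff_right scaleR_diff_left mult.commute sgn_mult_self_eq abs_sgn[symmetric])
    then have "norm (sgn a *\<^sub>R w - v) \<le> norm ((\<bar>a\<bar> - 1) *\<^sub>R v) + norm (sgn a *\<^sub>R x)"
      by (metis norm_triangle_ineq)
    also have "\<dots> = (1 - \<bar>a\<bar>) + norm x" using \<open>\<bar>a\<bar> \<le> 1\<close> False v by (simp add: abs_sgn_eq)
    finally show ?thesis using a1 by (simp add: x_def a_def)
  qed
qed

text \<open>\<open>C - \<kappa>\<close> kills \<open>v\<close>, so at the part \<open>x\<close> of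
  \<open>w\<close> orthogonal to \<open>v\<close> it takes the same value as at \<open>w\<close>,
  which has norm at most \<open>2 * \<Delta>\<close>: one \<open>\<Delta>\<close> from the
  operators, one from the eigenvalues. Hence \<open>norm x \<le> 2 * \<Delta> / g\<close>, and
  fixing the sign doubles it.\<close>

lemma eigenvector_perturbation:
  fixes A C :: "'h::real_inner \<Rightarrow> 'h"
  assumes C: "bounded_linear C"
    and lower: "\<And>x. inner x v = 0 \<Longrightarrow> g * norm x \<le> norm (C x - \<kappa> *\<^sub>R x)"
    and Cv: "C v = \<kappa> *\<^sub>R v" and v: "norm v = 1"
    and Aw: "A w = \<mu> *\<^sub>R w" and w: "norm w = 1"
    and val: "\<bar>\<mu> - \<kappa>\<bar> \<le> \<Delta>" and D: "norm (A w - C w) \<le> \<Delta>" and g: "g > 0"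
  shows "norm (sgn (inner w v) *\<^sub>R w - v) \<le> 4 * \<Delta> / g"
proof -
  interpret C: bounded_linear C by fact
  define x where "x = w - inner w v *\<^sub>R v"
  have vv: "inner v v = 1" using v by (simp add: power2_norm_eq_inner[symmetric])
  have "inner x v = 0" by (simp add: x_def inner_diff_left vv)
  then have "g * norm x \<le> norm (C x - \<kappa> *\<^sub>R x)" by (rule lower)
  also have "C x - \<kappa> *\<^sub>R x = - (A w - C w) + (\<mu> - \<kappa>) *\<^sub>R w"
    by (simp add: x_def C.diff C.scaleR Cv Aw scaleR_diff_right scaleR_diff_left mult.commute)
  also have "norm \<dots> \<le> norm (A w - C w) + \<bar>\<mu> - \<kappa>\<bar>"
    using norm_triangle_ineq[of "- (A w - C w)" "(\<mu> - \<kappa>) *\<^sub>R w"] w by (simp add: norm_minus_commute)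
  also have "\<dots> \<le> 2 * \<Delta>" using val D by simp
  finally have "norm x \<le> 2 * \<Delta> / g" using g by (simp add: field_simps)
  then show ?thesis using norm_sgn_inner_diff_le[OF v w] by (simp add: x_def)
qed


text \<open>\<open>v\<close> certifies infinite dimension: some nonzero combination of finitely many
  \<open>v i\<close> is orthogonal to \<open>F\<close> and to all \<open>w i\<close>. It is an
  eigenvector of \<open>A\<close> with eigenvalue 0, so no leading eigenvalue lies below 0. This
  stands in for positivity of the estimator, whose weights may be negative.\<close>

lemma leading_eigensystem_nonneg_if_kernel:
  fixes A :: "'h::real_inner \<Rightarrow> 'h" and v :: "nat \<Rightarrow> 'h"
  assumes F: "finite F" "\<And>x. (\<And>y. y \<in> F \<Longrightarrow> inner x y = 0) \<Longrightarrow> A x = 0"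
    and eig: "leading_eigensystem A q mu w" and j: "j \<in> {1..q}"
    and ortho: "\<And>i k. i \<ge> 1 \<Longrightarrow> k \<ge> 1 \<Longrightarrow> inner (v i) (v k) = (if i = k then 1 else 0)"
  shows "mu j \<ge> (0::real)"
proof -
  define Y where "Y = F \<union> w ` {1..q}"
  have fY: "finite Y" using F by (simp add: Y_def)
  have "card Y < card {1..card Y + 1}" by simp
  from homogeneous_system_nontrivial[OF fY finite_atLeastAtMost this, of "\<lambda>i y. inner (v i) y"]
  obtain c where c: "\<exists>i\<in>{1..card Y + 1}. c i \<noteq> 0"
      "\<And>y. y \<in> Y \<Longrightarrow> (\<Sum>i\<in>{1..card Y + 1}. c i * inner (v i) y) = 0"
    by blast
  define x where "x = (\<Sum>i\<in>{1..card Y + 1}. c i *\<^sub>R v i)"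
  have "inner x x = (\<Sum>i\<in>{1..card Y + 1}. c i * c i)"
    unfolding x_def by (rule inner_sum_orthonormal) (auto simp: ortho)
  moreover have "\<dots> > 0"
  proof -
    obtain i where "i \<in> {1..card Y + 1}" "c i \<noteq> 0" using c(1) by blast
    then show ?thesis
      by (intro sum_pos2[of _ i]) (auto simp: zero_less_mult_iff linorder_neq_iff)
  qed
  ultimately have "x \<noteq> 0" by auto
  have xY: "inner x y = 0" if "y \<in> Y" for y
    unfolding x_def inner_sum_left inner_scaleR_left by (rule c(2)[OF that])
  then have "A x = 0 *\<^sub>R x" using F(2)[of x] by (simp add: Y_def)
  moreover have "\<forall>i\<in>{1..q}. inner x (w i) = 0" using xY by (simp add: Y_def)
  ultimately show ?thesis
    using eig \<open>x \<noteq> 0\<close> j unfolding leading_eigensystem_def by blast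
qed

text \<open>\<open>C\<close> is the true operator and \<open>A\<close> the estimator, treated
  asymmetrically: \<open>C\<close> is positive with its whole eigenvalue sequence given, while
  \<open>A\<close> vanishes on the orthogonal complement of a finite set and comes with
  \<open>q\<close> eigenpairs. The gaps include the one between \<open>lam q\<close> and
  \<open>lam (q + 1)\<close>, which the eigenvector bound at \<open>j = q\<close> uses.\<close>

proposition eigensystem_perturbation:
  fixes A C :: "'h::{real_inner, second_countable_topology} \<Rightarrow> 'h"
  assumes C: "bounded_linear C" "completely_continuous C" "\<And>x y. inner (C x) y = inner x (C y)"
    and psd: "\<And>x. inner (C x) x \<ge> 0" and full: "full_eigensystem C lam v"
    and gap: "g > 0" "\<And>j. j \<in> {1..q} \<Longrightarrow> lam (j + 1) + g \<le> lam j"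
    and A: "bounded_linear A" "completely_continuous A" "\<And>x y. inner (A x) y = inner x (A y)"
    and F: "finite F" "\<And>x. (\<And>y. y \<in> F \<Longrightarrow> inner x y = 0) \<Longrightarrow> A x = 0"
    and eig: "leading_eigensystem A q mu w"
    and D: "\<And>x. norm (A x - C x) \<le> \<Delta> * norm x" and j: "j \<in> {1..q}"
  shows "\<bar>mu j - lam j\<bar> \<le> \<Delta>" (is ?val)
    and "norm (sgn (inner (w j) (v j)) *\<^sub>R w j - v j) \<le> 4 * \<Delta> / g" (is ?vec)
proof -
  have lead: "leading_eigensystem C n lam v" for n using full by (simp add: full_eigensystem_def)
  have ov: "inner (v i) (v k) = (if i = k then 1 else 0)" if "i \<ge> 1" "k \<ge> 1" for i k
    using lead[of "max i k"] that unfolding leading_eigensystem_def by simp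
  have Cv: "C (v i) = lam i *\<^sub>R v i" if "i \<ge> 1" for i
    using lead[of i] that unfolding leading_eigensystem_def by simp
  have dec: "lam k \<le> lam i" if "1 \<le> i" "i \<le> k" for i k
    using lead[of k] that unfolding leading_eigensystem_def by simp
  have lam0: "lam i \<ge> 0" if "i \<ge> 1" for i using psd[of "v i"] Cv[OF that] ov[OF that that] by simp
  have ow: "inner (w i) (w k) = (if i = k then 1 else 0)" if "i \<in> {1..q}" "k \<in> {1..q}" for i k
    using eig that unfolding leading_eigensystem_def by simp
  have Aw: "A (w i) = mu i *\<^sub>R w i" if "i \<in> {1..q}" for i
    using eig that unfolding leading_eigensystem_def by simp
  have mu_dec: "mu k \<le> mu i" if "i \<in> {1..q}" "k \<in> {1..q}" "i \<le> k" for i k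
    using eig that unfolding leading_eigensystem_def by simp
  have mu0: "mu j \<ge> 0" by (rule leading_eigensystem_nonneg_if_kernel[OF F eig j ov])
  have formC: "inner (C x) x \<le> lam k * (norm x)\<^sup>2"
    if "k \<ge> 1" "\<And>i. i \<in> {1..<k} \<Longrightarrow> inner x (v i) = 0" for x k
    using that by (intro leading_eigensystem_form_bound[OF C lead[of k]] lam0) auto
  have formA: "inner (A x) x \<le> mu j * (norm x)\<^sup>2"
    if "\<And>i. i \<in> {1..<j} \<Longrightarrow> inner x (w i) = 0" for x
    using that by (intro leading_eigensystem_form_bound[OF A eig j mu0])
  have D2: "\<bar>inner (A x - C x) x\<bar> \<le> \<Delta> * (norm x)\<^sup>2" for x
  proof -
    have "\<bar>inner (A x - C x) x\<bar> \<le> norm (A x - C x) * norm x" by (rule Cauchy_Schwarz_ineq2)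
    also have "\<dots> \<le> \<Delta> * norm x * norm x" by (intro mult_right_mono D) simp
    finally show ?thesis by (simp add: power2_eq_square mult.assoc)
  qed
  have "mu j \<le> lam j + \<Delta>"
  proof (rule eigenvalue_perturbation_le[OF A(1), where a = w and B = C and b = v])
    show "inner (A x - C x) x \<le> \<Delta> * (norm x)\<^sup>2" for x using D2[of x] by linarith
  qed (use j ow Aw mu_dec formC in auto)
  moreover have "lam j \<le> mu j + \<Delta>"
  proof (rule eigenvalue_perturbation_le[OF C(1), where a = v and B = A and b = w])
    show "inner (C x - A x) x \<le> \<Delta> * (norm x)\<^sup>2" for x
      using D2[of x] by (simp add: inner_diff_left)
  qed (use j ov Cv dec formA in auto)
  ultimately show val: ?val by linarith
  \<comment> \<open>Above \<open>lam j\<close>, at least one consecutive gap separates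
    \<open>lam i\<close> from it. Below, the form on the complement of \<open>v 1, ..., v j\<close>
    is bounded by \<open>lam (j + 1)\<close>.\<close>
  have low: "g * norm x \<le> norm (C x - lam j *\<^sub>R x)" if x: "inner x (v j) = 0" for x
  proof (rule spectral_gap_lower_bound[OF C(1,3), where v = v])
    show "lam i \<ge> lam j + g" if "i \<in> {1..<j}" for i
      using gap(2)[of i] dec[of "i + 1" j] that j by auto
    show "inner (C y) y \<le> (lam j - g) * (norm y)\<^sup>2" if "\<And>i. i \<in> {1..j} \<Longrightarrow> inner y (v i) = 0" for y
    proof -
      have "inner (C y) y \<le> lam (j + 1) * (norm y)\<^sup>2" using that by (intro formC) auto
      also have "\<dots> \<le> (lam j - g) * (norm y)\<^sup>2" using gap(2)[OF j] by (intro mult_right_mono) auto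
      finally show ?thesis .
    qed
  qed (use j ov Cv x in auto)
  have nv: "norm (v j) = 1" using ov[of j j] j by (simp add: norm_eq_sqrt_inner)
  have nw: "norm (w j) = 1" using ow[OF j j] by (simp add: norm_eq_sqrt_inner)
  show ?vec
  proof (rule eigenvector_perturbation[where v = "v j" and w = "w j", OF C(1) low])
    show "norm (A (w j) - C (w j)) \<le> \<Delta>" using D[of "w j"] nw by simp
  qed (use Cv Aw nv nw val gap(1) j in auto)
qed

section \<open>Orthonormal expansions\<close>

text \<open>An orthonormal system in which some vectors may vanish: \<open>sgn 0 = 0\<close> allows a linearly
  dependent sequence to be orthogonalised without skipping indices.\<close>

function gram_schmidt :: "(nat \<Rightarrow> 'h::real_inner) \<Rightarrow> nat \<Rightarrow> 'h" where
  "gram_schmidt d n = sgn (d n - (\<Sum>k<n. inner (d n) (gram_schmidt d k) *\<^sub>R gram_schmidt d k))"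
  by auto
termination by (relation "Wellfounded.measure snd") auto

declare gram_schmidt.simps [simp del]

lemma inner_gram_schmidt:
  "inner (gram_schmidt d i) (gram_schmidt d j) = (if i = j \<and> gram_schmidt d i \<noteq> 0 then 1 else 0)"
proof -
  have diag: "inner (gram_schmidt d i) (gram_schmidt d i) = (if gram_schmidt d i \<noteq> 0 then 1 else 0)" for i
    by (subst (1 2 3) gram_schmidt.simps) (simp add: power2_norm_eq_inner[symmetric] norm_sgn sgn_zero_iff)
  have off: "inner (gram_schmidt d i) (gram_schmidt d j) = 0" if "j < i" for i j
    using that
  proof (induction i arbitrary: j rule: less_induct)
    case (less i)
    let ?e = "gram_schmidt d"
    have "inner (?e k) (?e j) = (if k = j \<and> ?e j \<noteq> 0 then 1 else 0)" if "k < i" for k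
    proof (cases k j rule: linorder_cases)
      case less' : less
      then have "inner (?e j) (?e k) = 0" using less.IH[of j k] \<open>j < i\<close> by simp
      then show ?thesis using less' by (simp add: inner_commute)
    next
      case equal
      then show ?thesis using diag[of j] by auto
    next
      case greater
      then show ?thesis using less.IH[of k j] that by simp
    qed
    then have "(\<Sum>k<i. inner (d i) (?e k) * inner (?e k) (?e j)) =
        (\<Sum>k<i. if k = j then inner (d i) (?e k) * (if ?e j \<noteq> 0 then 1 else 0) else 0)"
      by (intro sum.cong) auto
    also have "\<dots> = inner (d i) (?e j) * (if ?e j \<noteq> 0 then 1 else 0)"
      by (subst sum.delta) (use \<open>j < i\<close> in auto)
    also have "\<dots> = inner (d i) (?e j)" by simp
    finally have "inner (d i - (\<Sum>k<i. inner (d i) (?e k) *\<^sub>R ?e k)) (?e j) = 0"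
      by (simp add: inner_diff_left inner_sum_left)
    then show ?case by (subst gram_schmidt.simps) (simp add: sgn_div_norm)
  qed
  show ?thesis
  proof (cases i j rule: linorder_cases)
    case less
    then show ?thesis using off[of i j] by (simp add: inner_commute)
  qed (use diag off in auto)
qed

definition ortho_seq :: "(nat \<Rightarrow> 'h::real_inner) \<Rightarrow> bool" where
  "ortho_seq e \<longleftrightarrow> (\<forall>i j. inner (e i) (e j) = (if i = j \<and> e i \<noteq> 0 then 1 else 0))"

definition ortho_proj :: "(nat \<Rightarrow> 'h::real_inner) \<Rightarrow> nat \<Rightarrow> 'h \<Rightarrow> 'h" where
  "ortho_proj e N x = (\<Sum>k<N. inner x (e k) *\<^sub>R e k)"

lemma inner_ortho_proj:
  assumes "ortho_seq e"
  shows "inner (ortho_proj e N x) (e j) = (if j < N then inner x (e j) else 0)"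
proof -
  have "inner (ortho_proj e N x) (e j) = (\<Sum>k<N. if k = j then inner x (e k) else 0)"
    unfolding ortho_proj_def inner_sum_left using assms
    by (intro sum.cong refl) (auto simp: ortho_seq_def)
  then show ?thesis by simp
qed

lemma norm_ortho_proj:
  assumes "ortho_seq e"
  shows "(norm (ortho_proj e N x))\<^sup>2 = (\<Sum>k<N. (inner x (e k))\<^sup>2)"
proof -
  have "inner (ortho_proj e N x) (ortho_proj e N x)
      = (\<Sum>k<N. inner x (e k) * inner (ortho_proj e N x) (e k))"
    by (subst (2) ortho_proj_def) (simp add: inner_sum_right inner_commute)
  then show ?thesis
    unfolding power2_norm_eq_inner by (simp add: inner_ortho_proj[OF assms] power2_eq_square)
qed

lemma ortho_proj_pythagoras:
  assumes "ortho_seq e"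
  shows "(norm x)\<^sup>2 = (norm (ortho_proj e N x))\<^sup>2 + (norm (x - ortho_proj e N x))\<^sup>2"
proof -
  have "inner x (ortho_proj e N x) = (\<Sum>k<N. (inner x (e k))\<^sup>2)"
    by (simp add: ortho_proj_def inner_sum_right power2_eq_square)
  then have "inner x (ortho_proj e N x) = (norm (ortho_proj e N x))\<^sup>2"
    by (simp add: norm_ortho_proj[OF assms])
  then show ?thesis
    by (simp add: power2_norm_eq_inner inner_diff_left inner_diff_right inner_commute)
qed

lemma bessel_inequality:
  assumes "ortho_seq e"
  shows "(\<Sum>k<N. (inner x (e k))\<^sup>2) \<le> (norm x)\<^sup>2"
  using ortho_proj_pythagoras[OF assms, of x N] by (simp add: norm_ortho_proj[OF assms])

text \<open>These numbers are the entries of a rank-one operator whose Hilbert--Schmidt norm is at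
  most \<open>norm x * norm y\<close>; the double sum of squares factorises into two Bessel
  sums.\<close>

lemma bessel_inequality_product:
  assumes "ortho_seq e"
  shows "L2_set (\<lambda>(k, l). inner x (e k) * inner y (e l)) ({..<N} \<times> {..<N}) \<le> norm x * norm y"
proof -
  have "(\<Sum>p\<in>{..<N}\<times>{..<N}. (case p of (k, l) \<Rightarrow> inner x (e k) * inner y (e l))\<^sup>2)
      = (\<Sum>k<N. (inner x (e k))\<^sup>2) * (\<Sum>l<N. (inner y (e l))\<^sup>2)"
    by (simp add: sum_product sum.cartesian_product case_prod_beta power_mult_distrib)
  also have "\<dots> \<le> (norm x)\<^sup>2 * (norm y)\<^sup>2"
    by (intro mult_mono bessel_inequality assms sum_nonneg) auto
  finally show ?thesis
    unfolding L2_set_def by (intro real_le_lsqrt sum_nonneg) (simp_all add: power_mult_distrib)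
qed

text \<open>Gram--Schmidt applied to a dense sequence. For \<open>N > n\<close> the projection fixes
  \<open>d n\<close>, so its error at \<open>x\<close> is at most the distance from \<open>x\<close>
  to \<open>d n\<close>, for all later \<open>N\<close> at once.\<close>

lemma ortho_seq_complete_exists:
  obtains e :: "nat \<Rightarrow> 'h::{real_inner, second_countable_topology}"
  where "ortho_seq e" "\<And>x. (\<lambda>N. ortho_proj e N x) \<longlonglongrightarrow> x"
proof -
  obtain D :: "'h set" where D: "countable D" "\<And>U. open U \<Longrightarrow> U \<noteq> {} \<Longrightarrow> \<exists>d\<in>D. d \<in> U"
    by (rule countable_dense_setE) blast
  have "D \<noteq> {}" using D(2)[of UNIV] by auto
  define d where "d = from_nat_into D"
  define e where "e = gram_schmidt d"
  have e: "ortho_seq e" by (simp add: ortho_seq_def e_def inner_gram_schmidt)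
  have fixed: "ortho_proj e N (d n) = d n" if "n < N" for n N
  proof -
    define s where "s = (\<Sum>k<n. inner (d n) (e k) *\<^sub>R e k)"
    have en: "e n = sgn (d n - s)" unfolding e_def s_def by (rule gram_schmidt.simps)
    have proj_e: "ortho_proj e N (e k) = e k" if "k < N" for k
    proof -
      have "ortho_proj e N (e k) = (\<Sum>l<N. if l = k then e k else 0)"
        unfolding ortho_proj_def using e by (intro sum.cong refl) (auto simp: ortho_seq_def)
      then show ?thesis using that by simp
    qed
    have lin: "ortho_proj e N (x + y) = ortho_proj e N x + ortho_proj e N y"
      "ortho_proj e N (c *\<^sub>R x) = c *\<^sub>R ortho_proj e N x" for x y c
      by (simp_all add: ortho_proj_def inner_add_left scaleR_add_left sum.distrib scaleR_sum_right)
    have sum_fixed: "ortho_proj e N (\<Sum>k<m. c k *\<^sub>R e k) = (\<Sum>k<m. c k *\<^sub>R e k)" if "m \<le> N" for m c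
      using that
    proof (induction m)
      case 0
      show ?case by (simp add: ortho_proj_def)
    next
      case (Suc m)
      then show ?case by (simp add: lin proj_e)
    qed
    \<comment> \<open>This also covers dependent vectors: then \<open>d n = s\<close>, and
      \<open>e n = 0\<close> contributes nothing.\<close>
    have "d n = s + norm (d n - s) *\<^sub>R e n" unfolding en by (cases "d n = s") (simp_all add: sgn_div_norm)
    then have "d n = (\<Sum>k<Suc n. (if k = n then norm (d n - s) else inner (d n) (e k)) *\<^sub>R e k)"
      by (simp add: s_def)
    then show ?thesis using sum_fixed[of "Suc n"] that by (metis Suc_leI)
  qed
  have "(\<lambda>N. ortho_proj e N x) \<longlonglongrightarrow> x" for x
  proof (rule LIMSEQ_I)
    fix r :: real assume "r > 0"
    then have "ball x (r / 2) \<noteq> {}" by simp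
    then obtain z where z: "z \<in> D" "z \<in> ball x (r / 2)" using D(2) open_ball by blast
    obtain n where n: "z = d n"
      using z(1) D(1) \<open>D \<noteq> {}\<close> unfolding d_def by (metis from_nat_into_surj)
    show "\<exists>no. \<forall>N\<ge>no. norm (ortho_proj e N x - x) < r"
    proof (intro exI[of _ "Suc n"] allI impI)
      fix N assume "N \<ge> Suc n"
      then have "ortho_proj e N z = z" using fixed[of n N] n by simp
      then have "ortho_proj e N x - x = ortho_proj e N (x - z) - (x - z)"
        by (simp add: ortho_proj_def inner_diff_left scaleR_diff_left sum_subtractf)
      also have "norm \<dots> \<le> norm (x - z)"
      proof -
        have "(norm (ortho_proj e N (x - z) - (x - z)))\<^sup>2 \<le> (norm (x - z))\<^sup>2"
          using ortho_proj_pythagoras[OF e, of "x - z" N] by (simp add: norm_minus_commute)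
        then show ?thesis by (rule power2_le_imp_le) simp
      qed
      finally show "norm (ortho_proj e N x - x) < r"
        using z(2) \<open>r > 0\<close> by (auto simp: dist_norm)
    qed
  qed
  with e show ?thesis by (rule that)
qed

text \<open>Cauchy--Schwarz over the matrix entries bounds the bilinear form on projected vectors;
  the projections converge, and testing against \<open>B x\<close> gives the operator bound. The
  hypothesis concerns finite sections, which is the form in which the random bound becomes
  available.\<close>

lemma norm_le_hilbert_schmidt:
  fixes B :: "'h::real_inner \<Rightarrow> 'h"
  assumes e: "ortho_seq e" "\<And>x. (\<lambda>N. ortho_proj e N x) \<longlonglongrightarrow> x"
    and B: "bounded_linear B"
    and S: "\<And>N. (\<Sum>(k,l)\<in>{..<N}\<times>{..<N}. (inner (B (e k)) (e l))\<^sup>2) \<le> S\<^sup>2" and "S \<ge> 0"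
  shows "norm (B x) \<le> S * norm x"
proof -
  interpret B: bounded_linear B by fact
  have fin: "inner (B (ortho_proj e N x)) (ortho_proj e N y) \<le> S * (norm x * norm y)" for N x y
  proof -
    let ?P = "{..<N} \<times> {..<N}"
    let ?a = "\<lambda>(k, l). inner x (e k) * inner y (e l)" and ?b = "\<lambda>(k, l). inner (B (e k)) (e l)"
    have "inner (B (ortho_proj e N x)) (ortho_proj e N y)
        = (\<Sum>k<N. \<Sum>l<N. (inner x (e k) * inner y (e l)) * inner (B (e k)) (e l))"
      unfolding ortho_proj_def B.sum B.scaleR inner_sum_left
      unfolding inner_sum_right by (simp add: mult_ac)
    also have "\<dots> = (\<Sum>p\<in>?P. ?a p * ?b p)"
      by (simp add: sum.cartesian_product case_prod_beta)
    also have "\<dots> \<le> (\<Sum>p\<in>?P. \<bar>?a p\<bar> * \<bar>?b p\<bar>)"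
      by (intro sum_mono) (simp only: abs_mult[symmetric] abs_ge_self)
    also have "\<dots> \<le> L2_set ?a ?P * L2_set ?b ?P" by (rule L2_set_mult_ineq)
    also have "\<dots> \<le> (norm x * norm y) * S"
    proof (rule mult_mono)
      have "(\<Sum>p\<in>?P. (?b p)\<^sup>2) \<le> S\<^sup>2" using S[of N] by (simp add: case_prod_beta)
      then show "L2_set ?b ?P \<le> S"
        unfolding L2_set_def using \<open>S \<ge> 0\<close> by (intro real_le_lsqrt sum_nonneg) auto
    qed (auto intro!: bessel_inequality_product e)
    finally show ?thesis by (simp add: mult.commute)
  qed
  have "inner (B x) y \<le> S * (norm x * norm y)" for y
  proof (rule LIMSEQ_le_const2)
    show "(\<lambda>N. inner (B (ortho_proj e N x)) (ortho_proj e N y)) \<longlonglongrightarrow> inner (B x) y"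
      by (intro tendsto_inner B.tendsto e)
    show "\<exists>N. \<forall>n\<ge>N. inner (B (ortho_proj e n x)) (ortho_proj e n y) \<le> S * (norm x * norm y)"
      using fin by blast
  qed
  from this[of "B x"] have "norm (B x) * norm (B x) \<le> (S * norm x) * norm (B x)"
    by (simp add: power2_norm_eq_inner[symmetric] power2_eq_square mult_ac)
  then show ?thesis using \<open>S \<ge> 0\<close> by (cases "norm (B x) = 0") (auto simp: mult_le_cancel_right)
qed

section \<open>Riemann sums\<close>

text \<open>On a cell of length \<open>1 / T\<close> the integrand differs from its right endpoint
  value by at most \<open>L / T\<close>, so each of the \<open>T\<close> cells contributes an error
  of at most \<open>L / T\<^sup>2\<close>.\<close>

lemma riemann_sum_lipschitz:
  fixes f :: "real \<Rightarrow> real"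
  assumes f: "L-lipschitz_on {0..1} f" and T: "T \<ge> 1"
  shows "\<bar>(\<Sum>t=1..T. f (real t / real T)) / real T - integral {0..1} f\<bar> \<le> L / real T"
proof -
  define a where "a n = real n / real T" for n
  have cont: "continuous_on {0..1} f" by (rule lipschitz_on_continuous_on[OF f])
  have "\<bar>(\<Sum>t=1..n. f (a t)) / real T - integral {0..a n} f\<bar> \<le> real n * (L / (real T)\<^sup>2)"
    if "n \<le> T" for n
    using that
  proof (induction n)
    case 0
    then show ?case by (simp add: a_def)
  next
    case (Suc n)
    have an: "0 \<le> a n" "a n \<le> a (Suc n)" "a (Suc n) \<le> 1" "a (Suc n) - a n = 1 / real T"
      using Suc.prems T by (auto simp: a_def field_simps)
    have int: "f integrable_on {c..d}" if "0 \<le> c" "d \<le> 1" for c d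
      by (rule integrable_continuous_real) (rule continuous_on_subset[OF cont], use that in auto)
    have split: "integral {0..a (Suc n)} f = integral {0..a n} f + integral {a n..a (Suc n)} f"
      using an by (intro Henstock_Kurzweil_Integration.integral_combine[symmetric] int) auto
    have "\<bar>f (a (Suc n)) / real T - integral {a n..a (Suc n)} f\<bar> \<le> L / (real T)\<^sup>2"
    proof -
      have "((\<lambda>_. f (a (Suc n))) has_integral (a (Suc n) - a n) *\<^sub>R f (a (Suc n))) {a n..a (Suc n)}"
        using has_integral_const_real[of "f (a (Suc n))" "a n" "a (Suc n)"] an by simp
      then have "((\<lambda>x. f (a (Suc n)) - f x) has_integral (f (a (Suc n)) / real T - integral {a n..a (Suc n)} f))
          {a n..a (Suc n)}"
        using an by (intro has_integral_diff integrable_integral int) auto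
      moreover have "norm (f (a (Suc n)) - f x) \<le> L / real T" if "x \<in> {a n..a (Suc n)}" for x
      proof -
        have "dist (f (a (Suc n))) (f x) \<le> L * dist (a (Suc n)) x"
          using that an by (intro lipschitz_onD[OF f]) auto
        also have "\<dots> \<le> L * (1 / real T)"
          using that an lipschitz_on_nonneg[OF f] by (intro mult_left_mono) (auto simp: dist_real_def)
        finally show ?thesis by (simp add: dist_norm)
      qed
      ultimately have "norm (f (a (Suc n)) / real T - integral {a n..a (Suc n)} f)
          \<le> L / real T * Sigma_Algebra.measure lborel (cbox (a n) (a (Suc n)))"
        using lipschitz_on_nonneg[OF f] T by (intro has_integral_bound) auto
      also have "Sigma_Algebra.measure lborel (cbox (a n) (a (Suc n))) = 1 / real T" using an by simp
      finally show ?thesis by (simp add: power2_eq_square)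
    qed
    with Suc show ?case unfolding split by (simp add: add_divide_distrib distrib_right)
  qed
  from this[of T] show ?thesis using T by (simp add: a_def power2_eq_square)
qed

text \<open>Rescaling turns the Lipschitz constant into \<open>L / h\<close>, and the normalisation
  contributes another \<open>1 / h\<close>; this is the source of \<open>h\<^sup>2\<close> in the
  denominator. The support condition keeps the rescaled kernel inside the unit interval, so no mass
  is lost at the boundary.\<close>

lemma kernel_riemann_sum:
  fixes g :: "real \<Rightarrow> real"
  assumes g: "L-lipschitz_on UNIV g" "integrable lborel g"
    and supp: "\<And>s. s \<notin> {0..1} \<Longrightarrow> g ((u - s) / h) = 0" and h: "h > 0" and T: "T \<ge> 1"
  shows "\<bar>(\<Sum>t=1..T. g ((u - real t / real T) / h)) / (real T * h) - (LINT z|lborel. g z)\<bar>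
    \<le> L / (real T * h\<^sup>2)"
proof -
  define f where "f s = g ((u - s) / h)" for s
  have "(LINT z|lborel. g z) = (1 / h) * (LINT s|lborel. f s)"
    using lborel_integral_real_affine[of "-1/h" g "u/h"] h
    by (simp add: f_def diff_divide_distrib)
  also have "(LINT s|lborel. f s) = integral {0..1} f"
  proof -
    have "integrable lborel (\<lambda>s. g (u / h + (- 1 / h) * s))"
      using h by (intro lborel_integrable_real_affine g(2)) auto
    then have "integrable lborel f" by (simp add: f_def[abs_def] diff_divide_distrib)
    then have "(f has_integral (LINT s|lborel. f s)) UNIV" by (rule has_integral_integral_lborel)
    then have "((\<lambda>s. if s \<in> {0..1} then f s else 0) has_integral (LINT s|lborel. f s)) UNIV"
      by (rule has_integral_eq[rotated]) (use supp in \<open>auto simp: f_def\<close>)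
    then have "(f has_integral (LINT s|lborel. f s)) {0..1}" by (simp only: has_integral_restrict_UNIV)
    then show ?thesis by (simp add: integral_unique)
  qed
  finally have I: "(LINT z|lborel. g z) = (1 / h) * integral {0..1} f" .
  have lip: "(L / h)-lipschitz_on {0..1} f"
  proof (rule lipschitz_onI)
    fix x y :: real
    have "dist (f x) (f y) \<le> L * dist ((u - x) / h) ((u - y) / h)"
      unfolding f_def by (rule lipschitz_onD[OF g(1)]) auto
    also have "dist ((u - x) / h) ((u - y) / h) = dist x y / h"
      using h by (simp add: dist_real_def diff_divide_distrib[symmetric] abs_divide abs_minus_commute)
    finally show "dist (f x) (f y) \<le> L / h * dist x y" by simp
  qed (use lipschitz_on_nonneg[OF g(1)] h in auto)
  have "\<bar>(\<Sum>t=1..T. f (real t / real T)) / (real T * h) - (1 / h) * integral {0..1} f\<bar>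
      = (1 / h) * \<bar>(\<Sum>t=1..T. f (real t / real T)) / real T - integral {0..1} f\<bar>"
  proof -
    have "(\<Sum>t=1..T. f (real t / real T)) / (real T * h) - (1 / h) * integral {0..1} f
        = (1 / h) * ((\<Sum>t=1..T. f (real t / real T)) / real T - integral {0..1} f)"
      using h by (simp add: field_simps)
    then show ?thesis using h by (simp add: abs_mult)
  qed
  also have "\<dots> \<le> (1 / h) * (L / h / real T)"
    using h by (intro mult_left_mono riemann_sum_lipschitz lip T) auto
  finally show ?thesis unfolding I by (simp add: f_def power2_eq_square mult_ac)
qed

section \<open>Coupling\<close>

context prob_space
begin

lemma prob_finite_intersection:
  assumes X: "indep_vars (\<lambda>_. S) X UNIV" and J: "finite J" and B: "\<And>i. i \<in> J \<Longrightarrow> B i \<in> sets S"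
  shows "prob {w \<in> space M. \<forall>i\<in>J. X i w \<in> B i} = (\<Prod>i\<in>J. prob (X i -` B i \<inter> space M))"
proof (cases "J = {}")
  case True
  then show ?thesis by (simp add: prob_space)
next
  case False
  then have "{w \<in> space M. \<forall>i\<in>J. X i w \<in> B i} = (\<Inter>i\<in>J. X i -` B i \<inter> space M)" by auto
  also have "prob \<dots> = (\<Prod>i\<in>J. prob (X i -` B i \<inter> space M))"
    by (rule indep_varsD[OF X False J]) (use B in auto)
  finally show ?thesis .
qed

lemma indep_vars_UNIV_I:
  fixes X :: "'i \<Rightarrow> 'a \<Rightarrow> 's"
  assumes rv: "\<And>i. random_variable S (X i)"
    and prob: "\<And>J (B :: 'i \<Rightarrow> 's set). finite J \<Longrightarrow> (\<And>i. i \<in> J \<Longrightarrow> B i \<in> sets S) \<Longrightarrow>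
      prob {w \<in> space M. \<forall>i\<in>J. X i w \<in> B i} = (\<Prod>i\<in>J. prob (X i -` B i \<inter> space M))"
  shows "indep_vars (\<lambda>_. S) X UNIV"
  unfolding indep_vars_def2
proof (intro conjI ballI indep_setsI)
  fix i show "random_variable S (X i)" by (rule rv)
next
  fix i show "{X i -` A \<inter> space M |A. A \<in> sets S} \<subseteq> events"
    using rv by (auto intro: measurable_sets)
next
  fix A J assume J: "J \<noteq> {}" "finite J" and "\<forall>j\<in>J. A j \<in> {X j -` A \<inter> space M |A. A \<in> sets S}"
  then obtain B where B: "\<And>j. j \<in> J \<Longrightarrow> B j \<in> sets S" "\<And>j. j \<in> J \<Longrightarrow> A j = X j -` B j \<inter> space M"
    by (simp add: Bex_def) metis
  have "(\<Inter>j\<in>J. A j) = {w \<in> space M. \<forall>i\<in>J. X i w \<in> B i}" using J B(2) by auto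
  also have "prob \<dots> = (\<Prod>i\<in>J. prob (X i -` B i \<inter> space M))" by (rule prob) (use J B in auto)
  also have "\<dots> = (\<Prod>j\<in>J. prob (A j))" using B(2) by simp
  finally show "prob (\<Inter>j\<in>J. A j) = (\<Prod>j\<in>J. prob (A j))" .
qed

lemma indep_vars_reindex_inj:
  fixes X :: "'i \<Rightarrow> 'a \<Rightarrow> 's" and \<pi> :: "'j \<Rightarrow> 'i"
  assumes X: "indep_vars (\<lambda>_. S) X UNIV" and \<pi>: "inj \<pi>"
  shows "indep_vars (\<lambda>_. S) (\<lambda>j. X (\<pi> j)) UNIV"
proof (rule indep_vars_UNIV_I)
  show "random_variable S (X (\<pi> j))" for j using X by (simp add: indep_vars_def2)
  fix J and B :: "'j \<Rightarrow> 's set" assume J: "finite J" and B: "\<And>i. i \<in> J \<Longrightarrow> B i \<in> sets S"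
  have inv: "inv \<pi> (\<pi> j) = j" for j using \<pi> by simp
  have "prob {w \<in> space M. \<forall>i\<in>\<pi> ` J. X i w \<in> B (inv \<pi> i)}
      = (\<Prod>i\<in>\<pi> ` J. prob (X i -` B (inv \<pi> i) \<inter> space M))"
    using J B by (intro prob_finite_intersection[OF X]) (auto simp: inv)
  then show "prob {w \<in> space M. \<forall>j\<in>J. X (\<pi> j) w \<in> B j} = (\<Prod>j\<in>J. prob (X (\<pi> j) -` B j \<inter> space M))"
    using \<pi> by (simp add: inv prod.reindex inj_on_subset[OF \<pi>])
qed

text \<open>Innovations and copy become one independent family over the disjoint sum of their index
  sets, so that a sequence mixing both is a selection from an independent family. A cylinder over
  the sum splits into one cylinder for each family.\<close>

lemma indep_vars_case_sum:
  fixes X Y :: "'i \<Rightarrow> 'a \<Rightarrow> 's"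
  assumes X: "indep_vars (\<lambda>_. S) X UNIV" and Y: "indep_vars (\<lambda>_. S) Y UNIV"
    and XY: "indep_var (PiM UNIV (\<lambda>_. S)) (\<lambda>w k. X k w) (PiM UNIV (\<lambda>_. S)) (\<lambda>w k. Y k w)"
  shows "indep_vars (\<lambda>_. S) (case_sum X Y) UNIV"
proof (rule indep_vars_UNIV_I)
  show "random_variable S (case_sum X Y i)" for i
    using X Y by (cases i) (simp_all add: indep_vars_def2)
  fix J and B :: "'i + 'i \<Rightarrow> 's set" assume J: "finite J" and B: "\<And>i. i \<in> J \<Longrightarrow> B i \<in> sets S"
  define J1 where "J1 = Inl -` J"
  define J2 where "J2 = Inr -` J"
  have J_eq: "J = J1 <+> J2" by (auto simp: J1_def J2_def Plus_def image_iff) (metis sum.exhaust)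
  have fin: "finite J1" "finite J2"
    unfolding J1_def J2_def by (auto intro!: finite_vimageI J)
  have cyl: "{f \<in> space (PiM UNIV (\<lambda>_. S)). \<forall>i\<in>K. f i \<in> A i} \<in> sets (PiM UNIV (\<lambda>_. S))"
    if "finite K" "\<And>i. i \<in> K \<Longrightarrow> A i \<in> sets S" for K :: "'k set" and A :: "'k \<Rightarrow> 's set"
    using that by (intro sets.sets_Collect_finite_All) (auto intro!: measurable_sets_Collect)
  have rvX: "X i w \<in> space S" and rvY: "Y k w \<in> space S" if "w \<in> space M" for i k w
    using X Y that by (auto simp: indep_vars_def2 intro: measurable_space)
  let ?C1 = "{f \<in> space (PiM UNIV (\<lambda>_. S)). \<forall>i\<in>J1. f i \<in> B (Inl i)}"
  let ?C2 = "{f \<in> space (PiM UNIV (\<lambda>_. S)). \<forall>i\<in>J2. f i \<in> B (Inr i)}"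
  have "{w \<in> space M. \<forall>i\<in>J. case_sum X Y i w \<in> B i}
      = (\<lambda>w. (\<lambda>k. X k w, \<lambda>k. Y k w)) -` (?C1 \<times> ?C2) \<inter> space M"
  proof -
    have "(\<forall>i\<in>J. P i) \<longleftrightarrow> (\<forall>i\<in>J1. P (Inl i)) \<and> (\<forall>i\<in>J2. P (Inr i))" for P
      unfolding J_eq by blast
    then show ?thesis using rvX rvY by (auto simp: space_PiM)
  qed
  also have "prob \<dots> = prob ((\<lambda>w k. X k w) -` ?C1 \<inter> space M) * prob ((\<lambda>w k. Y k w) -` ?C2 \<inter> space M)"
    by (rule indep_varD[OF XY cyl cyl]) (use fin B in \<open>auto simp: J_eq\<close>)
  also have "(\<lambda>w k. X k w) -` ?C1 \<inter> space M = {w \<in> space M. \<forall>i\<in>J1. X i w \<in> B (Inl i)}"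
    using rvX by (auto simp: space_PiM)
  also have "prob \<dots> = (\<Prod>i\<in>J1. prob (X i -` B (Inl i) \<inter> space M))"
    by (rule prob_finite_intersection[OF X fin(1)]) (use B in \<open>auto simp: J_eq\<close>)
  also have "(\<lambda>w k. Y k w) -` ?C2 \<inter> space M = {w \<in> space M. \<forall>i\<in>J2. Y i w \<in> B (Inr i)}"
    using rvY by (auto simp: space_PiM)
  also have "prob \<dots> = (\<Prod>i\<in>J2. prob (Y i -` B (Inr i) \<inter> space M))"
    by (rule prob_finite_intersection[OF Y fin(2)]) (use B in \<open>auto simp: J_eq\<close>)
  finally show "prob {w \<in> space M. \<forall>i\<in>J. case_sum X Y i w \<in> B i}
      = (\<Prod>i\<in>J. prob (case_sum X Y i -` B i \<inter> space M))"
    unfolding J_eq by (simp add: prod.Plus fin)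
qed

text \<open>The law does not depend on the injection. This is why replacing old innovations by
  copies leaves distributions unchanged.\<close>

lemma distr_iid_reindex:
  assumes X: "indep_vars (\<lambda>_. S) X UNIV" and law: "\<And>i. distr M S (X i) = \<nu>" and \<pi>: "inj \<pi>"
  shows "distr M (PiM UNIV (\<lambda>_. S)) (\<lambda>w j. X (\<pi> j) w) = PiM UNIV (\<lambda>_. \<nu>)"
proof -
  have "random_variable S (X i)" for i using X by (simp add: indep_vars_def2)
  then show ?thesis
    using indep_vars_iff_distr_eq_PiM[where I = UNIV and M' = "\<lambda>_. S" and X = "\<lambda>j. X (\<pi> j)"]
      indep_vars_reindex_inj[OF X \<pi>] by (simp add: law restrict_UNIV)
qed

lemma indep_var_disjoint_reindex:
  assumes X: "indep_vars (\<lambda>_. S) X UNIV" and disj: "range \<pi> \<inter> range \<tau> = {}"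
    and f: "f \<in> borel_measurable (PiM UNIV (\<lambda>_. S))" and g: "g \<in> borel_measurable (PiM UNIV (\<lambda>_. S))"
  shows "indep_var borel (\<lambda>w. f (\<lambda>j. X (\<pi> j) w)) borel (\<lambda>w. g (\<lambda>j. X (\<tau> j) w))"
proof -
  have "indep_var (PiM (range \<pi>) (\<lambda>_. S)) (\<lambda>w. restrict (\<lambda>i. X i w) (range \<pi>))
      (PiM (range \<tau>) (\<lambda>_. S)) (\<lambda>w. restrict (\<lambda>i. X i w) (range \<tau>))"
    by (rule indep_var_restrict[OF X disj]) auto
  then have "indep_var borel ((\<lambda>x. f (\<lambda>j. x (\<pi> j))) \<circ> (\<lambda>w. restrict (\<lambda>i. X i w) (range \<pi>)))
      borel ((\<lambda>x. g (\<lambda>j. x (\<tau> j))) \<circ> (\<lambda>w. restrict (\<lambda>i. X i w) (range \<tau>)))"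
  proof (rule indep_var_compose)
    show "(\<lambda>x. f (\<lambda>j. x (\<pi> j))) \<in> borel_measurable (PiM (range \<pi>) (\<lambda>_. S))"
      by (rule measurable_compose[OF measurable_PiM_single' f]) (auto simp: space_PiM)
    show "(\<lambda>x. g (\<lambda>j. x (\<tau> j))) \<in> borel_measurable (PiM (range \<tau>) (\<lambda>_. S))"
      by (rule measurable_compose[OF measurable_PiM_single' g]) (auto simp: space_PiM)
  qed
  then show ?thesis by (simp add: o_def)
qed

text \<open>In the joint family the past up to \<open>t - m\<close> uses the indices
  \<open>Inl i\<close> with \<open>i \<le> t - m\<close>; the coupled sequence uses
  \<open>Inl i\<close> with \<open>i > t - m\<close> and otherwise \<open>Inr i\<close>.
  Disjointness gives independence. The coupled and the original selection are both injective into an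
  i.i.d. family, which gives equality of laws.\<close>

lemma coupled_past_law:
  assumes iid: "iid_seq M S \<epsilon>" and copy: "indep_copy M S \<epsilon> \<epsilon>'"
    and f: "f \<in> borel_measurable (PiM UNIV (\<lambda>_. S))"
  shows "indep_var borel (\<lambda>w. f (\<lambda>j. \<epsilon> (t - int m - int j) w)) borel (\<lambda>w. f (coupled_past \<epsilon> \<epsilon>' t m w))"
    and "distr M borel (\<lambda>w. f (coupled_past \<epsilon> \<epsilon>' t m w)) = distr M borel (\<lambda>w. f (\<lambda>j. \<epsilon> (t - int j) w))"
proof -
  define \<nu> where "\<nu> = distr M S (\<epsilon> 0)"
  have \<epsilon>: "indep_vars (\<lambda>_. S) \<epsilon> UNIV" and \<nu>: "distr M S (\<epsilon> i) = \<nu>" for i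
    using iid by (auto simp: iid_seq_def \<nu>_def)
  have rv: "random_variable S (\<epsilon> i)" for i using \<epsilon> by (simp add: indep_vars_def2)
  have ind: "indep_var (PiM UNIV (\<lambda>_. S)) (\<lambda>w k. \<epsilon> k w) (PiM UNIV (\<lambda>_. S)) (\<lambda>w k. \<epsilon>' k w)"
    and eq: "distr M (PiM UNIV (\<lambda>_. S)) (\<lambda>w k. \<epsilon>' k w) = distr M (PiM UNIV (\<lambda>_. S)) (\<lambda>w k. \<epsilon> k w)"
    using copy by (auto simp: indep_copy_def)
  have rv_all: "(\<lambda>w k. \<epsilon> k w) \<in> M \<rightarrow>\<^sub>M PiM UNIV (\<lambda>_. S)" "(\<lambda>w k. \<epsilon>' k w) \<in> M \<rightarrow>\<^sub>M PiM UNIV (\<lambda>_. S)"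
    using indep_var_rv1[OF ind] indep_var_rv2[OF ind] by auto
  have rv': "random_variable S (\<epsilon>' i)" for i
    using measurable_compose[OF rv_all(2) measurable_component_singleton[of i UNIV "\<lambda>_. S"]] by simp
  have \<nu>': "distr M S (\<epsilon>' i) = \<nu>" for i
  proof -
    have "distr M S (\<epsilon>' i) = distr (distr M (PiM UNIV (\<lambda>_. S)) (\<lambda>w k. \<epsilon>' k w)) S (\<lambda>x. x i)"
      by (subst distr_distr) (auto simp: o_def rv_all)
    also have "\<dots> = distr M S (\<epsilon> i)"
      unfolding eq by (subst distr_distr) (auto simp: o_def rv_all)
    finally show ?thesis by (simp add: \<nu>)
  qed
  \<comment> \<open>\<open>indep_copy\<close> fixes only the joint law of the copy; its coordinates
    are independent because that law is a product measure.\<close>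
  have \<epsilon>': "indep_vars (\<lambda>_. S) \<epsilon>' UNIV"
    using indep_vars_iff_distr_eq_PiM[where I = UNIV and M' = "\<lambda>_. S" and X = \<epsilon>'] indep_vars_iff_distr_eq_PiM[where I = UNIV and M' = "\<lambda>_. S" and X = \<epsilon>]
      \<epsilon> rv rv' eq by (simp add: \<nu> \<nu>' restrict_UNIV)
  define W where "W = case_sum \<epsilon> \<epsilon>'"
  have W: "indep_vars (\<lambda>_. S) W UNIV" unfolding W_def by (rule indep_vars_case_sum[OF \<epsilon> \<epsilon>' ind])
  have W\<nu>: "distr M S (W i) = \<nu>" for i by (cases i) (simp_all add: W_def \<nu> \<nu>')
  define \<pi> :: "nat \<Rightarrow> int + int" where "\<pi> j = Inl (t - int m - int j)" for j
  define \<tau> :: "nat \<Rightarrow> int + int" where "\<tau> j = (if j < m then Inl (t - int j) else Inr (t - int j))" for j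
  define \<sigma> :: "nat \<Rightarrow> int + int" where "\<sigma> j = Inl (t - int j)" for j
  have cp: "coupled_past \<epsilon> \<epsilon>' t m w = (\<lambda>j. W (\<tau> j) w)" for w
    by (auto simp: coupled_past_def W_def \<tau>_def)
  have "range \<pi> \<inter> range \<tau> = {}" by (auto simp: \<pi>_def \<tau>_def split: if_splits)
  then have "indep_var borel (\<lambda>w. f (\<lambda>j. W (\<pi> j) w)) borel (\<lambda>w. f (\<lambda>j. W (\<tau> j) w))"
    by (rule indep_var_disjoint_reindex[OF W _ f f])
  then show "indep_var borel (\<lambda>w. f (\<lambda>j. \<epsilon> (t - int m - int j) w)) borel (\<lambda>w. f (coupled_past \<epsilon> \<epsilon>' t m w))"
    unfolding cp by (simp add: W_def \<pi>_def)
  have inj: "inj \<tau>" "inj \<sigma>" by (auto simp: inj_def \<tau>_def \<sigma>_def)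
  have rvW: "random_variable S (W i)" for i using W by (simp add: indep_vars_def2)
  have law: "distr M borel (\<lambda>w. f (\<lambda>j. W (\<kappa> j) w)) = distr (PiM UNIV (\<lambda>_. \<nu>)) borel f"
    if "inj \<kappa>" for \<kappa> :: "nat \<Rightarrow> int + int"
  proof -
    have "(\<lambda>w j. W (\<kappa> j) w) \<in> M \<rightarrow>\<^sub>M PiM UNIV (\<lambda>_. S)"
      using rvW by (intro measurable_PiM_single') (auto intro: measurable_space)
    then show ?thesis
      unfolding distr_iid_reindex[OF W W\<nu> that, symmetric] by (subst distr_distr) (auto simp: o_def f)
  qed
  show "distr M borel (\<lambda>w. f (coupled_past \<epsilon> \<epsilon>' t m w)) = distr M borel (\<lambda>w. f (\<lambda>j. \<epsilon> (t - int j) w))"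
    unfolding cp using law[OF inj(1)] law[OF inj(2)] by (simp add: W_def \<sigma>_def)
qed

end

section \<open>Covariance inequalities\<close>

lemma integral_cauchy_schwarz:
  fixes f g :: "'a \<Rightarrow> real"
  assumes [measurable]: "f \<in> borel_measurable M" "g \<in> borel_measurable M"
    and f2: "integrable M (\<lambda>x. (f x)\<^sup>2)" and g2: "integrable M (\<lambda>x. (g x)\<^sup>2)"
  shows "integrable M (\<lambda>x. f x * g x)"
    and "\<bar>LINT x|M. f x * g x\<bar> \<le> sqrt (LINT x|M. (f x)\<^sup>2) * sqrt (LINT x|M. (g x)\<^sup>2)"
proof -
  show fg: "integrable M (\<lambda>x. f x * g x)"
  proof (rule Bochner_Integration.integrable_bound[of _ "\<lambda>x. (f x)\<^sup>2 + (g x)\<^sup>2"])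
    show "AE x in M. norm (f x * g x) \<le> norm ((f x)\<^sup>2 + (g x)\<^sup>2)"
    proof (rule AE_I2)
      fix x
      have "2 * \<bar>f x\<bar> * \<bar>g x\<bar> \<le> \<bar>f x\<bar>\<^sup>2 + \<bar>g x\<bar>\<^sup>2" by (rule sum_squares_bound)
      moreover have "0 \<le> \<bar>f x\<bar> * \<bar>g x\<bar>" by simp
      ultimately show "norm (f x * g x) \<le> norm ((f x)\<^sup>2 + (g x)\<^sup>2)"
        unfolding real_norm_def abs_mult power2_abs by linarith
    qed
  qed (use f2 g2 in auto)
  define A where "A = (LINT x|M. (f x)\<^sup>2)"
  define B where "B = (LINT x|M. (g x)\<^sup>2)"
  define I where "I = (LINT x|M. f x * g x)"
  have A0: "A \<ge> 0" and B0: "B \<ge> 0" by (simp_all add: A_def B_def)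
  have quad: "0 \<le> c\<^sup>2 * A - 2 * c * I + B" for c
  proof -
    have "0 \<le> (LINT x|M. (c * f x - g x)\<^sup>2)" by simp
    also have "\<dots> = (LINT x|M. c\<^sup>2 * (f x)\<^sup>2 - 2 * c * (f x * g x) + (g x)\<^sup>2)"
      by (rule Bochner_Integration.integral_cong) (auto simp: power2_eq_square algebra_simps)
    also have "\<dots> = c\<^sup>2 * A - 2 * c * I + B"
      using f2 g2 fg by (simp add: A_def B_def I_def)
    finally show ?thesis .
  qed
  have "I\<^sup>2 \<le> A * B"
  proof (cases "A = 0")
    case True
    have "I = 0"
    proof (rule ccontr)
      assume "I \<noteq> 0"
      \<comment> \<open>At this point \<open>2 * c * I = B + 1\<close>, so the nonnegative quadratic
        would take the value -1.\<close>
      then show False using quad[of "(B + 1) / (2 * I)"] True by simp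
    qed
    then show ?thesis using True by simp
  next
    case False
    then have "A > 0" using A0 by simp
    have "(I / A)\<^sup>2 * A - 2 * (I / A) * I + B = B - I\<^sup>2 / A"
      using False by (simp add: power2_eq_square field_simps)
    then have "I\<^sup>2 / A \<le> B" using quad[of "I / A"] by simp
    then show ?thesis using \<open>A > 0\<close> by (simp add: field_simps)
  qed
  then have "\<bar>I\<bar> \<le> sqrt (A * B)" by (rule real_le_rsqrt[of "\<bar>I\<bar>", simplified])
  then show "\<bar>LINT x|M. f x * g x\<bar> \<le> sqrt (LINT x|M. (f x)\<^sup>2) * sqrt (LINT x|M. (g x)\<^sup>2)"
    by (simp add: I_def A_def B_def real_sqrt_mult)
qed

text \<open>Hoelder's inequality with exponents 2, 4, 4, from two applications of Cauchy--Schwarz.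
  Nested square roots are fourth roots, the shape in which \<open>v_norm_4\<close> presents the
  norm.\<close>

lemma integral_square_product_le:
  fixes a b d :: "'a \<Rightarrow> real"
  assumes meas [measurable]: "a \<in> borel_measurable M" "b \<in> borel_measurable M" "d \<in> borel_measurable M"
    and int: "integrable M (\<lambda>x. a x ^ 4)" "integrable M (\<lambda>x. b x ^ 4)" "integrable M (\<lambda>x. d x ^ 4)"
  shows "integrable M (\<lambda>x. (a x)\<^sup>2 * (b x * d x))"
    and "\<bar>LINT x|M. (a x)\<^sup>2 * (b x * d x)\<bar> \<le>
      sqrt (LINT x|M. a x ^ 4) * (sqrt (sqrt (LINT x|M. b x ^ 4)) * sqrt (sqrt (LINT x|M. d x ^ 4)))"
proof -
  have sq: "(y\<^sup>2)\<^sup>2 = y ^ 4" for y :: real by simp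
  have bd: "integrable M (\<lambda>x. (b x)\<^sup>2 * (d x)\<^sup>2)"
    and bd_le: "\<bar>LINT x|M. (b x)\<^sup>2 * (d x)\<^sup>2\<bar> \<le> sqrt (LINT x|M. b x ^ 4) * sqrt (LINT x|M. d x ^ 4)"
    using integral_cauchy_schwarz[of "\<lambda>x. (b x)\<^sup>2" M "\<lambda>x. (d x)\<^sup>2"] int by (simp_all add: sq)
  have bd': "integrable M (\<lambda>x. (b x * d x)\<^sup>2)" using bd by (simp add: power_mult_distrib)
  have a2: "integrable M (\<lambda>x. ((a x)\<^sup>2)\<^sup>2)" using int by (simp add: sq)
  show "integrable M (\<lambda>x. (a x)\<^sup>2 * (b x * d x))"
    by (rule integral_cauchy_schwarz(1)) (use a2 bd' in auto)
  have "\<bar>LINT x|M. (a x)\<^sup>2 * (b x * d x)\<bar>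
      \<le> sqrt (LINT x|M. ((a x)\<^sup>2)\<^sup>2) * sqrt (LINT x|M. (b x * d x)\<^sup>2)"
    by (rule integral_cauchy_schwarz(2)) (use a2 bd' in auto)
  also have "\<dots> \<le> sqrt (LINT x|M. a x ^ 4) * sqrt (sqrt (LINT x|M. b x ^ 4) * sqrt (LINT x|M. d x ^ 4))"
    unfolding sq power_mult_distrib using bd_le by (intro mult_left_mono real_sqrt_le_mono) auto
  finally show "\<bar>LINT x|M. (a x)\<^sup>2 * (b x * d x)\<bar> \<le>
      sqrt (LINT x|M. a x ^ 4) * (sqrt (sqrt (LINT x|M. b x ^ 4)) * sqrt (sqrt (LINT x|M. d x ^ 4)))"
    by (simp add: real_sqrt_mult)
qed

section \<open>Fourth moments and matrix entries of rank-one operators\<close>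

lemma powr_4: "x powr 4 = x ^ 4" if "x \<ge> 0" for x :: real
  using that by (cases "x = 0") auto

lemma in_Lp_4_iff: "in_Lp M 4 X \<longleftrightarrow> X \<in> borel_measurable M \<and> integrable M (\<lambda>w. norm (X w) ^ 4)"
  by (simp add: in_Lp_def powr_4)

lemma v_norm_4: "v_norm M 4 X = sqrt (sqrt (LINT w|M. norm (X w) ^ 4))"
proof -
  have "(LINT w|M. norm (X w) ^ 4) \<ge> 0" by simp
  then show ?thesis
    unfolding v_norm_def by (simp add: powr_4 powr_half_sqrt[symmetric] powr_powr)
qed

text \<open>Entry of the matrix of \<open>tensor x x\<close> in the system \<open>e\<close>. The
  pair is a single index, so that \<open>L2_set\<close> over a square of indices is a truncated
  Hilbert--Schmidt norm.\<close>

definition coord_product :: "(nat \<Rightarrow> 'h::real_inner) \<Rightarrow> nat \<times> nat \<Rightarrow> 'h \<Rightarrow> real" where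
  "coord_product e p x = inner x (e (fst p)) * inner x (e (snd p))"

lemma measurable_coord_product [measurable]:
  "coord_product e p \<in> borel_measurable (borel :: 'h::real_inner measure)"
  unfolding coord_product_def
  by (intro borel_measurable_continuous_onI continuous_intros)

lemma L2_set_coord_product_le:
  "ortho_seq e \<Longrightarrow> L2_set (\<lambda>p. coord_product e p x) ({..<N} \<times> {..<N}) \<le> (norm x)\<^sup>2"
  using bessel_inequality_product[of e x x N]
  by (simp add: coord_product_def case_prod_unfold power2_eq_square)

text \<open>The difference of the two rank-one operators is
  \<open>(y - z) \<otimes> y + z \<otimes> (y - z)\<close>, and the product form of Bessel's
  inequality controls each summand.\<close>

lemma L2_set_coord_product_diff_le:
  assumes e: "ortho_seq e"
  shows "L2_set (\<lambda>p. coord_product e p y - coord_product e p z) ({..<N} \<times> {..<N})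
    \<le> norm (y - z) * (norm y + norm z)"
proof -
  let ?P = "{..<N} \<times> {..<N}"
  have "L2_set (\<lambda>p. coord_product e p y - coord_product e p z) ?P
      = L2_set (\<lambda>p. (case p of (k, l) \<Rightarrow> inner (y - z) (e k) * inner y (e l))
          + (case p of (k, l) \<Rightarrow> inner z (e k) * inner (y - z) (e l))) ?P"
    by (rule L2_set_cong) (auto simp: coord_product_def inner_diff_left algebra_simps)
  also have "\<dots> \<le> norm (y - z) * norm y + norm z * norm (y - z)"
    by (rule order_trans[OF L2_set_triangle_ineq]) (intro add_mono bessel_inequality_product e)
  finally show ?thesis by (simp add: algebra_simps)
qed

lemma strictly_stationary_pair:
  fixes Y :: "int \<Rightarrow> 'w \<Rightarrow> 'h::topological_space"
  assumes st: "strictly_stationary M Y" and Y [measurable]: "\<And>t. Y t \<in> borel_measurable M"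
    and \<phi> [measurable]: "\<phi> \<in> borel_measurable borel" and \<psi> [measurable]: "\<psi> \<in> borel_measurable borel"
  shows "(LINT w|M. (\<phi> (Y s w) * \<psi> (Y t w) :: real)) = (LINT w|M. \<phi> (Y (s - r) w) * \<psi> (Y (t - r) w))"
proof -
  define J where "J = {s - r, t - r}"
  have J: "finite J" "s - r \<in> J" "t - r \<in> J" by (auto simp: J_def)
  define g where "g x = \<phi> (x (s - r)) * \<psi> (x (t - r))" for x
  have g [measurable]: "g \<in> borel_measurable (PiM J (\<lambda>_. borel))"
    unfolding g_def using J by measurable
  have m: "(\<lambda>w. \<lambda>i\<in>J. Y (i + r') w) \<in> M \<rightarrow>\<^sub>M PiM J (\<lambda>_. borel)" for r'
    by (rule measurable_restrict) simp
  have "(LINT w|M. \<phi> (Y s w) * \<psi> (Y t w)) = (LINT x|distr M (PiM J (\<lambda>_. borel)) (\<lambda>w. \<lambda>i\<in>J. Y (i + r) w). g x)"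
    by (subst integral_distr[OF m g]) (use J in \<open>simp add: g_def\<close>)
  also have "distr M (PiM J (\<lambda>_. borel)) (\<lambda>w. \<lambda>i\<in>J. Y (i + r) w)
      = distr M (PiM J (\<lambda>_. borel)) (\<lambda>w. \<lambda>i\<in>J. Y (i + 0) w)"
    using st J(1) by (simp add: strictly_stationary_def)
  also have "(LINT x|\<dots>. g x) = (LINT w|M. \<phi> (Y (s - r) w) * \<psi> (Y (t - r) w))"
    by (subst integral_distr[OF m g]) (use J in \<open>simp add: g_def\<close>)
  finally show ?thesis .
qed

lemma strictly_stationary_single:
  fixes Y :: "int \<Rightarrow> 'w \<Rightarrow> 'h::topological_space"
  assumes "strictly_stationary M Y" "\<And>t. Y t \<in> borel_measurable M" "\<phi> \<in> borel_measurable borel"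
  shows "(LINT w|M. (\<phi> (Y t w) :: real)) = (LINT w|M. \<phi> (Y 0 w))"
  using strictly_stationary_pair[OF assms, of "\<lambda>_. 1" t t t] by simp

context prob_space
begin

lemma coord_product_square_integrable:
  fixes Z :: "'a \<Rightarrow> 'h::{real_inner, second_countable_topology}"
  assumes e: "ortho_seq e" and Z: "in_Lp M 4 Z"
  shows "integrable M (\<lambda>w. (coord_product e p (Z w))\<^sup>2)"
proof (rule Bochner_Integration.integrable_bound[of _ "\<lambda>w. norm (Z w) ^ 4"])
  show "integrable M (\<lambda>w. norm (Z w) ^ 4)" using Z by (simp add: in_Lp_4_iff)
  have [measurable]: "Z \<in> borel_measurable M" using Z by (simp add: in_Lp_4_iff)
  show "(\<lambda>w. (coord_product e p (Z w))\<^sup>2) \<in> borel_measurable M" by measurable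
  show "AE w in M. norm ((coord_product e p (Z w))\<^sup>2) \<le> norm (norm (Z w) ^ 4)"
  proof (rule AE_I2)
    fix w
    define N where "N = Suc (max (fst p) (snd p))"
    have "p \<in> {..<N} \<times> {..<N}" by (auto simp: N_def mem_Times_iff)
    then have "\<bar>coord_product e p (Z w)\<bar> \<le> L2_set (\<lambda>p. \<bar>coord_product e p (Z w)\<bar>) ({..<N} \<times> {..<N})"
      by (intro member_le_L2_set) auto
    also have "\<dots> = L2_set (\<lambda>p. coord_product e p (Z w)) ({..<N} \<times> {..<N})" by (simp add: L2_set_def)
    also have "\<dots> \<le> (norm (Z w))\<^sup>2" by (rule L2_set_coord_product_le[OF e])
    finally have "\<bar>coord_product e p (Z w)\<bar>\<^sup>2 \<le> ((norm (Z w))\<^sup>2)\<^sup>2" by (rule power_mono) simp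
    then show "norm ((coord_product e p (Z w))\<^sup>2) \<le> norm (norm (Z w) ^ 4)" by simp
  qed
qed

lemma coord_product_integrable:
  fixes X :: "'a \<Rightarrow> 'h::{real_inner, second_countable_topology}"
  assumes e: "ortho_seq e" and X: "in_Lp M 4 X"
  shows "integrable M (\<lambda>w. coord_product e p (X w))"
proof -
  have [measurable]: "X \<in> borel_measurable M" using X by (simp add: in_Lp_4_iff)
  show ?thesis
    by (rule square_integrable_imp_integrable) (auto intro: coord_product_square_integrable e X)
qed

lemma coord_product_mult_integrable:
  fixes X :: "'a \<Rightarrow> 'h::{real_inner, second_countable_topology}"
  assumes e: "ortho_seq e" and X: "in_Lp M 4 X" and Y: "in_Lp M 4 Y"
  shows "integrable M (\<lambda>w. coord_product e p (X w) * coord_product e p' (Y w))"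
proof -
  have [measurable]: "X \<in> borel_measurable M" "Y \<in> borel_measurable M" using X Y by (auto simp: in_Lp_4_iff)
  show ?thesis
    by (rule integral_cauchy_schwarz(1)) (auto intro: coord_product_square_integrable e X Y)
qed

text \<open>Lag zero involves no coupling: every summand is a variance, hence between 0 and the
  second moment, and the second moments add up to at most the fourth moment of the norm by Bessel's
  inequality under the integral.\<close>

lemma sum_autocovariance_zero_le:
  fixes X :: "'a \<Rightarrow> 'h::{real_inner, second_countable_topology}"
  assumes e: "ortho_seq e" and X: "in_Lp M 4 X"
  shows "(\<Sum>p\<in>{..<N}\<times>{..<N}. \<bar>(LINT w|M. coord_product e p (X w) * coord_product e p (X w))
      - (LINT w|M. coord_product e p (X w))\<^sup>2\<bar>) \<le> (LINT w|M. norm (X w) ^ 4)"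
proof -
  let ?P = "{..<N} \<times> {..<N}" and ?\<phi> = "\<lambda>p w. coord_product e p (X w)"
  have [measurable]: "X \<in> borel_measurable M" using X by (simp add: in_Lp_4_iff)
  note int = coord_product_mult_integrable[OF e X X] coord_product_integrable[OF e X]
  have "\<bar>(LINT w|M. ?\<phi> p w * ?\<phi> p w) - (LINT w|M. ?\<phi> p w)\<^sup>2\<bar> \<le> (LINT w|M. ?\<phi> p w * ?\<phi> p w)" for p
  proof -
    have sq: "integrable M (\<lambda>w. (?\<phi> p w)\<^sup>2)" using int(1)[of p p] by (simp add: power2_eq_square)
    have eq: "(LINT w|M. ?\<phi> p w * ?\<phi> p w) = (LINT w|M. (?\<phi> p w)\<^sup>2)" by (simp add: power2_eq_square)
    have "(LINT w|M. (?\<phi> p w)\<^sup>2) - (LINT w|M. ?\<phi> p w)\<^sup>2 = variance (?\<phi> p)"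
      by (rule variance_eq[symmetric]) (use sq int(2) in auto)
    moreover have "variance (?\<phi> p) \<ge> 0" by (rule variance_positive)
    moreover have "(LINT w|M. ?\<phi> p w)\<^sup>2 \<ge> 0" by simp
    ultimately show ?thesis unfolding eq by linarith
  qed
  then have "(\<Sum>p\<in>?P. \<bar>(LINT w|M. ?\<phi> p w * ?\<phi> p w) - (LINT w|M. ?\<phi> p w)\<^sup>2\<bar>)
      \<le> (\<Sum>p\<in>?P. LINT w|M. ?\<phi> p w * ?\<phi> p w)"
    by (rule sum_mono)
  also have "\<dots> = (LINT w|M. (\<Sum>p\<in>?P. ?\<phi> p w * ?\<phi> p w))"
    by (rule Bochner_Integration.integral_sum[symmetric]) (rule int(1))
  also have "\<dots> \<le> (LINT w|M. norm (X w) ^ 4)"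
  proof (rule integral_mono)
    show "integrable M (\<lambda>w. \<Sum>p\<in>?P. ?\<phi> p w * ?\<phi> p w)" by (intro Bochner_Integration.integrable_sum int(1))
    show "integrable M (\<lambda>w. norm (X w) ^ 4)" using X by (simp add: in_Lp_4_iff)
    fix w
    have "(L2_set (\<lambda>p. ?\<phi> p w) ?P)\<^sup>2 \<le> ((norm (X w))\<^sup>2)\<^sup>2"
      by (intro power_mono L2_set_coord_product_le e) simp
    then show "(\<Sum>p\<in>?P. ?\<phi> p w * ?\<phi> p w) \<le> norm (X w) ^ 4"
      by (simp add: L2_set_def power2_eq_square[symmetric] sum_nonneg)
  qed
  finally show ?thesis .
qed

text \<open>Replacing \<open>Y\<close> by a copy \<open>Z\<close> that is independent of \<open>X\<close> turns the mixed moment into the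
  product of the means, so the covariance is paid for by \<open>Y - Z\<close> alone.\<close>
lemma sum_autocovariance_coupling_le:
  fixes X Y Z :: "'a \<Rightarrow> 'h::{real_inner, second_countable_topology}"
  assumes e: "ortho_seq e" and L: "in_Lp M 4 X" "in_Lp M 4 Y" "in_Lp M 4 Z"
    and ind: "indep_var borel X' borel Z" and X': "AE w in M. X w = X' w"
    and mean: "\<And>p. (LINT w|M. coord_product e p (X w)) = c p" "\<And>p. (LINT w|M. coord_product e p (Z w)) = c p"
    and M4: "(LINT w|M. norm (X w) ^ 4) = m4" "(LINT w|M. norm (Y w) ^ 4) = m4" "(LINT w|M. norm (Z w) ^ 4) = m4"
  shows "(\<Sum>p\<in>{..<N}\<times>{..<N}. \<bar>(LINT w|M. coord_product e p (X w) * coord_product e p (Y w)) - (c p)\<^sup>2\<bar>)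
    \<le> 2 * (sqrt m4 * sqrt (sqrt m4)) * v_norm M 4 (\<lambda>w. Y w - Z w)"
proof -
  let ?P = "{..<N} \<times> {..<N}" and ?\<phi> = "coord_product e"
  have [measurable]: "X \<in> borel_measurable M" "Y \<in> borel_measurable M" "Z \<in> borel_measurable M"
    using L by (auto simp: in_Lp_4_iff)
  have X'm [measurable]: "X' \<in> borel_measurable M" using indep_var_rv1[OF ind] .
  have prodZ: "(LINT w|M. ?\<phi> p (X w) * ?\<phi> p (Z w)) = (c p)\<^sup>2" for p
  proof -
    \<comment> \<open>Independence is available for the version \<open>X'\<close>; almost sure
      equality carries the product formula over to \<open>X\<close>.\<close>
    have ind': "indep_var borel (\<lambda>w. ?\<phi> p (X' w)) borel (\<lambda>w. ?\<phi> p (Z w))"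
      using indep_var_compose[OF ind measurable_coord_product[of e p] measurable_coord_product[of e p]]
      by (simp add: o_def)
    have X'X: "AE w in M. ?\<phi> p (X' w) = ?\<phi> p (X w)" using X' by eventually_elim simp
    have "integrable M (\<lambda>w. ?\<phi> p (X' w))"
      by (rule integrable_cong_AE_imp[OF coord_product_integrable[OF e L(1)]]) (use X'X in auto)
    then have "(LINT w|M. ?\<phi> p (X' w) * ?\<phi> p (Z w)) = (LINT w|M. ?\<phi> p (X' w)) * (LINT w|M. ?\<phi> p (Z w))"
      by (intro indep_var_lebesgue_integral ind' coord_product_integrable[OF e L(3)])
    also have "(LINT w|M. ?\<phi> p (X' w)) = (LINT w|M. ?\<phi> p (X w))"
      by (rule integral_cong_AE) (use X'X in auto)
    also have "(LINT w|M. ?\<phi> p (X' w) * ?\<phi> p (Z w)) = (LINT w|M. ?\<phi> p (X w) * ?\<phi> p (Z w))"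
      by (rule integral_cong_AE) (use X'X in auto)
    finally show ?thesis by (simp add: mean power2_eq_square)
  qed
  have iD: "integrable M (\<lambda>w. \<bar>?\<phi> p (X w)\<bar> * \<bar>?\<phi> p (Y w) - ?\<phi> p (Z w)\<bar>)" for p
  proof -
    have "integrable M (\<lambda>w. ?\<phi> p (X w) * ?\<phi> p (Y w) - ?\<phi> p (X w) * ?\<phi> p (Z w))"
      by (intro Bochner_Integration.integrable_diff coord_product_mult_integrable e L)
    then have "integrable M (\<lambda>w. norm (?\<phi> p (X w) * ?\<phi> p (Y w) - ?\<phi> p (X w) * ?\<phi> p (Z w)))"
      by (rule integrable_norm)
    then show ?thesis by (simp add: right_diff_distrib[symmetric] abs_mult)
  qed
  define D where "D w = Y w - Z w" for w
  have [measurable]: "D \<in> borel_measurable M" unfolding D_def by measurable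
  have L4: "integrable M (\<lambda>w. norm (V w) ^ 4)" if "V \<in> {X, Y, Z}" for V
    using L that by (auto simp: in_Lp_4_iff)
  \<comment> \<open>The factor 8 is that of \<open>(a + b)^4 \<le> 8 * (a^4 + b^4)\<close>, from
    using \<open>(a + b)\<^sup>2 \<le> 2 * (a\<^sup>2 + b\<^sup>2)\<close> twice.\<close>
  have D4: "integrable M (\<lambda>w. norm (D w) ^ 4)"
  proof (rule Bochner_Integration.integrable_bound[of _ "\<lambda>w. 8 * (norm (Y w) ^ 4 + norm (Z w) ^ 4)"])
    show "integrable M (\<lambda>w. 8 * (norm (Y w) ^ 4 + norm (Z w) ^ 4))" using L4 by auto
    show "AE w in M. norm (norm (D w) ^ 4) \<le> norm (8 * (norm (Y w) ^ 4 + norm (Z w) ^ 4))"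
    proof (rule AE_I2)
      fix w
      have sq: "(a + b)\<^sup>2 \<le> 2 * (a\<^sup>2 + b\<^sup>2)" for a b :: real
        using sum_squares_bound[of a b] by (simp add: power2_sum)
      have "norm (D w) ^ 4 \<le> (norm (Y w) + norm (Z w)) ^ 4"
        unfolding D_def by (intro power_mono norm_triangle_ineq4) simp
      also have "\<dots> = ((norm (Y w) + norm (Z w))\<^sup>2)\<^sup>2" by simp
      also have "\<dots> \<le> (2 * ((norm (Y w))\<^sup>2 + (norm (Z w))\<^sup>2))\<^sup>2" by (intro power_mono sq) simp
      also have "\<dots> = 4 * ((norm (Y w))\<^sup>2 + (norm (Z w))\<^sup>2)\<^sup>2" by (simp only: power_mult_distrib) simp
      also have "\<dots> \<le> 4 * (2 * (((norm (Y w))\<^sup>2)\<^sup>2 + ((norm (Z w))\<^sup>2)\<^sup>2))" by (intro mult_left_mono sq) simp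
      finally show "norm (norm (D w) ^ 4) \<le> norm (8 * (norm (Y w) ^ 4 + norm (Z w) ^ 4))" by simp
    qed
  qed measurable
  have bound: "integrable M (\<lambda>w. (norm (X w))\<^sup>2 * (norm (V w) * norm (D w)))"
      "(LINT w|M. (norm (X w))\<^sup>2 * (norm (V w) * norm (D w))) \<le>
        (sqrt m4 * sqrt (sqrt m4)) * v_norm M 4 D"
    if V: "V \<in> {Y, Z}" for V
  proof -
    have m: "V \<in> borel_measurable M" using V by auto
    have Vm: "(LINT w|M. norm (V w) ^ 4) = m4" using V M4 by auto
    note * = integral_square_product_le[of "\<lambda>w. norm (X w)" M "\<lambda>w. norm (V w)" "\<lambda>w. norm (D w)"]
    show "integrable M (\<lambda>w. (norm (X w))\<^sup>2 * (norm (V w) * norm (D w)))"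
      by (rule *) (use m V L4 D4 in auto)
    have "\<bar>LINT w|M. (norm (X w))\<^sup>2 * (norm (V w) * norm (D w))\<bar> \<le> sqrt (LINT w|M. norm (X w) ^ 4) *
        (sqrt (sqrt (LINT w|M. norm (V w) ^ 4)) * sqrt (sqrt (LINT w|M. norm (D w) ^ 4)))"
      by (rule *) (use m V L4 D4 in auto)
    then show "(LINT w|M. (norm (X w))\<^sup>2 * (norm (V w) * norm (D w))) \<le>
        (sqrt m4 * sqrt (sqrt m4)) * v_norm M 4 D"
      unfolding M4 Vm v_norm_4 by (simp add: mult.assoc)
  qed
  have "(\<Sum>p\<in>?P. \<bar>(LINT w|M. ?\<phi> p (X w) * ?\<phi> p (Y w)) - (c p)\<^sup>2\<bar>)
      \<le> (\<Sum>p\<in>?P. LINT w|M. \<bar>?\<phi> p (X w)\<bar> * \<bar>?\<phi> p (Y w) - ?\<phi> p (Z w)\<bar>)"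
  proof (rule sum_mono)
    fix p
    have "(LINT w|M. ?\<phi> p (X w) * ?\<phi> p (Y w)) - (c p)\<^sup>2
        = (LINT w|M. ?\<phi> p (X w) * ?\<phi> p (Y w) - ?\<phi> p (X w) * ?\<phi> p (Z w))"
      unfolding prodZ[symmetric]
      by (rule Bochner_Integration.integral_diff[symmetric]) (intro coord_product_mult_integrable e L)+
    also have "\<bar>\<dots>\<bar> \<le> (LINT w|M. \<bar>?\<phi> p (X w) * ?\<phi> p (Y w) - ?\<phi> p (X w) * ?\<phi> p (Z w)\<bar>)"
      by (rule integral_abs_bound)
    finally show "\<bar>(LINT w|M. ?\<phi> p (X w) * ?\<phi> p (Y w)) - (c p)\<^sup>2\<bar>
        \<le> (LINT w|M. \<bar>?\<phi> p (X w)\<bar> * \<bar>?\<phi> p (Y w) - ?\<phi> p (Z w)\<bar>)"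
      by (simp add: right_diff_distrib[symmetric] abs_mult)
  qed
  \<comment> \<open>With the sum inside the integral, Cauchy--Schwarz over \<open>p\<close> applies
    pointwise and Bessel's inequality removes \<open>N\<close>.\<close>
  also have "\<dots> = (LINT w|M. (\<Sum>p\<in>?P. \<bar>?\<phi> p (X w)\<bar> * \<bar>?\<phi> p (Y w) - ?\<phi> p (Z w)\<bar>))"
    by (rule Bochner_Integration.integral_sum[symmetric]) (rule iD)
  also have "\<dots> \<le> (LINT w|M. (norm (X w))\<^sup>2 * (norm (Y w) * norm (D w)) + (norm (X w))\<^sup>2 * (norm (Z w) * norm (D w)))"
  proof (rule integral_mono)
    show "integrable M (\<lambda>w. \<Sum>p\<in>?P. \<bar>?\<phi> p (X w)\<bar> * \<bar>?\<phi> p (Y w) - ?\<phi> p (Z w)\<bar>)"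
      by (intro Bochner_Integration.integrable_sum iD)
    show "integrable M (\<lambda>w. (norm (X w))\<^sup>2 * (norm (Y w) * norm (D w)) + (norm (X w))\<^sup>2 * (norm (Z w) * norm (D w)))"
      by (intro Bochner_Integration.integrable_add bound) auto
    fix w
    have "(\<Sum>p\<in>?P. \<bar>?\<phi> p (X w)\<bar> * \<bar>?\<phi> p (Y w) - ?\<phi> p (Z w)\<bar>)
        \<le> L2_set (\<lambda>p. ?\<phi> p (X w)) ?P * L2_set (\<lambda>p. ?\<phi> p (Y w) - ?\<phi> p (Z w)) ?P"
      by (rule L2_set_mult_ineq)
    also have "\<dots> \<le> (norm (X w))\<^sup>2 * (norm (D w) * (norm (Y w) + norm (Z w)))"
      unfolding D_def
      by (intro mult_mono L2_set_coord_product_le L2_set_coord_product_diff_le e) (auto simp: L2_set_nonneg)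
    finally show "(\<Sum>p\<in>?P. \<bar>?\<phi> p (X w)\<bar> * \<bar>?\<phi> p (Y w) - ?\<phi> p (Z w)\<bar>)
        \<le> (norm (X w))\<^sup>2 * (norm (Y w) * norm (D w)) + (norm (X w))\<^sup>2 * (norm (Z w) * norm (D w))"
      by (simp add: algebra_simps)
  qed
  also have "\<dots> = (LINT w|M. (norm (X w))\<^sup>2 * (norm (Y w) * norm (D w)))
      + (LINT w|M. (norm (X w))\<^sup>2 * (norm (Z w) * norm (D w)))"
    by (intro Bochner_Integration.integral_add bound) auto
  also have "\<dots> \<le> 2 * (sqrt m4 * sqrt (sqrt m4)) * v_norm M 4 D"
    using bound(2)[of Y] bound(2)[of Z] by simp
  finally show ?thesis by (simp add: D_def[abs_def])
qed

text \<open>One summable \<open>\<gamma>\<close> serves every system \<open>e\<close>, every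
  truncation and every pair of times. Stationarity moves a pair at lag \<open>m\<close> to times
  \<open>- m\<close> and 0, where the \<open>m\<close>-th approximation of \<open>Y 0\<close> is
  independent of the representation of \<open>Y (- m)\<close>.\<close>

proposition summable_autocovariance:
  fixes Y :: "int \<Rightarrow> 'a \<Rightarrow> 'h::{real_inner, second_countable_topology}"
  assumes st: "strictly_stationary M Y" and approx: "Lp_m_approximable M S 4 Y"
  obtains \<gamma> :: "nat \<Rightarrow> real" where "summable \<gamma>" "\<And>m. \<gamma> m \<ge> 0"
    "\<And>e N s t. ortho_seq e \<Longrightarrow>
      (\<Sum>p\<in>{..<N}\<times>{..<N}. \<bar>(LINT w|M. coord_product e p (Y s w) * coord_product e p (Y t w))
        - (LINT w|M. coord_product e p (Y 0 w))\<^sup>2\<bar>) \<le> \<gamma> (nat \<bar>s - t\<bar>)"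
proof -
  have L: "in_Lp M 4 (Y t)" for t using approx by (simp add: Lp_m_approximable_def)
  obtain f \<epsilon> \<epsilon>' where f: "f \<in> borel_measurable (PiM UNIV (\<lambda>_. S))" and iid: "iid_seq M S \<epsilon>"
    and repr: "\<forall>t. AE w in M. Y t w = f (\<lambda>j. \<epsilon> (t - int j) w)"
    and copy: "\<forall>t. \<forall>m\<ge>1. indep_copy M S \<epsilon> (\<epsilon>' t m)"
    and summ: "\<forall>t. summable (\<lambda>m. v_norm M 4 (\<lambda>w. Y t w - f (coupled_past \<epsilon> (\<epsilon>' t (Suc m)) t (Suc m) w)))"
    using approx unfolding Lp_m_approximable_def by (elim conjE exE)
  have Ym [measurable]: "Y t \<in> borel_measurable M" for t using L by (simp add: in_Lp_4_iff)
  define Z where "Z m w = f (coupled_past \<epsilon> (\<epsilon>' 0 m) 0 m w)" for m w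
  define m4 where "m4 = (LINT w|M. norm (Y 0 w) ^ 4)"
  \<comment> \<open>Approximability provides copies and the series for \<open>m \<ge> 1\<close>; lag
    0 gets the fourth moment instead.\<close>
  define \<gamma> where "\<gamma> m = (if m = 0 then m4 else 2 * (sqrt m4 * sqrt (sqrt m4)) * v_norm M 4 (\<lambda>w. Y 0 w - Z m w))" for m
  have "summable (\<lambda>m. \<gamma> (Suc m))"
    using summable_mult[OF summ[rule_format, of 0]] by (simp add: \<gamma>_def Z_def)
  then have "summable \<gamma>" by (simp only: summable_Suc_iff)
  moreover have "\<gamma> m \<ge> 0" for m by (simp add: \<gamma>_def m4_def v_norm_4)
  moreover have "(\<Sum>p\<in>{..<N}\<times>{..<N}. \<bar>(LINT w|M. coord_product e p (Y s w) * coord_product e p (Y t w))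
        - (LINT w|M. coord_product e p (Y 0 w))\<^sup>2\<bar>) \<le> \<gamma> (nat \<bar>s - t\<bar>)" (is "?cov s t \<le> _")
    if e: "ortho_seq e" for e :: "nat \<Rightarrow> 'h" and N s t
  proof -
    have lag: "?cov (- int m) 0 \<le> \<gamma> m" for m
    proof (cases "m = 0")
      case True
      then show ?thesis using sum_autocovariance_zero_le[OF e L[of 0], of N] by (simp add: \<gamma>_def m4_def)
    next
      case False
      then have cm: "indep_copy M S \<epsilon> (\<epsilon>' 0 m)" using copy by simp
      note cp = coupled_past_law[OF iid cm f, of 0 m, folded Z_def]
      have Zm [measurable]: "Z m \<in> borel_measurable M" using indep_var_rv2[OF cp(1)] .
      have \<epsilon>m: "(\<lambda>w. f (\<lambda>j. \<epsilon> (0 - int j) w)) \<in> borel_measurable M"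
      proof -
        have "\<epsilon> i \<in> M \<rightarrow>\<^sub>M S" for i using iid by (simp add: iid_seq_def indep_vars_def2)
        then have "(\<lambda>w j. \<epsilon> (0 - int j) w) \<in> M \<rightarrow>\<^sub>M PiM UNIV (\<lambda>_. S)"
          by (intro measurable_PiM_single') (auto intro: measurable_space)
        then show ?thesis using f by (rule measurable_compose)
      qed
      have lawZ: "distr M borel (Z m) = distr M borel (Y 0)"
        unfolding cp(2) by (rule distr_cong_AE) (use repr[rule_format, of 0] \<epsilon>m in \<open>auto elim: AE_mp\<close>)
      have law_int: "(LINT w|M. g (Z m w)) = (LINT w|M. g (Y 0 w))"
        if [measurable]: "g \<in> borel_measurable borel" for g :: "'h \<Rightarrow> real"
        using integral_distr[of "Z m" M borel g] integral_distr[of "Y 0" M borel g] lawZ by simp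
      have LZ: "in_Lp M 4 (Z m)"
      proof -
        have "integrable (distr M borel (Y 0)) (\<lambda>x. norm x ^ 4)"
          using L[of 0] by (subst integrable_distr_eq) (auto simp: in_Lp_4_iff)
        then have "integrable M (\<lambda>w. norm (Z m w) ^ 4)"
          unfolding lawZ[symmetric] by (subst (asm) integrable_distr_eq) auto
        then show ?thesis by (simp add: in_Lp_4_iff)
      qed
      have "?cov (- int m) 0 \<le> 2 * (sqrt m4 * sqrt (sqrt m4)) * v_norm M 4 (\<lambda>w. Y 0 w - Z m w)"
      proof (rule sum_autocovariance_coupling_le[OF e L L LZ cp(1)])
        show "AE w in M. Y (- int m) w = f (\<lambda>j. \<epsilon> (0 - int m - int j) w)" using repr[rule_format, of "- int m"] by simp
        show "(LINT w|M. norm (Y 0 w) ^ 4) = m4" by (simp add: m4_def)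
        show "(LINT w|M. norm (Y (- int m) w) ^ 4) = m4"
          using strictly_stationary_single[OF st Ym, of "\<lambda>x. norm x ^ 4" "- int m"] by (simp add: m4_def)
        show "(LINT w|M. norm (Z m w) ^ 4) = m4"
          using law_int[of "\<lambda>x. norm x ^ 4"] by (simp add: m4_def)
        show "(LINT w|M. coord_product e p (Y (- int m) w)) = (LINT w|M. coord_product e p (Y 0 w))" for p
          by (rule strictly_stationary_single[OF st Ym]) simp
        show "(LINT w|M. coord_product e p (Z m w)) = (LINT w|M. coord_product e p (Y 0 w))" for p
          by (rule law_int) simp
      qed
      then show ?thesis using False by (simp add: \<gamma>_def)
    qed
    have shift: "?cov s t = ?cov (s - r) (t - r)" for s t r
      using strictly_stationary_pair[OF st Ym, of "coord_product e p" "coord_product e p" s t r for p] by simp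
    have sym: "?cov s t = ?cov t s" for s t by (simp add: mult.commute)
    show "?cov s t \<le> \<gamma> (nat \<bar>s - t\<bar>)"
    proof (cases "s \<le> t")
      case True
      then show ?thesis using lag[of "nat (t - s)"] shift[of s t t] by simp
    next
      case False
      then show ?thesis using lag[of "nat (s - t)"] shift[of t s s] sym[of s t] by simp
    qed
  qed
  ultimately show thesis using that by blast
qed

text \<open>Expanding the square gives a double sum over times. As in Schur's test, \<open>\<bar>a s
  * a t\<bar> \<le> (a s)\<^sup>2 / 2 + (a t)\<^sup>2 / 2\<close> and symmetry reduce it to row sums
  of \<open>\<gamma>\<close>. The weights stay squared, and this produces the factor
  \<open>1 / (T h)\<close> for kernel weights.\<close>

lemma variance_weighted_sum_le:
  fixes Y :: "int \<Rightarrow> 'a \<Rightarrow> 'h::{real_inner, second_countable_topology}" and a :: "nat \<Rightarrow> real"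
  assumes e: "ortho_seq e" and L: "\<And>t. in_Lp M 4 (Y t)" and \<gamma>: "summable \<gamma>" "\<And>m. \<gamma> m \<ge> 0"
    and mean: "\<And>p t. (LINT w|M. coord_product e p (Y t w)) = c p"
    and cov: "\<And>s t. (\<Sum>p\<in>{..<N}\<times>{..<N}.
        \<bar>(LINT w|M. coord_product e p (Y s w) * coord_product e p (Y t w)) - (c p)\<^sup>2\<bar>) \<le> \<gamma> (nat \<bar>s - t\<bar>)"
  shows "integrable M (\<lambda>w. \<Sum>p\<in>{..<N}\<times>{..<N}. (\<Sum>t=1..T. a t * (coord_product e p (Y (int t) w) - c p))\<^sup>2)"
    and "(LINT w|M. (\<Sum>p\<in>{..<N}\<times>{..<N}. (\<Sum>t=1..T. a t * (coord_product e p (Y (int t) w) - c p))\<^sup>2))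
      \<le> 2 * suminf \<gamma> * (\<Sum>t=1..T. (a t)\<^sup>2)"
proof -
  let ?P = "{..<N} \<times> {..<N}"
  define x where "x p t w = coord_product e p (Y (int t) w) - c p" for p t w
  define G where "G p s t = (LINT w|M. x p s w * x p t w)" for p s t
  have prod: "x p s w * x p t w = coord_product e p (Y (int s) w) * coord_product e p (Y (int t) w)
      - c p * coord_product e p (Y (int s) w) - c p * coord_product e p (Y (int t) w) + (c p)\<^sup>2" for p s t w
    by (simp add: x_def power2_eq_square algebra_simps)
  have int: "integrable M (\<lambda>w. x p s w * x p t w)" for p s t
    unfolding prod by (intro Bochner_Integration.integrable_add Bochner_Integration.integrable_diff
        integrable_mult_right coord_product_mult_integrable coord_product_integrable e L integrable_const)
  have G: "G p s t = (LINT w|M. coord_product e p (Y (int s) w) * coord_product e p (Y (int t) w)) - (c p)\<^sup>2" for p s t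
    unfolding G_def prod
    by (simp add: coord_product_mult_integrable[OF e L L] coord_product_integrable[OF e L] mean prob_space power2_eq_square)
  have square: "(\<Sum>p\<in>?P. (\<Sum>t=1..T. a t * x p t w)\<^sup>2)
      = (\<Sum>p\<in>?P. \<Sum>s=1..T. \<Sum>t=1..T. a s * a t * (x p s w * x p t w))" for w
    unfolding power2_eq_square sum_product by (intro sum.cong refl) (simp add: mult_ac)
  have int': "integrable M (\<lambda>w. \<Sum>p\<in>?P. \<Sum>s=1..T. \<Sum>t=1..T. a s * a t * (x p s w * x p t w))"
    by (intro Bochner_Integration.integrable_sum integrable_mult_right int)
  then have "integrable M (\<lambda>w. \<Sum>p\<in>?P. (\<Sum>t=1..T. a t * x p t w)\<^sup>2)"
    unfolding square .
  then show "integrable M (\<lambda>w. \<Sum>p\<in>?P. (\<Sum>t=1..T. a t * (coord_product e p (Y (int t) w) - c p))\<^sup>2)"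
    unfolding x_def .
  \<comment> \<open>Each lag occurs at most twice in a row: the distance to \<open>s\<close> is
    injective on the times up to \<open>s\<close> and on those after it.\<close>
  have row: "(\<Sum>t=1..T. \<gamma> (nat \<bar>int s - int t\<bar>)) \<le> 2 * suminf \<gamma>" for s
  proof -
    have inj: "(\<Sum>t\<in>A. \<gamma> (nat \<bar>int s - int t\<bar>)) \<le> suminf \<gamma>"
      if "finite A" "inj_on (\<lambda>t. nat \<bar>int s - int t\<bar>) A" for A
    proof -
      have "(\<Sum>t\<in>A. \<gamma> (nat \<bar>int s - int t\<bar>)) = sum \<gamma> ((\<lambda>t. nat \<bar>int s - int t\<bar>) ` A)"
        using that(2) by (simp add: sum.reindex)
      also have "\<dots> \<le> suminf \<gamma>" using that(1) \<gamma> by (intro sum_le_suminf) auto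
      finally show ?thesis .
    qed
    have "{1..T} = {1..T} \<inter> {..s} \<union> {1..T} \<inter> {s<..}" by auto
    then have "(\<Sum>t=1..T. \<gamma> (nat \<bar>int s - int t\<bar>)) =
        (\<Sum>t\<in>{1..T} \<inter> {..s} \<union> {1..T} \<inter> {s<..}. \<gamma> (nat \<bar>int s - int t\<bar>))"
      by (rule arg_cong)
    also have "\<dots> = (\<Sum>t\<in>{1..T} \<inter> {..s}. \<gamma> (nat \<bar>int s - int t\<bar>))
        + (\<Sum>t\<in>{1..T} \<inter> {s<..}. \<gamma> (nat \<bar>int s - int t\<bar>))"
      by (rule sum.union_disjoint) auto
    also have "\<dots> \<le> suminf \<gamma> + suminf \<gamma>"
      by (intro add_mono inj) (auto simp: inj_on_def)
    finally show ?thesis by simp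
  qed
  have "(LINT w|M. (\<Sum>p\<in>?P. (\<Sum>t=1..T. a t * x p t w)\<^sup>2))
      = (\<Sum>p\<in>?P. \<Sum>s=1..T. \<Sum>t=1..T. a s * a t * G p s t)"
    unfolding square G_def
    by (simp only: Bochner_Integration.integral_sum Bochner_Integration.integrable_sum
        integrable_mult_right int integral_mult_right_zero)
  also have "\<dots> = (\<Sum>s=1..T. \<Sum>t=1..T. a s * a t * (\<Sum>p\<in>?P. G p s t))"
    unfolding sum_distrib_left
    by (subst sum.swap, rule sum.cong[OF refl], subst sum.swap, rule refl)
  also have "\<dots> \<le> (\<Sum>s=1..T. \<Sum>t=1..T. ((a s)\<^sup>2 / 2 + (a t)\<^sup>2 / 2) * \<gamma> (nat \<bar>int s - int t\<bar>))"
  proof (intro sum_mono)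
    fix s t
    have "a s * a t * (\<Sum>p\<in>?P. G p s t) \<le> \<bar>a s * a t\<bar> * \<bar>\<Sum>p\<in>?P. G p s t\<bar>"
      by (simp only: abs_mult[symmetric] abs_ge_self)
    also have "\<dots> \<le> ((a s)\<^sup>2 / 2 + (a t)\<^sup>2 / 2) * \<gamma> (nat \<bar>int s - int t\<bar>)"
    proof (rule mult_mono)
      show "\<bar>a s * a t\<bar> \<le> (a s)\<^sup>2 / 2 + (a t)\<^sup>2 / 2"
        using sum_squares_bound[of "\<bar>a s\<bar>" "\<bar>a t\<bar>"] by (simp add: abs_mult)
      show "\<bar>\<Sum>p\<in>?P. G p s t\<bar> \<le> \<gamma> (nat \<bar>int s - int t\<bar>)"
        using order_trans[OF sum_abs cov[of "int s" "int t"]] by (simp add: G)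
    qed auto
    finally show "a s * a t * (\<Sum>p\<in>?P. G p s t) \<le> ((a s)\<^sup>2 / 2 + (a t)\<^sup>2 / 2) * \<gamma> (nat \<bar>int s - int t\<bar>)" .
  qed
  also have "\<dots> = (\<Sum>s=1..T. \<Sum>t=1..T. (a s)\<^sup>2 / 2 * \<gamma> (nat \<bar>int s - int t\<bar>))
      + (\<Sum>s=1..T. \<Sum>t=1..T. (a t)\<^sup>2 / 2 * \<gamma> (nat \<bar>int s - int t\<bar>))"
    by (simp only: distrib_right sum.distrib)
  also have "(\<Sum>s=1..T. \<Sum>t=1..T. (a t)\<^sup>2 / 2 * \<gamma> (nat \<bar>int s - int t\<bar>))
      = (\<Sum>s=1..T. \<Sum>t=1..T. (a s)\<^sup>2 / 2 * \<gamma> (nat \<bar>int s - int t\<bar>))"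
    by (subst sum.swap) (simp add: abs_minus_commute)
  also have "(\<Sum>s=1..T. \<Sum>t=1..T. (a s)\<^sup>2 / 2 * \<gamma> (nat \<bar>int s - int t\<bar>)) + \<dots>
      = (\<Sum>s=1..T. (a s)\<^sup>2 * (\<Sum>t=1..T. \<gamma> (nat \<bar>int s - int t\<bar>)))"
    unfolding sum.distrib[symmetric] sum_distrib_left by (intro sum.cong refl) simp
  also have "\<dots> \<le> (\<Sum>s=1..T. (a s)\<^sup>2 * (2 * suminf \<gamma>))"
    by (intro sum_mono mult_left_mono row) auto
  also have "\<dots> = 2 * suminf \<gamma> * (\<Sum>s=1..T. (a s)\<^sup>2)"
    by (simp add: sum_distrib_left mult_ac)
  finally show "(LINT w|M. (\<Sum>p\<in>?P. (\<Sum>t=1..T. a t * (coord_product e p (Y (int t) w) - c p))\<^sup>2))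
      \<le> 2 * suminf \<gamma> * (\<Sum>t=1..T. (a t)\<^sup>2)"
    by (simp add: x_def)
qed

end

section \<open>Covariance operators\<close>

lemma norm_tensor: "norm (tensor z z x) \<le> (norm z)\<^sup>2 * norm x"
proof -
  have "norm (tensor z z x) = \<bar>inner z x\<bar> * norm z" by (simp add: tensor_def)
  also have "\<dots> \<le> (norm z * norm x) * norm z" by (intro mult_right_mono Cauchy_Schwarz_ineq2) simp
  finally show ?thesis by (simp add: power2_eq_square mult_ac)
qed

lemma bounded_linear_tensor: "bounded_linear (tensor z z)"
  by (rule bounded_linear_intro[where K = "(norm z)\<^sup>2"])
    (use norm_tensor[of z] in \<open>simp_all add: tensor_def inner_add_right scaleR_add_left mult.commute[of "norm _"]\<close>)

lemma (in prob_space) in_Lp_4_square_integrable: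
  assumes "in_Lp M 4 Z"
  shows "integrable M (\<lambda>w. (norm (Z w))\<^sup>2)"
  by (rule square_integrable_imp_integrable) (use assms in \<open>auto simp: in_Lp_4_iff\<close>)

context
  fixes M :: "'w measure" and Z :: "'w \<Rightarrow> 'h::{real_inner, banach, second_countable_topology}"
  assumes Z [measurable]: "Z \<in> borel_measurable M" and Z2: "integrable M (\<lambda>w. (norm (Z w))\<^sup>2)"
begin

lemma integrable_tensor: "integrable M (\<lambda>w. tensor (Z w) (Z w) x)"
proof (rule Bochner_Integration.integrable_bound[of _ "\<lambda>w. (norm (Z w))\<^sup>2 * norm x"])
  show "integrable M (\<lambda>w. (norm (Z w))\<^sup>2 * norm x)" using Z2 by (rule integrable_mult_left)
  show "(\<lambda>w. tensor (Z w) (Z w) x) \<in> borel_measurable M"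
    unfolding tensor_def by (intro borel_measurable_scaleR borel_measurable_inner Z borel_measurable_const)
  show "AE w in M. norm (tensor (Z w) (Z w) x) \<le> norm ((norm (Z w))\<^sup>2 * norm x)"
    by (rule AE_I2) (simp add: norm_tensor)
qed

lemma inner_cov_op: "inner (cov_op M Z x) y = (LINT w|M. inner (Z w) x * inner (Z w) y)"
proof -
  have "inner (cov_op M Z x) y = (LINT w|M. inner (tensor (Z w) (Z w) x) y)"
    unfolding cov_op_def by (rule integral_inner_left[symmetric]) (use integrable_tensor in auto)
  then show ?thesis by (simp add: tensor_def)
qed

lemma norm_cov_op_le: "norm (cov_op M Z x) \<le> (LINT w|M. (norm (Z w))\<^sup>2) * norm x"
proof -
  have "norm (cov_op M Z x) \<le> (LINT w|M. norm (tensor (Z w) (Z w) x))"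
    unfolding cov_op_def by (rule integral_norm_bound)
  also have "\<dots> \<le> (LINT w|M. (norm (Z w))\<^sup>2 * norm x)"
    by (rule integral_mono) (use Z2 integrable_tensor in \<open>auto simp: norm_tensor\<close>)
  finally show ?thesis by simp
qed

lemma bounded_linear_cov_op: "bounded_linear (cov_op M Z)"
proof (rule bounded_linear_intro)
  show "cov_op M Z (x + y) = cov_op M Z x + cov_op M Z y" for x y
    unfolding cov_op_def Bochner_Integration.integral_add[OF integrable_tensor integrable_tensor, symmetric]
    by (simp add: tensor_def inner_add_right scaleR_add_left)
  show "cov_op M Z (r *\<^sub>R x) = r *\<^sub>R cov_op M Z x" for r x
    unfolding cov_op_def integral_scaleR_right[symmetric] by (simp add: tensor_def)
  show "norm (cov_op M Z x) \<le> norm x * (LINT w|M. (norm (Z w))\<^sup>2)" for x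
    using norm_cov_op_le[of x] by (simp add: mult.commute)
qed

lemma cov_op_adjoint: "inner (cov_op M Z x) y = inner x (cov_op M Z y)"
proof -
  have "inner (cov_op M Z x) y = inner (cov_op M Z y) x"
    unfolding inner_cov_op by (simp only: mult.commute)
  then show ?thesis by (simp only: inner_commute)
qed

lemma cov_op_nonneg: "inner (cov_op M Z x) x \<ge> 0"
  by (simp add: inner_cov_op)

text \<open>Dominated convergence: along a bounded weakly convergent sequence the integrand
  converges pointwise and is dominated by \<open>(norm (Z w))\<^sup>2 * b\<close>.\<close>

lemma completely_continuous_cov_op: "completely_continuous (cov_op M Z)"
  unfolding completely_continuous_def
proof (intro allI impI)
  fix x :: "nat \<Rightarrow> 'h"
  assume "bounded (range x)" and conv: "\<forall>y. convergent (\<lambda>k. inner (x k) y)"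
  then obtain b where b: "\<And>k. norm (x k) \<le> b" unfolding bounded_iff by auto
  define g where "g w = lim (\<lambda>k. inner (Z w) (x k))" for w
  have lim: "(\<lambda>k. inner (Z w) (x k)) \<longlonglongrightarrow> g w" for w
  proof -
    have "convergent (\<lambda>k. inner (Z w) (x k))"
      using conv by (subst inner_commute) blast
    then show ?thesis unfolding g_def by (simp only: convergent_LIMSEQ_iff)
  qed
  have [measurable]: "g \<in> borel_measurable M" unfolding g_def by measurable
  have "(\<lambda>k. cov_op M Z (x k)) \<longlonglongrightarrow> (LINT w|M. g w *\<^sub>R Z w)"
    unfolding cov_op_def
  proof (rule integral_dominated_convergence)
    show "integrable M (\<lambda>w. (norm (Z w))\<^sup>2 * b)" using Z2 by simp
    show "AE w in M. (\<lambda>k. tensor (Z w) (Z w) (x k)) \<longlonglongrightarrow> g w *\<^sub>R Z w"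
      unfolding tensor_def by (intro AE_I2 tendsto_scaleR lim tendsto_const)
    show "AE w in M. norm (tensor (Z w) (Z w) (x k)) \<le> (norm (Z w))\<^sup>2 * b" for k
      by (rule AE_I2) (rule order_trans[OF norm_tensor], intro mult_left_mono b, simp)
    show "(\<lambda>w. tensor (Z w) (Z w) (x k)) \<in> borel_measurable M" for k
      using integrable_tensor by (rule borel_measurable_integrable)
  qed measurable
  then show "convergent (\<lambda>k. cov_op M Z (x k))" by (rule convergentI)
qed

end

section \<open>Kernel estimators as operators\<close>

lemma inner_local_cov:
  "inner (local_cov K h X u T w x) y =
    (1 / (real T * h T)) * (\<Sum>t=1..T. K ((u - real t / real T) / h T) * (inner (X t T w) x * inner (X t T w) y))"
  by (simp add: local_cov_def inner_sum_left tensor_def mult.assoc)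

lemma bounded_linear_local_cov: "bounded_linear (local_cov K h X u T w)"
  unfolding local_cov_def[abs_def]
  by (intro bounded_linear_compose[OF bounded_linear_scaleR_right] bounded_linear_sum bounded_linear_tensor)

lemma local_cov_adjoint: "inner (local_cov K h X u T w x) y = inner x (local_cov K h X u T w y)"
proof -
  have "inner (local_cov K h X u T w x) y = inner (local_cov K h X u T w y) x"
    unfolding inner_local_cov by (simp only: mult.commute[of "inner (X t T w) x" for t])
  then show ?thesis by (simp only: inner_commute)
qed

text \<open>Finite rank: the image depends on the argument through finitely many scalar
  products.\<close>

lemma completely_continuous_local_cov: "completely_continuous (local_cov K h X u T w)"
  unfolding completely_continuous_def
proof (intro allI impI)
  fix x :: "nat \<Rightarrow> 'a" assume "\<forall>y. convergent (\<lambda>k. inner (x k) y)"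
  then obtain l where "\<And>y. (\<lambda>k. inner (x k) y) \<longlonglongrightarrow> l y" unfolding convergent_def by metis
  then have lim: "(\<lambda>k. inner y (x k)) \<longlonglongrightarrow> l y" for y by (simp add: inner_commute[of y])
  have "(\<lambda>k. local_cov K h X u T w (x k)) \<longlonglongrightarrow> (1 / (real T * h T)) *\<^sub>R
      (\<Sum>t=1..T. K ((u - real t / real T) / h T) *\<^sub>R l (X t T w) *\<^sub>R X t T w)"
    unfolding local_cov_def tensor_def by (intro tendsto_scaleR tendsto_sum tendsto_const lim)
  then show "convergent (\<lambda>k. local_cov K h X u T w (x k))" by (rule convergentI)
qed

text \<open>Supplies the finite set required by
  \<open>leading_eigensystem_nonneg_if_kernel\<close>.\<close>

lemma local_cov_kernel:
  assumes "\<And>y. y \<in> (\<lambda>t. X t T w) ` {1..T} \<Longrightarrow> inner x y = 0"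
  shows "local_cov K h X u T w x = 0"
proof -
  have "tensor (X t T w) (X t T w) x = 0" if "t \<in> {1..T}" for t
  proof -
    have "inner x (X t T w) = 0" by (rule assms) (use that in blast)
    then show ?thesis unfolding tensor_def by (subst inner_commute) simp
  qed
  then have "(\<Sum>t=1..T. K ((u - real t / real T) / h T) *\<^sub>R tensor (X t T w) (X t T w) x) = 0"
    by (intro sum.neutral) simp
  then show ?thesis unfolding local_cov_def by simp
qed

lemma norm_tensor_diff:
  fixes y z x :: "'h::real_inner"
  shows "norm (tensor z z x - tensor y y x) \<le> norm (z - y) * (norm z + norm y) * norm x"
proof -
  have "tensor z z x - tensor y y x = inner (z - y) x *\<^sub>R z + inner y x *\<^sub>R (z - y)"
    by (simp add: tensor_def inner_diff_left scaleR_diff_left scaleR_diff_right)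
  also have "norm \<dots> \<le> \<bar>inner (z - y) x\<bar> * norm z + \<bar>inner y x\<bar> * norm (z - y)"
    by (rule order_trans[OF norm_triangle_ineq]) simp
  also have "\<dots> \<le> (norm (z - y) * norm x) * norm z + (norm y * norm x) * norm (z - y)"
    by (intro add_mono mult_right_mono Cauchy_Schwarz_ineq2) auto
  finally show ?thesis by (simp add: algebra_simps)
qed

text \<open>For positive bandwidth this dominates the operator norm of the difference of the two
  estimators. As a finite sum of norms it is free of the argument \<open>x\<close> and can be
  integrated directly, without measurability questions about a supremum.\<close>

definition local_cov_dist ::
  "(real \<Rightarrow> real) \<Rightarrow> (nat \<Rightarrow> real) \<Rightarrow> (nat \<Rightarrow> nat \<Rightarrow> 'w \<Rightarrow> 'h::real_inner) \<Rightarrow> (nat \<Rightarrow> nat \<Rightarrow> 'w \<Rightarrow> 'h)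
    \<Rightarrow> real \<Rightarrow> nat \<Rightarrow> 'w \<Rightarrow> real" where
  "local_cov_dist K h X Y u T w = (1 / (real T * h T)) * (\<Sum>t=1..T. \<bar>K ((u - real t / real T) / h T)\<bar> *
     (norm (X t T w - Y t T w) * (norm (X t T w) + norm (Y t T w))))"

lemma norm_local_cov_diff_le:
  assumes "h T > 0"
  shows "norm (local_cov K h X u T w x - local_cov K h Y u T w x) \<le> local_cov_dist K h X Y u T w * norm x"
proof -
  let ?k = "\<lambda>t. K ((u - real t / real T) / h T)"
  have "local_cov K h X u T w x - local_cov K h Y u T w x = (1 / (real T * h T)) *\<^sub>R
      (\<Sum>t=1..T. ?k t *\<^sub>R (tensor (X t T w) (X t T w) x - tensor (Y t T w) (Y t T w) x))"
    by (simp add: local_cov_def scaleR_diff_right sum_subtractf)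
  then have "norm (local_cov K h X u T w x - local_cov K h Y u T w x) = (1 / (real T * h T)) *
      norm (\<Sum>t=1..T. ?k t *\<^sub>R (tensor (X t T w) (X t T w) x - tensor (Y t T w) (Y t T w) x))"
    using assms by simp
  also have "\<dots> \<le> (1 / (real T * h T)) * (\<Sum>t=1..T. \<bar>?k t\<bar> *
      (norm (X t T w - Y t T w) * (norm (X t T w) + norm (Y t T w)) * norm x))"
    using assms
    by (intro mult_left_mono sum_norm_le) (auto intro!: mult_left_mono norm_tensor_diff)
  finally show ?thesis
    by (simp add: local_cov_dist_def sum_distrib_right mult.assoc)
qed

section \<open>Rates\<close>

context prob_space
begin

text \<open>\<open>\<delta>\<close> carries the rate, while \<open>D\<close> is a crude bound on it
  that enters the constant. Pointwise, \<open>norm (X w) \<le> norm (Y w) + D * U w\<close> and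
  \<open>2 * U w * norm (Y w) \<le> (U w)\<^sup>2 + (norm (Y w))\<^sup>2\<close>, so second moments
  of \<open>U\<close> suffice; they come from
  \<open>(U w)\<^sup>2 \<le> 1 + U w powr \<rho>\<close>.\<close>

lemma expectation_local_increment_le:
  fixes X Y :: "'a \<Rightarrow> 'h::{real_inner, second_countable_topology}"
  assumes L: "in_Lp M 4 X" "in_Lp M 4 Y"
    and U: "U \<in> borel_measurable M" "AE w in M. U w > 0" "integrable M (\<lambda>w. U w powr \<rho>)"
      "(LINT w|M. U w powr \<rho>) \<le> c" and rho: "\<rho> \<ge> 2"
    and near: "AE w in M. norm (X w - Y w) \<le> \<delta> * U w" and \<delta>: "0 \<le> \<delta>" "\<delta> \<le> D"
  shows "integrable M (\<lambda>w. norm (X w - Y w) * (norm (X w) + norm (Y w)))"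
    and "(LINT w|M. norm (X w - Y w) * (norm (X w) + norm (Y w)))
      \<le> \<delta> * ((D + 1) * (1 + c) + (LINT w|M. (norm (Y w))\<^sup>2))"
proof -
  have [measurable]: "X \<in> borel_measurable M" "Y \<in> borel_measurable M" using L by (auto simp: in_Lp_4_iff)
  have X2: "integrable M (\<lambda>w. (norm (X w))\<^sup>2)" and Y2: "integrable M (\<lambda>w. (norm (Y w))\<^sup>2)"
    using L by (auto intro: in_Lp_4_square_integrable)
  show int: "integrable M (\<lambda>w. norm (X w - Y w) * (norm (X w) + norm (Y w)))"
  proof (rule Bochner_Integration.integrable_bound)
    show "integrable M (\<lambda>w. 2 * ((norm (X w))\<^sup>2 + (norm (Y w))\<^sup>2))" using X2 Y2 by simp
    show "AE w in M. norm (norm (X w - Y w) * (norm (X w) + norm (Y w)))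
        \<le> norm (2 * ((norm (X w))\<^sup>2 + (norm (Y w))\<^sup>2))"
    proof (rule AE_I2)
      fix w
      have "norm (X w - Y w) * (norm (X w) + norm (Y w)) \<le> (norm (X w) + norm (Y w)) * (norm (X w) + norm (Y w))"
        by (intro mult_right_mono norm_triangle_ineq4) auto
      also have "\<dots> \<le> 2 * ((norm (X w))\<^sup>2 + (norm (Y w))\<^sup>2)"
        using sum_squares_bound[of "norm (X w)" "norm (Y w)"] by (simp add: power2_eq_square algebra_simps)
      finally show "norm (norm (X w - Y w) * (norm (X w) + norm (Y w)))
        \<le> norm (2 * ((norm (X w))\<^sup>2 + (norm (Y w))\<^sup>2))" by simp
    qed
  qed measurable
  have iU: "integrable M (\<lambda>w. (D + 1) * (1 + U w powr \<rho>))" using U(3) by simp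
  have "(LINT w|M. norm (X w - Y w) * (norm (X w) + norm (Y w)))
      \<le> (LINT w|M. \<delta> * ((D + 1) * (1 + U w powr \<rho>) + (norm (Y w))\<^sup>2))"
  proof (rule integral_mono_AE[OF int])
    show "integrable M (\<lambda>w. \<delta> * ((D + 1) * (1 + U w powr \<rho>) + (norm (Y w))\<^sup>2))"
      by (rule integrable_mult_right) (rule Bochner_Integration.integrable_add[OF iU Y2])
    show "AE w in M. norm (X w - Y w) * (norm (X w) + norm (Y w))
        \<le> \<delta> * ((D + 1) * (1 + U w powr \<rho>) + (norm (Y w))\<^sup>2)"
      using near U(2)
    proof eventually_elim
      case (elim w)
      have "norm (X w) \<le> norm (Y w) + norm (X w - Y w)" using norm_triangle_ineq[of "Y w" "X w - Y w"] by simp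
      also have "\<dots> \<le> norm (Y w) + D * U w"
        using elim \<delta> by (meson add_left_mono mult_right_mono less_imp_le order_trans)
      finally have "norm (X w) + norm (Y w) \<le> 2 * norm (Y w) + D * U w" by simp
      then have "norm (X w - Y w) * (norm (X w) + norm (Y w)) \<le> (\<delta> * U w) * (2 * norm (Y w) + D * U w)"
        using elim \<delta> by (intro mult_mono) auto
      also have "\<dots> = \<delta> * (2 * U w * norm (Y w) + D * (U w)\<^sup>2)" by (simp add: power2_eq_square algebra_simps)
      also have "\<dots> \<le> \<delta> * ((D + 1) * (U w)\<^sup>2 + (norm (Y w))\<^sup>2)"
        using sum_squares_bound[of "U w" "norm (Y w)"] \<delta>(1)
        by (intro mult_left_mono) (auto simp: algebra_simps)
      also have "\<dots> \<le> \<delta> * ((D + 1) * (1 + U w powr \<rho>) + (norm (Y w))\<^sup>2)"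
      proof -
        have "(U w)\<^sup>2 \<le> 1 + U w powr \<rho>"
        proof (cases "U w \<le> 1")
          case True
          then have "(U w)\<^sup>2 \<le> 1" using elim by (simp add: power_le_one)
          then show ?thesis using powr_ge_zero[of "U w" \<rho>] by linarith
        next
          case False
          then have "(U w)\<^sup>2 = U w powr 2" by simp
          also have "\<dots> \<le> U w powr \<rho>" using False rho by (intro powr_mono) auto
          finally show ?thesis by simp
        qed
        then show ?thesis using \<delta> by (intro mult_left_mono add_right_mono) auto
      qed
      finally show ?case .
    qed
  qed
  also have "\<dots> = \<delta> * ((D + 1) * (1 + (LINT w|M. U w powr \<rho>)) + (LINT w|M. (norm (Y w))\<^sup>2))"
  proof -
    have "(LINT w|M. 1 + U w powr \<rho>) = 1 + (LINT w|M. U w powr \<rho>)"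
      using U(3) by (simp add: prob_space)
    then show ?thesis
      unfolding integral_mult_right_zero Bochner_Integration.integral_add[OF iU Y2] by simp
  qed
  also have "\<dots> \<le> \<delta> * ((D + 1) * (1 + c) + (LINT w|M. (norm (Y w))\<^sup>2))"
    using U(4) \<delta> by (intro mult_left_mono add_right_mono) auto
  finally show "(LINT w|M. norm (X w - Y w) * (norm (X w) + norm (Y w)))
      \<le> \<delta> * ((D + 1) * (1 + c) + (LINT w|M. (norm (Y w))\<^sup>2))" .
qed

text \<open>Markov's inequality at each \<open>N\<close>, then continuity from below along
  increasing events. With \<open>S N\<close> a truncated squared Hilbert--Schmidt norm, all
  truncations are controlled at once.\<close>

lemma prob_exceeds_mono_sequence_le:
  fixes S :: "nat \<Rightarrow> 'a \<Rightarrow> real"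
  assumes int: "\<And>N. integrable M (S N)" and pos: "\<And>N w. S N w \<ge> 0" and mono: "\<And>w. mono (\<lambda>N. S N w)"
    and le: "\<And>N. (LINT w|M. S N w) \<le> b" and c: "c > 0"
  shows "{w \<in> space M. \<exists>N. S N w \<ge> c} \<in> sets M" and "prob {w \<in> space M. \<exists>N. S N w \<ge> c} \<le> b / c"
proof -
  have [measurable]: "S N \<in> borel_measurable M" for N using int by (rule borel_measurable_integrable)
  have eq: "{w \<in> space M. \<exists>N. S N w \<ge> c} = (\<Union>N. {w \<in> space M. S N w \<ge> c})" by auto
  show "{w \<in> space M. \<exists>N. S N w \<ge> c} \<in> sets M" by measurable
  have lim: "(\<lambda>N. prob {w \<in> space M. S N w \<ge> c}) \<longlonglongrightarrow> prob (\<Union>N. {w \<in> space M. S N w \<ge> c})"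
  proof (rule finite_Lim_measure_incseq)
    show "incseq (\<lambda>N. {w \<in> space M. S N w \<ge> c})"
    proof (intro monoI subsetI CollectI conjI)
      fix m n w assume "m \<le> n" and w: "w \<in> {w \<in> space M. S m w \<ge> c}"
      then have "S m w \<le> S n w" using mono[of w] by (simp add: mono_def)
      then show "c \<le> S n w" using w by simp
    qed auto
  qed auto
  have "prob {w \<in> space M. S N w \<ge> c} \<le> b / c" for N
  proof -
    have "prob {w \<in> space M. S N w \<ge> c} \<le> (LINT w|M. S N w) / c"
      using integral_Markov_inequality_measure[OF int[of N], of "{}" c] pos c by auto
    also have "\<dots> \<le> b / c" using le[of N] c by (simp add: divide_right_mono)
    finally show ?thesis .
  qed
  then show "prob {w \<in> space M. \<exists>N. S N w \<ge> c} \<le> b / c"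
    unfolding eq by (intro LIMSEQ_le_const2[OF lim]) blast
qed

end

section \<open>Arithmetic of the rate and the stochastic bound for the estimator\<close>

definition cov_rate :: "(nat \<Rightarrow> real) \<Rightarrow> nat \<Rightarrow> real" where
  "cov_rate h T = h T + sqrt (1 / (real T * h T)) + 1 / (real T * (h T)\<^sup>2)"

text \<open>From \<open>h T \<le> 1\<close> and \<open>T \<ge> 1\<close> follow
  \<open>m \<le> d\<close> and \<open>1 / T \<le> d\<close>, in the notation of the proof. Since
  \<open>d\<close> may be large, products need care: in the bias its cofactor is bounded by a
  constant, and in the variance \<open>m * d \<le> d\<^sup>2\<close> is absorbed by the squared
  rate.\<close>

lemma cov_rate_bounds:
  assumes T: "T \<ge> 1" and h: "0 < h T" "h T \<le> 1"
  shows cov_rate_pos: "cov_rate h T > 0"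
    and cov_rate_ge: "1 / (real T * (h T)\<^sup>2) \<le> cov_rate h T"
    and bias_le_cov_rate: "\<lbrakk>0 \<le> C; 0 \<le> k; 0 \<le> L\<rbrakk> \<Longrightarrow>
      (C * h T + 1 / real T) * (k + L / (real T * (h T)\<^sup>2)) \<le> (C + 1) * (k + L) * cov_rate h T"
    and variance_le_cov_rate: "\<lbrakk>0 \<le> k; 0 \<le> L\<rbrakk> \<Longrightarrow>
      1 / (real T * h T) * (k + L / (real T * (h T)\<^sup>2)) \<le> (k + L) * (cov_rate h T)\<^sup>2"
proof -
  define d where "d = 1 / (real T * (h T)\<^sup>2)"
  define m where "m = 1 / (real T * h T)"
  have d0: "d > 0" and m0: "m > 0" using T h by (simp_all add: d_def m_def)
  have hd: "cov_rate h T = h T + sqrt m + d" by (simp add: cov_rate_def d_def m_def)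
  have h2: "(h T)\<^sup>2 \<le> h T" using h by (simp add: power2_eq_square mult_left_le)
  have md: "m \<le> d"
    unfolding m_def d_def using T h h2 by (intro divide_left_mono mult_left_mono) auto
  have Td: "1 / real T \<le> d"
    unfolding d_def using T h by (intro divide_left_mono) (auto simp: power_le_one mult_left_le)
  have T1: "1 / real T \<le> 1" using T by simp
  show pos: "cov_rate h T > 0" unfolding hd using d0 m0 h by (simp add: add_pos_pos)
  show ge: "1 / (real T * (h T)\<^sup>2) \<le> cov_rate h T" using h m0 by (simp add: hd d_def)
  have ge_hd: "h T + d \<le> cov_rate h T" using m0 by (simp add: hd)
  show "(C * h T + 1 / real T) * (k + L / (real T * (h T)\<^sup>2)) \<le> (C + 1) * (k + L) * cov_rate h T"
    if "0 \<le> C" "0 \<le> k" "0 \<le> L"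
  proof -
    have "C * h T + 1 / real T \<le> C * h T + d" using Td by simp
    also have "\<dots> \<le> (C + 1) * (h T + d)" using that h d0 by (simp add: algebra_simps)
    finally have le1: "C * h T + 1 / real T \<le> (C + 1) * (h T + d)" .
    have "C * h T \<le> C * 1" using that h by (intro mult_left_mono) auto
    then have le2: "C * h T + 1 / real T \<le> C + 1" using T1 by simp
    have "(C * h T + 1 / real T) * (k + L / (real T * (h T)\<^sup>2))
        = (C * h T + 1 / real T) * k + (C * h T + 1 / real T) * (L * d)"
      by (simp add: d_def algebra_simps)
    also have "\<dots> \<le> (C + 1) * (h T + d) * k + (C + 1) * (L * d)"
      by (rule add_mono[OF mult_right_mono[OF le1] mult_right_mono[OF le2]]) (use that d0 in auto)
    also have "\<dots> \<le> (C + 1) * (h T + d) * k + (C + 1) * (L * (h T + d))"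
      using that h by (intro add_left_mono mult_left_mono) auto
    also have "\<dots> = (C + 1) * (k + L) * (h T + d)" by (simp add: algebra_simps)
    also have "\<dots> \<le> (C + 1) * (k + L) * cov_rate h T"
      using that by (intro mult_left_mono ge_hd) auto
    finally show ?thesis .
  qed
  show "1 / (real T * h T) * (k + L / (real T * (h T)\<^sup>2)) \<le> (k + L) * (cov_rate h T)\<^sup>2"
    if "0 \<le> k" "0 \<le> L"
  proof -
    have "m = (sqrt m)\<^sup>2" using m0 by simp
    also have "\<dots> \<le> (cov_rate h T)\<^sup>2" using h d0 m0 by (intro power_mono) (auto simp: hd)
    finally have m_le: "m \<le> (cov_rate h T)\<^sup>2" .
    have "d\<^sup>2 \<le> (cov_rate h T)\<^sup>2" using ge d0 by (intro power_mono) (auto simp: d_def)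
    moreover have "m * d \<le> d\<^sup>2" using md d0 by (simp add: power2_eq_square mult_right_mono)
    ultimately have md_le: "m * d \<le> (cov_rate h T)\<^sup>2" by linarith
    have "1 / (real T * h T) * (k + L / (real T * (h T)\<^sup>2)) = k * m + L * (m * d)"
      by (simp add: d_def m_def algebra_simps)
    also have "\<dots> \<le> k * (cov_rate h T)\<^sup>2 + L * (cov_rate h T)\<^sup>2"
      using m_le md_le that by (intro add_mono mult_left_mono) auto
    finally show ?thesis by (simp add: algebra_simps)
  qed
qed

context prob_space
begin

text \<open>The kernel vanishes unless \<open>t / T\<close> is within \<open>C * h T\<close> of
  \<open>u\<close>, so only times with increment factor at most \<open>C * h T + 1 / T\<close>
  contribute.\<close>

lemma expectation_local_cov_dist_le:
  fixes X Y :: "nat \<Rightarrow> nat \<Rightarrow> 'a \<Rightarrow> 'h::{real_inner, second_countable_topology}"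
  assumes L: "\<And>t. t \<in> {1..T} \<Longrightarrow> in_Lp M 4 (X t T)" "\<And>t. t \<in> {1..T} \<Longrightarrow> in_Lp M 4 (Y t T)"
    and U: "\<And>t. t \<in> {1..T} \<Longrightarrow> U t T \<in> borel_measurable M \<and> (AE w in M. U t T w > 0) \<and>
      integrable M (\<lambda>w. U t T w powr \<rho>) \<and> (LINT w|M. U t T w powr \<rho>) < c \<and>
      (AE w in M. norm (X t T w - Y t T w) \<le> (\<bar>real t / real T - u\<bar> + 1 / real T) * U t T w)"
    and rho: "\<rho> \<ge> 2" and c: "c \<ge> 0" and T: "T \<ge> 1" and h: "0 < h T" "h T \<le> 1"
    and supp: "\<And>z. \<bar>z\<bar> > C \<Longrightarrow> K z = 0" and C: "C \<ge> 0"
    and m: "\<And>t. t \<in> {1..T} \<Longrightarrow> (LINT w|M. (norm (Y t T w))\<^sup>2) = m2"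
  shows "integrable M (local_cov_dist K h X Y u T)"
    and "(LINT w|M. local_cov_dist K h X Y u T w) \<le>
      (C * h T + 1 / real T) * ((\<Sum>t=1..T. \<bar>K ((u - real t / real T) / h T)\<bar>) / (real T * h T)) * ((C + 2) * (1 + c) + m2)"
proof -
  let ?k = "\<lambda>t. K ((u - real t / real T) / h T)"
  let ?D = "\<lambda>t w. norm (X t T w - Y t T w) * (norm (X t T w) + norm (Y t T w))"
  have m2: "m2 \<ge> 0"
  proof -
    have "0 \<le> (LINT w|M. (norm (Y 1 T w))\<^sup>2)" by simp
    also have "\<dots> = m2" by (rule m) (use T in simp)
    finally show ?thesis .
  qed
  \<comment> \<open>Integrability is claimed also for times off the support, so here the increment
    factor serves as its own bound \<open>D\<close>.\<close>
  have int: "integrable M (?D t)" if "t \<in> {1..T}" for t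
    using U[OF that] L(1)[OF that] L(2)[OF that]
    by (intro expectation_local_increment_le(1)[where U = "U t T" and \<rho> = \<rho> and c = c
          and \<delta> = "\<bar>real t / real T - u\<bar> + 1 / real T" and D = "\<bar>real t / real T - u\<bar> + 1 / real T"])
      (auto intro: rho less_imp_le)
  have int': "integrable M (\<lambda>w. 1 / (real T * h T) * (\<Sum>t=1..T. \<bar>?k t\<bar> * ?D t w))"
    by (intro integrable_mult_right Bochner_Integration.integrable_sum int)
  then show "integrable M (local_cov_dist K h X Y u T)" unfolding local_cov_dist_def[abs_def] .
  have "(LINT w|M. local_cov_dist K h X Y u T w) = 1 / (real T * h T) * (\<Sum>t=1..T. \<bar>?k t\<bar> * (LINT w|M. ?D t w))"
    unfolding local_cov_dist_def integral_mult_right_zero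
    by (subst Bochner_Integration.integral_sum) (auto intro: int)
  also have "\<dots> \<le> 1 / (real T * h T) *
      (\<Sum>t=1..T. \<bar>?k t\<bar> * ((C * h T + 1 / real T) * ((C + 2) * (1 + c) + m2)))"
  proof (rule mult_left_mono[OF sum_mono])
    fix t assume t: "t \<in> {1..T}"
    show "\<bar>?k t\<bar> * (LINT w|M. ?D t w) \<le> \<bar>?k t\<bar> * ((C * h T + 1 / real T) * ((C + 2) * (1 + c) + m2))"
    proof (cases "?k t = 0")
      case False
      define \<delta> where "\<delta> = \<bar>real t / real T - u\<bar> + 1 / real T"
      have "\<bar>(u - real t / real T) / h T\<bar> \<le> C" using supp[of "(u - real t / real T) / h T"] False by force
      then have "\<bar>real t / real T - u\<bar> \<le> C * h T" using h by (simp add: abs_divide field_simps abs_minus_commute)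
      then have \<delta>: "\<delta> \<le> C * h T + 1 / real T" "0 \<le> \<delta>" by (simp_all add: \<delta>_def)
      have "C * h T \<le> C * 1" using h C by (intro mult_left_mono) auto
      moreover have "1 / real T \<le> 1" using T by simp
      \<comment> \<open>Taking \<open>D = C + 1\<close> produces the constant \<open>C + 2\<close>
        of the statement as \<open>D + 1\<close>.\<close>
      ultimately have \<delta>1: "\<delta> \<le> C + 1" using \<delta> by linarith
      have "(LINT w|M. ?D t w) \<le> \<delta> * ((C + 1 + 1) * (1 + c) + (LINT w|M. (norm (Y t T w))\<^sup>2))"
        using U[OF t] L(1)[OF t] L(2)[OF t] \<delta> \<delta>1
        by (intro expectation_local_increment_le(2)[where U = "U t T" and \<rho> = \<rho>])
          (auto intro: rho less_imp_le simp: \<delta>_def)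
      also have "\<dots> = \<delta> * ((C + 2) * (1 + c) + m2)" by (simp add: m[OF t])
      also have "\<dots> \<le> (C * h T + 1 / real T) * ((C + 2) * (1 + c) + m2)"
        using \<delta> C c m2 by (intro mult_right_mono) auto
      finally show ?thesis by (intro mult_left_mono) auto
    qed simp
  qed (use h in auto)
  finally show "(LINT w|M. local_cov_dist K h X Y u T w) \<le>
      (C * h T + 1 / real T) * ((\<Sum>t=1..T. \<bar>?k t\<bar>) / (real T * h T)) * ((C + 2) * (1 + c) + m2)"
    unfolding sum_distrib_right[symmetric] by (simp add: mult_ac)
qed

text \<open>The exceptional event is chosen before \<open>x\<close>, so the estimate bounds an
  operator norm. The stationary estimator is centred at \<open>\<kappa>\<close> times the covariance
  operator, where \<open>\<kappa>\<close> is the normalised sum of the kernel weights; the remaining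
  factor \<open>\<kappa> - 1\<close> is deterministic.\<close>

proposition local_cov_rate:
  fixes X :: "nat \<Rightarrow> nat \<Rightarrow> 'a \<Rightarrow> 'h::{real_inner, banach, second_countable_topology}"
  assumes rho: "\<rho> \<ge> 2" and loc: "locally_stationary M 4 \<rho> X Xs"
    and u: "u \<in> {0<..<1}" and approx: "Lp_m_approximable M S 4 (Xs u)"
    and K_bdd: "bounded (range K)" and K_lip: "L-lipschitz_on UNIV K"
    and K_supp: "\<And>z. \<bar>z\<bar> > C \<Longrightarrow> K z = 0" and K_int: "(LINT z|lborel. K z) = 1"
    and h_pos: "\<And>T. T \<ge> 1 \<Longrightarrow> h T > 0" and h_lim: "h \<longlonglongrightarrow> 0" and e0: "\<epsilon> > 0"
  obtains B where "B > 0" "\<forall>\<^sub>F T in sequentially. \<exists>E\<in>sets M. prob E < \<epsilon> \<and> (\<forall>w\<in>space M - E. \<forall>x.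
      norm (local_cov K h X u T w x - cov_op M (Xs u 0) x) \<le> B * cov_rate h T * norm x)"
proof -
  define Y where "Y = Xs u"
  have u01: "u \<in> {0..1}" using u by simp
  have LX: "in_Lp M 4 (X t T)" if "t \<in> {1..T}" for t T using loc that by (simp add: locally_stationary_def)
  have LY: "in_Lp M 4 (Y t)" for t using loc u01 by (simp add: locally_stationary_def Y_def)
  have st: "strictly_stationary M Y" using loc u01 by (simp add: locally_stationary_def Y_def)
  have Ym [measurable]: "Y t \<in> borel_measurable M" for t using LY by (simp add: in_Lp_4_iff)
  obtain c U where U: "\<And>t T. t \<in> {1..T} \<Longrightarrow> U t T \<in> borel_measurable M \<and> (AE w in M. U t T w > 0) \<and>
      integrable M (\<lambda>w. U t T w powr \<rho>) \<and> (LINT w|M. U t T w powr \<rho>) < c \<and>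
      (AE w in M. norm (X t T w - Y (int t) w) \<le> (\<bar>real t / real T - u\<bar> + 1 / real T) * U t T w)"
  proof -
    obtain c and U :: "real \<Rightarrow> nat \<Rightarrow> nat \<Rightarrow> 'a \<Rightarrow> real" where
      *: "\<forall>u\<in>{0..1}. \<forall>T. \<forall>t\<in>{1..T}.
          U u t T \<in> borel_measurable M \<and> (AE w in M. U u t T w > 0) \<and>
          integrable M (\<lambda>w. U u t T w powr \<rho>) \<and> (LINT w|M. U u t T w powr \<rho>) < c \<and>
          (AE w in M. norm (X t T w - Xs u (int t) w) \<le> (\<bar>real t / real T - u\<bar> + 1 / real T) * U u t T w)"
      using loc unfolding locally_stationary_def by (elim conjE exE)
    show ?thesis using that[of "U u" c] bspec[OF * u01] unfolding Y_def by blast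
  qed
  have c0: "c \<ge> 0"
  proof -
    have "0 \<le> (LINT w|M. U 1 1 w powr \<rho>)" by simp
    also have "\<dots> < c" using U[of 1 1] by simp
    finally show ?thesis by simp
  qed
  obtain \<gamma> where \<gamma>: "summable \<gamma>" "\<And>m. \<gamma> m \<ge> 0" and cov: "\<And>e N s t. ortho_seq e \<Longrightarrow>
      (\<Sum>p\<in>{..<N}\<times>{..<N}. \<bar>(LINT w|M. coord_product e p (Y s w) * coord_product e p (Y t w))
        - (LINT w|M. coord_product e p (Y 0 w))\<^sup>2\<bar>) \<le> \<gamma> (nat \<bar>s - t\<bar>)"
    using summable_autocovariance[OF st approx[folded Y_def]] by blast
  define \<Gamma> where "\<Gamma> = suminf \<gamma>"
  have \<Gamma>0: "\<Gamma> \<ge> 0" unfolding \<Gamma>_def using \<gamma> by (intro suminf_nonneg)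
  obtain e :: "nat \<Rightarrow> 'h" where e: "ortho_seq e" "\<And>x. (\<lambda>N. ortho_proj e N x) \<longlonglongrightarrow> x"
    by (rule ortho_seq_complete_exists) blast
  define m2 where "m2 = (LINT w|M. (norm (Y 0 w))\<^sup>2)"
  have m2: "(LINT w|M. (norm (Y t w))\<^sup>2) = m2" for t
    unfolding m2_def by (rule strictly_stationary_single[OF st Ym]) simp
  have m20: "m2 \<ge> 0" by (simp add: m2_def)
  have L0: "L \<ge> 0" using K_lip by (rule lipschitz_on_nonneg)
  obtain b where b: "\<And>z. \<bar>K z\<bar> \<le> b"
    using K_bdd unfolding bounded_iff by auto
  have b0: "b \<ge> 0" using b[of 0] by linarith
  \<comment> \<open>A non-integrable function has Bochner integral 0, so the value 1 already implies
    integrability.\<close>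
  have K_integrable: "integrable lborel K" using K_int not_integrable_integral_eq by fastforce
  have abs_integrable: "integrable lborel (\<lambda>z. \<bar>K z\<bar>)" using K_integrable by simp
  have abs_lip: "L-lipschitz_on UNIV (\<lambda>z. \<bar>K z\<bar>)"
  proof (rule lipschitz_onI)
    fix x y
    have "dist \<bar>K x\<bar> \<bar>K y\<bar> \<le> dist (K x) (K y)" by (simp add: dist_real_def)
    also have "\<dots> \<le> L * dist x y" by (rule lipschitz_onD[OF K_lip]) auto
    finally show "dist \<bar>K x\<bar> \<bar>K y\<bar> \<le> L * dist x y" .
  qed (rule L0)
  have sq_lip: "(2 * b * L)-lipschitz_on UNIV (\<lambda>z. (K z)\<^sup>2)"
  proof (rule lipschitz_onI)
    fix x y
    have "dist ((K x)\<^sup>2) ((K y)\<^sup>2) = \<bar>K x + K y\<bar> * dist (K x) (K y)"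
      by (simp add: dist_real_def abs_mult[symmetric] power2_eq_square algebra_simps)
    also have "\<dots> \<le> (2 * b) * (L * dist x y)"
      using b[of x] b[of y] L0 by (intro mult_mono lipschitz_onD[OF K_lip]) auto
    finally show "dist ((K x)\<^sup>2) ((K y)\<^sup>2) \<le> 2 * b * L * dist x y" by (simp add: mult.assoc)
  qed (use b0 L0 in auto)
  have sq_integrable: "integrable lborel (\<lambda>z. (K z)\<^sup>2)"
  proof (rule Bochner_Integration.integrable_bound[of _ "\<lambda>z. b * \<bar>K z\<bar>"])
    show "integrable lborel (\<lambda>z. b * \<bar>K z\<bar>)" using abs_integrable by simp
    show "(\<lambda>z. (K z)\<^sup>2) \<in> borel_measurable lborel"
      using borel_measurable_integrable[OF K_integrable] by (rule borel_measurable_power)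
    show "AE z in lborel. norm ((K z)\<^sup>2) \<le> norm (b * \<bar>K z\<bar>)"
    proof (rule AE_I2)
      fix z
      have "\<bar>K z\<bar> * \<bar>K z\<bar> \<le> b * \<bar>K z\<bar>" using b by (intro mult_right_mono) auto
      then show "norm ((K z)\<^sup>2) \<le> norm (b * \<bar>K z\<bar>)" using b0 by (simp add: power2_eq_square abs_mult)
    qed
  qed
  define k1 where "k1 = (LINT z|lborel. \<bar>K z\<bar>)"
  define k2 where "k2 = (LINT z|lborel. (K z)\<^sup>2)"
  have k10: "k1 \<ge> 0" and k20: "k2 \<ge> 0" by (simp_all add: k1_def k2_def)
  \<comment> \<open>\<open>\<bar>C\<bar>\<close> takes the place of \<open>C\<close> in the
    constants, which saves an argument about its sign.\<close>
  define v where "v = (\<bar>C\<bar> + 2) * (1 + c) + m2"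
  have v0: "v \<ge> 0" using c0 m20 by (simp add: v_def)
  define c1 where "c1 = (\<bar>C\<bar> + 1) * (k1 + L) * v"
  define c2 where "c2 = 2 * \<Gamma> * (k2 + 2 * b * L)"
  have c10: "c1 \<ge> 0" using k10 L0 v0 by (simp add: c1_def)
  have c20: "c2 \<ge> 0" using k20 L0 b0 \<Gamma>0 by (simp add: c2_def)
  \<comment> \<open>Chosen so that \<open>(c1 + c2) / B0 < \<epsilon>\<close>. Being at least 1, it
    also allows the Chebyshev bound \<open>c2 / B0\<^sup>2\<close> to be replaced by
    \<open>c2 / B0\<close>.\<close>
  define B0 where "B0 = (c1 + c2) / \<epsilon> + 1"
  have B01: "B0 \<ge> 1" using c10 c20 e0 by (simp add: B0_def)
  \<comment> \<open>One \<open>B0\<close> each for the bias and the fluctuation, and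
    \<open>L * m2\<close> for the deviation of the kernel mass from 1.\<close>
  define B where "B = 2 * B0 + L * m2"
  have "B > 0" using B01 L0 m20 by (simp add: B_def add_pos_nonneg)
  moreover have "\<forall>\<^sub>F T in sequentially. \<exists>E\<in>sets M. prob E < \<epsilon> \<and> (\<forall>w\<in>space M - E. \<forall>x.
      norm (local_cov K h X u T w x - cov_op M (Xs u 0) x) \<le> B * cov_rate h T * norm x)"
  proof -
    \<comment> \<open>For \<open>h T < h0\<close> the kernel rescaled around \<open>u\<close> is
      supported inside the unit interval; this is how the interior condition on \<open>u\<close> is
      met for all large \<open>T\<close>.\<close>
    define h0 where "h0 = min 1 (min u (1 - u) / (\<bar>C\<bar> + 1))"
    have "h0 > 0" using u by (simp add: h0_def)
    then have "\<forall>\<^sub>F T in sequentially. h T < h0" by (intro order_tendstoD(2)[OF h_lim])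
    then show ?thesis using eventually_ge_at_top[of 1]
    proof eventually_elim
      case (elim T)
      have T: "T \<ge> 1" by fact
      have "h0 \<le> 1" by (simp add: h0_def)
      then have hT: "0 < h T" "h T \<le> 1" using h_pos[OF T] elim by simp_all
      define r where "r = cov_rate h T"
      have r0: "r > 0" unfolding r_def by (rule cov_rate_pos[where h = h, OF T hT])
      define k where "k t = K ((u - real t / real T) / h T)" for t :: nat
      have off: "K ((u - s) / h T) = 0" if "s \<notin> {0..1}" for s
      proof (rule K_supp)
        have "h T * (\<bar>C\<bar> + 1) < min u (1 - u)"
          using elim by (simp add: h0_def pos_less_divide_eq add_nonneg_pos)
        also have "\<dots> \<le> \<bar>u - s\<bar>" using that by auto
        finally have "\<bar>C\<bar> + 1 < \<bar>(u - s) / h T\<bar>" using hT by (simp add: abs_divide pos_less_divide_eq mult.commute)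
        then show "C < \<bar>(u - s) / h T\<bar>" by linarith
      qed
      have riem: "\<bar>(\<Sum>t=1..T. k t) / (real T * h T) - 1\<bar> \<le> L / (real T * (h T)\<^sup>2)"
        using kernel_riemann_sum[OF K_lip K_integrable off hT(1) T] by (simp add: k_def K_int)
      have riem1: "(\<Sum>t=1..T. \<bar>k t\<bar>) / (real T * h T) \<le> k1 + L / (real T * (h T)\<^sup>2)"
        using kernel_riemann_sum[OF abs_lip abs_integrable _ hT(1) T, of u] off by (simp add: k_def k1_def)
      have riem2: "(\<Sum>t=1..T. (k t)\<^sup>2) / (real T * h T) \<le> k2 + 2 * b * L / (real T * (h T)\<^sup>2)"
        using kernel_riemann_sum[OF sq_lip sq_integrable _ hT(1) T, of u] off by (simp add: k_def k2_def)
      \<comment> \<open>The stationary process as an array with identical rows, so that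
        \<open>local_cov\<close> applies to it.\<close>
      define Y' where "Y' t (T :: nat) = Y (int t)" for t T
      define G where "G w = local_cov_dist K h X Y' u T w" for w
      have G_int: "integrable M G" and "(LINT w|M. G w) \<le> (\<bar>C\<bar> * h T + 1 / real T) *
          ((\<Sum>t=1..T. \<bar>k t\<bar>) / (real T * h T)) * v"
        using expectation_local_cov_dist_le[of T X Y' U \<rho> c u h "\<bar>C\<bar>" K m2]
          LX LY U rho c0 T hT K_supp m2 by (simp_all add: Y'_def G_def[abs_def] k_def v_def)
      note this(2)
      also have "\<dots> \<le> (\<bar>C\<bar> * h T + 1 / real T) * (k1 + L / (real T * (h T)\<^sup>2)) * v"
        using riem1 v0 hT by (intro mult_right_mono mult_left_mono) auto
      also have "\<dots> \<le> (\<bar>C\<bar> + 1) * (k1 + L) * r * v"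
        unfolding r_def by (intro mult_right_mono bias_le_cov_rate T hT k10 L0 v0) auto
      finally have G_le: "(LINT w|M. G w) \<le> c1 * r" by (simp add: c1_def mult_ac)
      define a where "a t = k t / (real T * h T)" for t
      define cp where "cp p = (LINT w|M. coord_product e p (Y 0 w))" for p
      define Q where "Q N w = (\<Sum>p\<in>{..<N}\<times>{..<N}. (\<Sum>t=1..T. a t * (coord_product e p (Y (int t) w) - cp p))\<^sup>2)" for N w
      have cp: "(LINT w|M. coord_product e p (Y t w)) = cp p" for p t
        unfolding cp_def by (rule strictly_stationary_single[OF st Ym]) simp
      note var = variance_weighted_sum_le[OF e(1) LY \<gamma> cp cov[OF e(1), folded cp_def], where a = a and T = T]
      have Q_int: "integrable M (Q N)" for N using var(1)[of N] by (simp add: Q_def[abs_def])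
      have Q_le: "(LINT w|M. Q N w) \<le> c2 * r\<^sup>2" for N
      proof -
        have "(LINT w|M. Q N w) \<le> 2 * \<Gamma> * (\<Sum>t=1..T. (a t)\<^sup>2)"
          using var(2)[of N] by (simp add: Q_def \<Gamma>_def)
        also have "(\<Sum>t=1..T. (a t)\<^sup>2) = 1 / (real T * h T) * ((\<Sum>t=1..T. (k t)\<^sup>2) / (real T * h T))"
          by (simp add: a_def power_divide sum_divide_distrib[symmetric] power2_eq_square)
        also have "\<dots> \<le> 1 / (real T * h T) * (k2 + 2 * b * L / (real T * (h T)\<^sup>2))"
          using riem2 hT by (intro mult_left_mono) auto
        also have "\<dots> \<le> (k2 + 2 * b * L) * r\<^sup>2"
          unfolding r_def using b0 L0 by (intro variance_le_cov_rate T hT k20) auto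
        finally show ?thesis using \<Gamma>0 by (simp add: c2_def mult_left_mono mult.assoc)
      qed
      have Q_mono: "mono (\<lambda>N. Q N w)" for w
        unfolding Q_def by (intro monoI sum_mono2) auto
      define E1 where "E1 = {w \<in> space M. G w \<ge> B0 * r}"
      \<comment> \<open>Uniting over \<open>N\<close> makes all finite sections of \<open>F\<close>
        bounded simultaneously outside \<open>E2\<close>.\<close>
      define E2 where "E2 = {w \<in> space M. \<exists>N. Q N w \<ge> (B0 * r)\<^sup>2}"
      have Br: "B0 * r > 0" using B01 r0 by simp
      have G0: "G w \<ge> 0" for w
        unfolding G_def local_cov_dist_def using hT by (intro mult_nonneg_nonneg sum_nonneg) auto
      have Q0: "Q N w \<ge> 0" for N w unfolding Q_def by (intro sum_nonneg) auto
      have E1: "E1 \<in> sets M" unfolding E1_def using borel_measurable_integrable[OF G_int] by measurable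
      have pE1: "prob E1 \<le> c1 / B0"
      proof -
        have "prob E1 \<le> (LINT w|M. G w) / (B0 * r)"
          unfolding E1_def using integral_Markov_inequality_measure[OF G_int, of "{}" "B0 * r"] G0 Br by auto
        also have "\<dots> \<le> (c1 * r) / (B0 * r)" using G_le Br by (intro divide_right_mono) auto
        finally show ?thesis using r0 by simp
      qed
      have "0 < (B0 * r)\<^sup>2" using Br by (rule zero_less_power)
      note E2 = prob_exceeds_mono_sequence_le[OF Q_int Q0 Q_mono Q_le this, folded E2_def]
      have pE2: "prob E2 \<le> c2 / B0"
      proof -
        have "prob E2 \<le> (c2 * r\<^sup>2) / (B0 * r)\<^sup>2" by (rule E2(2))
        also have "\<dots> = c2 / B0\<^sup>2" using r0 by (simp add: power_mult_distrib)
        also have "\<dots> \<le> c2 / B0"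
          using B01 c20 by (intro divide_left_mono) (auto simp: power2_eq_square mult_le_cancel_left1)
        finally show ?thesis .
      qed
      have "prob (E1 \<union> E2) \<le> prob E1 + prob E2" by (rule measure_Un_le[OF E1 E2(1)])
      also have "\<dots> \<le> (c1 + c2) / B0" using pE1 pE2 by (simp add: add_divide_distrib)
      also have "\<dots> < \<epsilon>"
      proof -
        have "\<epsilon> * B0 = c1 + c2 + \<epsilon>" using e0 by (simp add: B0_def field_simps)
        then have "c1 + c2 < \<epsilon> * B0" using e0 by simp
        then show ?thesis using B01 by (simp add: pos_divide_less_eq)
      qed
      finally have prob_small: "prob (E1 \<union> E2) < \<epsilon>" .
      have Y2: "integrable M (\<lambda>w. (norm (Y 0 w))\<^sup>2)" using LY by (rule in_Lp_4_square_integrable)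
      note covC = bounded_linear_cov_op[OF Ym Y2] inner_cov_op[OF Ym Y2] norm_cov_op_le[OF Ym Y2]
      define \<kappa> where "\<kappa> = (\<Sum>t=1..T. k t) / (real T * h T)"
      have "norm (local_cov K h X u T w x - cov_op M (Y 0) x) \<le> B * r * norm x"
        if w: "w \<in> space M - (E1 \<union> E2)" for w x
      proof -
        define F where "F x = local_cov K h Y' u T w x - \<kappa> *\<^sub>R cov_op M (Y 0) x" for x
        have F: "bounded_linear F" unfolding F_def
          by (intro bounded_linear_sub bounded_linear_local_cov bounded_linear_compose[OF bounded_linear_scaleR_right covC(1)])
        \<comment> \<open>Because \<open>\<kappa>\<close> is built from the same weights, the matrix
          entries of \<open>F\<close> are centred weighted sums, exactly those squared and added in
          \<open>Q\<close>.\<close>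
        have entry: "inner (F (e i)) (e j) = (\<Sum>t=1..T. a t * (coord_product e (i, j) (Y (int t) w) - cp (i, j)))" for i j
        proof -
          have "inner (cov_op M (Y 0) (e i)) (e j) = cp (i, j)"
            by (simp add: covC(2) cp_def coord_product_def)
          then have "inner (F (e i)) (e j) = (1 / (real T * h T)) *
              (\<Sum>t=1..T. k t * coord_product e (i, j) (Y (int t) w)) - \<kappa> * cp (i, j)"
            by (simp add: F_def inner_diff_left inner_local_cov Y'_def coord_product_def k_def)
          then show ?thesis
            by (simp add: a_def \<kappa>_def right_diff_distrib sum_subtractf sum_distrib_right sum_distrib_left sum_divide_distrib)
        qed
        have F_le: "norm (F x) \<le> B0 * r * norm x"
        proof (rule norm_le_hilbert_schmidt[OF e F])
          fix N
          have "Q N w < (B0 * r)\<^sup>2" using w unfolding E2_def by (auto simp: not_le)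
          moreover have "(\<Sum>(i, j)\<in>{..<N}\<times>{..<N}. (inner (F (e i)) (e j))\<^sup>2) = Q N w"
            unfolding Q_def entry by (simp add: case_prod_unfold)
          ultimately show "(\<Sum>(i, j)\<in>{..<N}\<times>{..<N}. (inner (F (e i)) (e j))\<^sup>2) \<le> (B0 * r)\<^sup>2" by simp
        qed (use Br in simp)
        have "norm (local_cov K h X u T w x - local_cov K h Y' u T w x) \<le> G w * norm x"
          unfolding G_def by (rule norm_local_cov_diff_le) (rule hT(1))
        also have "\<dots> \<le> B0 * r * norm x"
          using w unfolding E1_def by (intro mult_right_mono) auto
        finally have X_le: "norm (local_cov K h X u T w x - local_cov K h Y' u T w x) \<le> B0 * r * norm x" .
        have "norm ((\<kappa> - 1) *\<^sub>R cov_op M (Y 0) x) = \<bar>\<kappa> - 1\<bar> * norm (cov_op M (Y 0) x)" by simp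
        also have "\<dots> \<le> (L / (real T * (h T)\<^sup>2)) * (m2 * norm x)"
          using riem covC(3)[of x] L0 by (intro mult_mono) (auto simp: \<kappa>_def m2_def)
        also have "\<dots> \<le> (L * r) * (m2 * norm x)"
        proof (rule mult_right_mono)
          have "L * (1 / (real T * (h T)\<^sup>2)) \<le> L * r"
            unfolding r_def by (intro mult_left_mono cov_rate_ge T hT L0)
          then show "L / (real T * (h T)\<^sup>2) \<le> L * r" by simp
        qed (use m20 in simp)
        finally have C_le: "norm ((\<kappa> - 1) *\<^sub>R cov_op M (Y 0) x) \<le> L * m2 * r * norm x" by (simp add: mult_ac)
        have "local_cov K h X u T w x - cov_op M (Y 0) x =
            (local_cov K h X u T w x - local_cov K h Y' u T w x) + F x + (\<kappa> - 1) *\<^sub>R cov_op M (Y 0) x"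
          by (simp add: F_def scaleR_diff_left)
        also have "norm \<dots> \<le> B0 * r * norm x + B0 * r * norm x + L * m2 * r * norm x"
          by (intro order_trans[OF norm_triangle_ineq] add_mono X_le F_le C_le)
        finally show ?thesis by (simp add: B_def algebra_simps)
      qed
      then show ?case
        using prob_small E1 E2(1) unfolding r_def Y_def by (intro bexI[of _ "E1 \<union> E2"]) auto
    qed
  qed
  ultimately show thesis by (rule that)
qed

end

text \<open>The good event speaks of the covariance operators only. On it the deterministic
  perturbation bounds apply to any choice of estimated eigenpairs, measurable or not, and its
  complement is the covering event that \<open>big_O_P\<close> asks for.\<close>

theorem corollary3p1:
  fixes M :: "'w measure" and S :: "'s measure"
    and X :: "nat \<Rightarrow> nat \<Rightarrow> 'w \<Rightarrow> 'd::finite L2_cube"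
    and Xs :: "real \<Rightarrow> int \<Rightarrow> 'w \<Rightarrow> 'd L2_cube"
    and K\<^sub>1 :: "real \<Rightarrow> real" and C\<^sub>1 \<rho> u :: real and h :: "nat \<Rightarrow> real" and q :: nat
    and lam :: "nat \<Rightarrow> real" and v :: "nat \<Rightarrow> 'd L2_cube"
    and lam_hat :: "nat \<Rightarrow> nat \<Rightarrow> 'w \<Rightarrow> real"
    and v_hat :: "nat \<Rightarrow> nat \<Rightarrow> 'w \<Rightarrow> 'd L2_cube"
  assumes prob: "prob_space M"
    and rho: "\<rho> \<ge> 2"
    and loc_stat: "locally_stationary M 4 \<rho> X Xs"
    and approx: "\<And>s. s \<in> {0..1} \<Longrightarrow> Lp_m_approximable M S 4 (Xs s)"
    and centred: "\<And>s t. s \<in> {0..1} \<Longrightarrow> (LINT w|M. Xs s t w) = 0"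
    and K_sym: "\<And>z. K\<^sub>1 (- z) = K\<^sub>1 z"
    and K_bdd: "bounded (range K\<^sub>1)"
    and K_lip: "\<exists>L. L-lipschitz_on UNIV K\<^sub>1"
    and K_supp: "\<And>z. \<bar>z\<bar> > C\<^sub>1 \<Longrightarrow> K\<^sub>1 z = 0"
    and K_int: "(LINT z|lborel. K\<^sub>1 z) = 1"
    and h_pos: "\<And>T. T \<ge> 1 \<Longrightarrow> h T > 0"
    and h_lim: "h \<longlonglongrightarrow> 0"
    and u: "u \<in> {0<..<1}"
    and q: "q \<ge> 1"
    and eig: "full_eigensystem (cov_op M (Xs u 0)) lam v"
    and gaps: "\<And>j. j \<in> {1..q} \<Longrightarrow> lam j > lam (j + 1)"
    and eig_hat: "\<And>T w. T \<ge> 1 \<Longrightarrow> w \<in> space M \<Longrightarrow>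
      leading_eigensystem (local_cov K\<^sub>1 h X u T w) q (\<lambda>j. lam_hat T j w) (\<lambda>j. v_hat T j w)"
  shows "big_O_P M (\<lambda>T w. Max ((\<lambda>j. \<bar>lam_hat T j w - lam j\<bar>) ` {1..q}))
           (\<lambda>T. h T + sqrt (1 / (real T * h T)) + 1 / (real T * (h T)\<^sup>2))
       \<and> big_O_P M (\<lambda>T w. Max ((\<lambda>j. norm (sgn (inner (v_hat T j w) (v j)) *\<^sub>R v_hat T j w - v j)) ` {1..q}))
           (\<lambda>T. h T + sqrt (1 / (real T * h T)) + 1 / (real T * (h T)\<^sup>2))"
proof -
  interpret prob_space M by (rule prob)
  obtain L where lip: "L-lipschitz_on UNIV K\<^sub>1" using K_lip by blast
  have approx_u: "Lp_m_approximable M S 4 (Xs u)" using u by (intro approx) simp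
  then have LY: "in_Lp M 4 (Xs u 0)" by (simp add: Lp_m_approximable_def)
  have Y: "Xs u 0 \<in> borel_measurable M" "integrable M (\<lambda>w. (norm (Xs u 0 w))\<^sup>2)"
    using LY by (simp_all add: in_Lp_4_iff in_Lp_4_square_integrable)
  \<comment> \<open>Smallest of the \<open>q\<close> gaps; the last of them separates
    \<open>lam q\<close> from \<open>lam (q + 1)\<close>.\<close>
  define g where "g = Min ((\<lambda>j. lam j - lam (j + 1)) ` {1..q})"
  have g0: "g > 0" unfolding g_def using q gaps by (subst Min_gr_iff) auto
  have gap: "lam (j + 1) + g \<le> lam j" if "j \<in> {1..q}" for j
  proof -
    have "g \<le> lam j - lam (j + 1)" unfolding g_def by (rule Min_le) (use that in auto)
    then show ?thesis by simp
  qed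
  have perturb: "\<bar>lam_hat T j w - lam j\<bar> \<le> 1 * \<Delta>"
      "norm (sgn (inner (v_hat T j w) (v j)) *\<^sub>R v_hat T j w - v j) \<le> 4 / g * \<Delta>"
    if "T \<ge> 1" "w \<in> space M" "j \<in> {1..q}"
      "\<And>x. norm (local_cov K\<^sub>1 h X u T w x - cov_op M (Xs u 0) x) \<le> \<Delta> * norm x" for T w j \<Delta>
  proof -
    have "finite ((\<lambda>t. X t T w) ` {1..T})" by simp
    note eigensystem_perturbation[OF bounded_linear_cov_op[OF Y] completely_continuous_cov_op[OF Y]
        cov_op_adjoint[OF Y] cov_op_nonneg[OF Y] eig g0 gap bounded_linear_local_cov
        completely_continuous_local_cov local_cov_adjoint this local_cov_kernel
        eig_hat[OF that(1,2)] that(4,3)]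
    then show "\<bar>lam_hat T j w - lam j\<bar> \<le> 1 * \<Delta>"
      "norm (sgn (inner (v_hat T j w) (v j)) *\<^sub>R v_hat T j w - v j) \<le> 4 / g * \<Delta>"
      by simp_all
  qed
  \<comment> \<open>Transfer for both claims: \<open>f\<close> is either error and \<open>c\<close>
    its perturbation constant, 1 for eigenvalues and \<open>4 / g\<close> for eigenvectors.\<close>
  have "big_O_P M (\<lambda>T w. Max (f T w ` {1..q})) (cov_rate h)"
    if nonneg: "\<And>T w j. f T w j \<ge> 0" and c: "c > 0"
      and le: "\<And>T w j \<Delta>. T \<ge> 1 \<Longrightarrow> w \<in> space M \<Longrightarrow> j \<in> {1..q} \<Longrightarrow>
        (\<And>x. norm (local_cov K\<^sub>1 h X u T w x - cov_op M (Xs u 0) x) \<le> \<Delta> * norm x) \<Longrightarrow> f T w j \<le> c * \<Delta>"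
    for f :: "nat \<Rightarrow> 'w \<Rightarrow> nat \<Rightarrow> real" and c
    unfolding big_O_P_def
  proof (intro allI impI)
    fix \<epsilon> :: real assume "\<epsilon> > 0"
    then obtain B where B: "B > 0" and ev: "\<forall>\<^sub>F T in sequentially. \<exists>E\<in>sets M. prob E < \<epsilon> \<and>
        (\<forall>w\<in>space M - E. \<forall>x. norm (local_cov K\<^sub>1 h X u T w x - cov_op M (Xs u 0) x) \<le> B * cov_rate h T * norm x)"
      using local_cov_rate[OF rho loc_stat u approx_u K_bdd lip K_supp K_int h_pos h_lim] by blast
    show "\<exists>B>0. \<forall>\<^sub>F T in sequentially. \<exists>E\<in>sets M.
        {w \<in> space M. \<bar>Max (f T w ` {1..q})\<bar> > B * cov_rate h T} \<subseteq> E \<and> prob E < \<epsilon>"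
    proof (intro exI[of _ "c * B"] conjI)
      show "c * B > 0" using B c by simp
      show "\<forall>\<^sub>F T in sequentially. \<exists>E\<in>sets M.
          {w \<in> space M. \<bar>Max (f T w ` {1..q})\<bar> > c * B * cov_rate h T} \<subseteq> E \<and> prob E < \<epsilon>"
        using ev eventually_ge_at_top[of 1]
      proof eventually_elim
        case (elim T)
        then obtain E where E: "E \<in> sets M" "prob E < \<epsilon>" "\<And>w x. w \<in> space M - E \<Longrightarrow>
            norm (local_cov K\<^sub>1 h X u T w x - cov_op M (Xs u 0) x) \<le> B * cov_rate h T * norm x"
          by blast
        have "\<bar>Max (f T w ` {1..q})\<bar> \<le> c * B * cov_rate h T" if w: "w \<in> space M - E" for w
        proof -
          have "Max (f T w ` {1..q}) \<in> f T w ` {1..q}" using q by (intro Max_in) auto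
          then obtain j where j: "j \<in> {1..q}" "Max (f T w ` {1..q}) = f T w j" by blast
          have "f T w j \<le> c * (B * cov_rate h T)" using elim w j E(3) by (intro le) auto
          then show ?thesis using nonneg[of T w j] unfolding j(2) by (simp add: mult.assoc)
        qed
        then have "{w \<in> space M. \<bar>Max (f T w ` {1..q})\<bar> > c * B * cov_rate h T} \<subseteq> E" by fastforce
        then show ?case using E by blast
      qed
    qed
  qed
  note main = this
  have "big_O_P M (\<lambda>T w. Max ((\<lambda>j. \<bar>lam_hat T j w - lam j\<bar>) ` {1..q})) (cov_rate h)"
    by (rule main[of _ 1]) (use perturb(1) in auto)
  moreover have "big_O_P M (\<lambda>T w. Max ((\<lambda>j. norm (sgn (inner (v_hat T j w) (v j)) *\<^sub>R v_hat T j w - v j)) ` {1..q}))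
      (cov_rate h)"
    by (rule main[of _ "4 / g"]) (use perturb(2) g0 in auto)
  ultimately show ?thesis unfolding cov_rate_def[abs_def] by blast
qed

end
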